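(* Let $\mathcal{M}$ be an exact category and let $\mathcal{P}$ be a full, additive subcategory of $\mathcal{M}$ that is closed under extensions. Suppose also that: (1) If $M' \rightarrowtail M \twoheadrightarrow M''$ is an exact sequence in $\mathcal{M}$ with $M$ and $M''$ in $\mathcal{P}$, then $M'$ is in $\mathcal{P}$ as well. (2) Given an admissible epimorphism $j : M \twoheadrightarrow P$ in $\mathcal{M}$ with $P$ in $\mathcal{P}$, there exist an admissible epimorphism $j' : P' \twoheadrightarrow P$ and a morphism $f : P' \to M$ in $\mathcal{M}$ with $P'$ in $\mathcal{P}$ such that $jf = j'$. (3) Every object of $\mathcal{M}$ has a finite resolution by objects of $\mathcal{P}$. Then the inclusion functor $\mathcal{P} \hookrightarrow \mathcal{M}$ induces an isomorphism $K_{n}\mathcal{P} \cong K_{n}\mathcal{M}$ for every $n \geq 0$.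
   Context: Exact categories are in the sense of Quillen: additive categories with a distinguished class of short exact sequences $N' \rightarrowtail N \twoheadrightarrow N''$ satisfying Quillen's axioms; $\twoheadrightarrow$ denotes admissible epimorphisms and $\rightarrowtail$ admissible monomorphisms. A full additive subcategory closed under extensions is an exact category, whose short exact sequences are those of the ambient category with all terms in the subcategory. Acyclic complexes: a bounded chain complex $(N,d)$ in an exact category $\mathcal{N}$ is acyclic (a long exact sequence) if each differential $d_k : N_k \to N_{k-1}$ factors as $N_k \twoheadrightarrow Z_{k-1} \rightarrowtail N_{k-1}$ such that each $Z_k \rightarrowtail N_k \twoheadrightarrow Z_{k-1}$ is a short exact sequence of $\mathcal{N}$. A finite resolution of $M$ by objects of $\mathcal{P}$ is a long exact sequence $0\to P_m\to\cdots\to P_0\to M\to 0$ in $\mathcal{M}$ with all $P_i$ in $\mathcal{P}$. Acyclic binary complexes: a bounded acyclic binary complex in $\mathcal{N}$ is a triple $(N,d,\tilde d)$ such that $(N,d)$ and $(N,\tilde d)$ are both bounded acyclic complexes in $\mathcal{N}$ on the same graded object. Morphisms are morphisms of graded objects commuting with both differentials, and a composable pair of morphisms is short exact if it is short exact term-wise in $\mathcal{N}$. This gives an exact category $B^{\mathrm{q}}\mathcal{N}$. Put $(B^{\mathrm{q}})^{0}\mathcal{N}=\mathcal{N}$ and $(B^{\mathrm{q}})^{n}\mathcal{N} = B^{\mathrm{q}}\cdots B^{\mathrm{q}}\mathcal{N}$ ($n$ times). Equivalently, an object of $(B^{\mathrm{q}})^{n}\mathcal{N}$ (a bounded acyclic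 binary multicomplex of dimension $n$) is a bounded $\mathbb{Z}^n$-graded collection of objects of $\mathcal{N}$ with a pair of acyclic differentials $d^i,\tilde d^i$ in each direction $1\le i\le n$, such that any two differentials in different directions commute. An object of $(B^{\mathrm{q}})^{n}\mathcal{N}$ is diagonal in direction $i$ if $d^i=\tilde d^i$, and diagonal if it is diagonal in at least one direction $i$. $K$-groups: for $n\ge 0$, $K_n\mathcal{N}$ is defined as the abelian group with one generator $[N]$ for each object $N$ of $(B^{\mathrm{q}})^{n}\mathcal{N}$, and relations $[N']+[N'']=[N]$ for each short exact sequence $N'\rightarrowtail N\twoheadrightarrow N''$ in $(B^{\mathrm{q}})^{n}\mathcal{N}$, and $[T]=0$ for each diagonal object $T$. For $n=0$ there are no diagonal objects and $K_0\mathcal{N}$ is the Grothendieck group. An exact functor induces homomorphisms on all $K_n$ by being applied term-wise to multicomplexes. *)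

theory Defs
  imports "HOL-Algebra.Free_Abelian_Groups"
begin

section \<open>Additive categories\<close>

text \<open>
  A small category is given by a set of objects and a set of morphisms for each pair of objects.
  The sets \<open>Hom X Y\<close> are not required to be disjoint, so a morphism is only
  meaningful together with its source and target.  Composition is written in the usual order:
  \<open>g \<cdot> f\<close> is \<open>f\<close> followed by \<open>g\<close>.
\<close>

record ('o, 'm) additive_cat =
  Obj :: "'o set"
  Hom :: "'o \<Rightarrow> 'o \<Rightarrow> 'm set"
  Comp :: "'m \<Rightarrow> 'm \<Rightarrow> 'm"  (infixr \<open>\<cdot>\<index>\<close> 70)
  Ident :: "'o \<Rightarrow> 'm"
  Plus :: "'m \<Rightarrow> 'm \<Rightarrow> 'm"
  Zero :: "'o \<Rightarrow> 'o \<Rightarrow> 'm"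

locale category =
  fixes C :: "('o, 'm, 'z) additive_cat_scheme" (structure)
  assumes ident_closed: "X \<in> Obj C \<Longrightarrow> Ident C X \<in> Hom C X X"
    and comp_closed: "\<lbrakk>X \<in> Obj C; Y \<in> Obj C; Z \<in> Obj C; f \<in> Hom C X Y; g \<in> Hom C Y Z\<rbrakk>
      \<Longrightarrow> g \<cdot> f \<in> Hom C X Z"
    and comp_assoc: "\<lbrakk>W \<in> Obj C; X \<in> Obj C; Y \<in> Obj C; Z \<in> Obj C;
      f \<in> Hom C W X; g \<in> Hom C X Y; h \<in> Hom C Y Z\<rbrakk> \<Longrightarrow> (h \<cdot> g) \<cdot> f = h \<cdot> (g \<cdot> f)"
    and ident_left: "\<lbrakk>X \<in> Obj C; Y \<in> Obj C; f \<in> Hom C X Y\<rbrakk> \<Longrightarrow> Ident C Y \<cdot> f = f"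
    and ident_right: "\<lbrakk>X \<in> Obj C; Y \<in> Obj C; f \<in> Hom C X Y\<rbrakk> \<Longrightarrow> f \<cdot> Ident C X = f"

definition hom_group :: "('o, 'm, 'z) additive_cat_scheme \<Rightarrow> 'o \<Rightarrow> 'o \<Rightarrow> 'm monoid" where
  "hom_group C X Y = \<lparr>carrier = Hom C X Y, mult = Plus C, one = Zero C X Y\<rparr>"

locale preadditive_category = category +
  assumes hom_comm_group: "\<lbrakk>X \<in> Obj C; Y \<in> Obj C\<rbrakk> \<Longrightarrow> comm_group (hom_group C X Y)"
    and comp_plus_left: "\<lbrakk>X \<in> Obj C; Y \<in> Obj C; Z \<in> Obj C;
      f \<in> Hom C X Y; g \<in> Hom C Y Z; g' \<in> Hom C Y Z\<rbrakk>
      \<Longrightarrow> Plus C g g' \<cdot> f = Plus C (g \<cdot> f) (g' \<cdot> f)"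
    and comp_plus_right: "\<lbrakk>X \<in> Obj C; Y \<in> Obj C; Z \<in> Obj C;
      f \<in> Hom C X Y; f' \<in> Hom C X Y; g \<in> Hom C Y Z\<rbrakk>
      \<Longrightarrow> g \<cdot> Plus C f f' = Plus C (g \<cdot> f) (g \<cdot> f')"

definition zero_object :: "('o, 'm, 'z) additive_cat_scheme \<Rightarrow> 'o \<Rightarrow> bool" where
  "zero_object C Z \<longleftrightarrow> Z \<in> Obj C \<and>
     (\<forall>X \<in> Obj C. (\<exists>!f. f \<in> Hom C X Z) \<and> (\<exists>!f. f \<in> Hom C Z X))"

definition biproduct ::
  "('o, 'm, 'z) additive_cat_scheme \<Rightarrow> 'o \<Rightarrow> 'o \<Rightarrow> 'o \<Rightarrow> 'm \<Rightarrow> 'm \<Rightarrow> 'm \<Rightarrow> 'm \<Rightarrow> bool"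
where
  "biproduct C X Y S inX inY prX prY \<longleftrightarrow>
     X \<in> Obj C \<and> Y \<in> Obj C \<and> S \<in> Obj C \<and>
     inX \<in> Hom C X S \<and> inY \<in> Hom C Y S \<and> prX \<in> Hom C S X \<and> prY \<in> Hom C S Y \<and>
     prX \<cdot>\<^bsub>C\<^esub> inX = Ident C X \<and> prY \<cdot>\<^bsub>C\<^esub> inY = Ident C Y \<and>
     prY \<cdot>\<^bsub>C\<^esub> inX = Zero C X Y \<and> prX \<cdot>\<^bsub>C\<^esub> inY = Zero C Y X \<and>
     Plus C (inX \<cdot>\<^bsub>C\<^esub> prX) (inY \<cdot>\<^bsub>C\<^esub> prY) = Ident C S"

locale additive_category = preadditive_category +
  assumes zero_object_exists: "\<exists>Z. zero_object C Z"
    and biproduct_exists: "\<lbrakk>X \<in> Obj C; Y \<in> Obj C\<rbrakk>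
      \<Longrightarrow> \<exists>S inX inY prX prY. biproduct C X Y S inX inY prX prY"

definition iso_mor :: "('o, 'm, 'z) additive_cat_scheme \<Rightarrow> 'o \<Rightarrow> 'm \<Rightarrow> 'o \<Rightarrow> bool" where
  "iso_mor C X f Y \<longleftrightarrow> f \<in> Hom C X Y \<and>
     (\<exists>g \<in> Hom C Y X. g \<cdot>\<^bsub>C\<^esub> f = Ident C X \<and> f \<cdot>\<^bsub>C\<^esub> g = Ident C Y)"

text \<open>\<open>is_kernel C K k A f B\<close>: the morphism \<open>k : K \<rightarrow> A\<close> is a kernel of \<open>f : A \<rightarrow> B\<close>; dually for cokernels.\<close>

definition is_kernel ::
  "('o, 'm, 'z) additive_cat_scheme \<Rightarrow> 'o \<Rightarrow> 'm \<Rightarrow> 'o \<Rightarrow> 'm \<Rightarrow> 'o \<Rightarrow> bool" where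
  "is_kernel C K k A f B \<longleftrightarrow>
     K \<in> Obj C \<and> A \<in> Obj C \<and> B \<in> Obj C \<and> k \<in> Hom C K A \<and> f \<in> Hom C A B \<and>
     f \<cdot>\<^bsub>C\<^esub> k = Zero C K B \<and>
     (\<forall>T \<in> Obj C. \<forall>t \<in> Hom C T A. f \<cdot>\<^bsub>C\<^esub> t = Zero C T B
        \<longrightarrow> (\<exists>!u. u \<in> Hom C T K \<and> k \<cdot>\<^bsub>C\<^esub> u = t))"

definition is_cokernel ::
  "('o, 'm, 'z) additive_cat_scheme \<Rightarrow> 'o \<Rightarrow> 'm \<Rightarrow> 'o \<Rightarrow> 'm \<Rightarrow> 'o \<Rightarrow> bool" where
  "is_cokernel C A f B q Q \<longleftrightarrow>
     A \<in> Obj C \<and> B \<in> Obj C \<and> Q \<in> Obj C \<and> f \<in> Hom C A B \<and> q \<in> Hom C B Q \<and>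
     q \<cdot>\<^bsub>C\<^esub> f = Zero C A Q \<and>
     (\<forall>T \<in> Obj C. \<forall>t \<in> Hom C B T. t \<cdot>\<^bsub>C\<^esub> f = Zero C A T
        \<longrightarrow> (\<exists>!u. u \<in> Hom C Q T \<and> u \<cdot>\<^bsub>C\<^esub> q = t))"

text \<open>
  \<open>is_pullback C D f' p' B C' p f A\<close>: the square with \<open>f' : D \<rightarrow> B\<close>, \<open>p' : D \<rightarrow> C'\<close>,
  \<open>p : B \<rightarrow> A\<close>, \<open>f : C' \<rightarrow> A\<close> is cartesian; dually for cocartesian squares.
\<close>

definition is_pullback ::
  "('o, 'm, 'z) additive_cat_scheme \<Rightarrow> 'o \<Rightarrow> 'm \<Rightarrow> 'm \<Rightarrow> 'o \<Rightarrow> 'o \<Rightarrow> 'm \<Rightarrow> 'm \<Rightarrow> 'o \<Rightarrow> bool"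
where
  "is_pullback C D f' p' B C' p f A \<longleftrightarrow>
     D \<in> Obj C \<and> B \<in> Obj C \<and> C' \<in> Obj C \<and> A \<in> Obj C \<and>
     f' \<in> Hom C D B \<and> p' \<in> Hom C D C' \<and> p \<in> Hom C B A \<and> f \<in> Hom C C' A \<and>
     p \<cdot>\<^bsub>C\<^esub> f' = f \<cdot>\<^bsub>C\<^esub> p' \<and>
     (\<forall>T \<in> Obj C. \<forall>s \<in> Hom C T B. \<forall>t \<in> Hom C T C'. p \<cdot>\<^bsub>C\<^esub> s = f \<cdot>\<^bsub>C\<^esub> t
        \<longrightarrow> (\<exists>!u. u \<in> Hom C T D \<and> f' \<cdot>\<^bsub>C\<^esub> u = s \<and> p' \<cdot>\<^bsub>C\<^esub> u = t))"

definition is_pushout ::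
  "('o, 'm, 'z) additive_cat_scheme \<Rightarrow> 'o \<Rightarrow> 'm \<Rightarrow> 'm \<Rightarrow> 'o \<Rightarrow> 'o \<Rightarrow> 'm \<Rightarrow> 'm \<Rightarrow> 'o \<Rightarrow> bool"
where
  "is_pushout C A i f B C' f' i' D \<longleftrightarrow>
     A \<in> Obj C \<and> B \<in> Obj C \<and> C' \<in> Obj C \<and> D \<in> Obj C \<and>
     i \<in> Hom C A B \<and> f \<in> Hom C A C' \<and> f' \<in> Hom C B D \<and> i' \<in> Hom C C' D \<and>
     f' \<cdot>\<^bsub>C\<^esub> i = i' \<cdot>\<^bsub>C\<^esub> f \<and>
     (\<forall>T \<in> Obj C. \<forall>s \<in> Hom C B T. \<forall>t \<in> Hom C C' T. s \<cdot>\<^bsub>C\<^esub> i = t \<cdot>\<^bsub>C\<^esub> f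
        \<longrightarrow> (\<exists>!u. u \<in> Hom C D T \<and> u \<cdot>\<^bsub>C\<^esub> f' = s \<and> u \<cdot>\<^bsub>C\<^esub> i' = t))"


section \<open>Exact categories\<close>

text \<open>\<open>Ses C A i B p D\<close>: the sequence \<open>A \<rightarrow> B \<rightarrow> D\<close> with maps \<open>i\<close>, \<open>p\<close> is a distinguished short exact sequence.\<close>

record ('o, 'm) exact_cat = "('o, 'm) additive_cat" +
  Ses :: "'o \<Rightarrow> 'm \<Rightarrow> 'o \<Rightarrow> 'm \<Rightarrow> 'o \<Rightarrow> bool"

definition admissible_mono :: "('o, 'm) exact_cat \<Rightarrow> 'o \<Rightarrow> 'm \<Rightarrow> 'o \<Rightarrow> bool" where
  "admissible_mono C A i B \<longleftrightarrow> (\<exists>D p. Ses C A i B p D)"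

definition admissible_epi :: "('o, 'm) exact_cat \<Rightarrow> 'o \<Rightarrow> 'm \<Rightarrow> 'o \<Rightarrow> bool" where
  "admissible_epi C B p D \<longleftrightarrow> (\<exists>A i. Ses C A i B p D)"

text \<open>
  Quillen's axioms in their original form, including the last pair of axioms
  (\<open>epi_cancel\<close>, \<open>mono_cancel\<close>), which Keller showed to follow from the others.
  Well-typedness of distinguished sequences is part of \<open>ses_kernel\<close> and \<open>ses_cokernel\<close>.
\<close>

locale exact_category = additive_category C for C :: "('o, 'm) exact_cat" (structure) +
  assumes ses_kernel: "Ses C A i B p D \<Longrightarrow> is_kernel C A i B p D"
    and ses_cokernel: "Ses C A i B p D \<Longrightarrow> is_cokernel C A i B p D"
    and ses_split: "biproduct C X Y S inX inY prX prY \<Longrightarrow> Ses C X inX S prY Y"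
    and ses_iso: "\<lbrakk>Ses C A i B p D; A' \<in> Obj C; B' \<in> Obj C; D' \<in> Obj C;
      i' \<in> Hom C A' B'; p' \<in> Hom C B' D';
      iso_mor C A a A'; iso_mor C B b B'; iso_mor C D d D';
      b \<cdot> i = i' \<cdot> a; d \<cdot> p = p' \<cdot> b\<rbrakk> \<Longrightarrow> Ses C A' i' B' p' D'"
    and epi_comp: "\<lbrakk>admissible_epi C X p Y; admissible_epi C Y q Z\<rbrakk>
      \<Longrightarrow> admissible_epi C X (q \<cdot> p) Z"
    and mono_comp: "\<lbrakk>admissible_mono C X i Y; admissible_mono C Y j Z\<rbrakk>
      \<Longrightarrow> admissible_mono C X (j \<cdot> i) Z"
    and epi_base_change: "\<lbrakk>admissible_epi C B p A; C' \<in> Obj C; f \<in> Hom C C' A\<rbrakk>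
      \<Longrightarrow> \<exists>D f' p'. is_pullback C D f' p' B C' p f A \<and> admissible_epi C D p' C'"
    and mono_cobase_change: "\<lbrakk>admissible_mono C A i B; C' \<in> Obj C; f \<in> Hom C A C'\<rbrakk>
      \<Longrightarrow> \<exists>D f' i'. is_pushout C A i f B C' f' i' D \<and> admissible_mono C C' i' D"
    and epi_cancel: "\<lbrakk>is_kernel C K k X f Y; N \<in> Obj C; e \<in> Hom C N X;
      admissible_epi C N (f \<cdot> e) Y\<rbrakk> \<Longrightarrow> admissible_epi C X f Y"
    and mono_cancel: "\<lbrakk>is_cokernel C X f Y q Q; N \<in> Obj C; e \<in> Hom C Y N;
      admissible_mono C X (e \<cdot> f) N\<rbrakk> \<Longrightarrow> admissible_mono C X f Y"

definition full_subcategory :: "('o, 'm) exact_cat \<Rightarrow> 'o set \<Rightarrow> ('o, 'm) exact_cat" where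
  "full_subcategory C P = C\<lparr>Obj := P,
     Ses := (\<lambda>A i B p D. Ses C A i B p D \<and> A \<in> P \<and> B \<in> P \<and> D \<in> P)\<rparr>"

definition closed_under_extensions :: "('o, 'm) exact_cat \<Rightarrow> 'o set \<Rightarrow> bool" where
  "closed_under_extensions C P \<longleftrightarrow>
     (\<forall>A i B p D. Ses C A i B p D \<and> A \<in> P \<and> D \<in> P \<longrightarrow> B \<in> P)"


section \<open>Bounded acyclic complexes\<close>

text \<open>A complex is a family \<open>N\<close> of objects with differentials \<open>d k : N k \<rightarrow> N (k - 1)\<close>, for all integers \<open>k\<close>.\<close>

definition chain_complex ::
  "('o, 'm, 'z) additive_cat_scheme \<Rightarrow> (int \<Rightarrow> 'o) \<Rightarrow> (int \<Rightarrow> 'm) \<Rightarrow> bool" where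
  "chain_complex C N d \<longleftrightarrow>
     (\<forall>k. N k \<in> Obj C \<and> d k \<in> Hom C (N k) (N (k - 1)) \<and>
          d (k - 1) \<cdot>\<^bsub>C\<^esub> d k = Zero C (N k) (N (k - 2)))"

definition bounded_graded :: "('o, 'm, 'z) additive_cat_scheme \<Rightarrow> (int \<Rightarrow> 'o) \<Rightarrow> bool" where
  "bounded_graded C N \<longleftrightarrow> (\<exists>a b. \<forall>k. k < a \<or> b < k \<longrightarrow> zero_object C (N k))"

definition acyclic_complex ::
  "('o, 'm) exact_cat \<Rightarrow> (int \<Rightarrow> 'o) \<Rightarrow> (int \<Rightarrow> 'm) \<Rightarrow> bool" where
  "acyclic_complex C N d \<longleftrightarrow> chain_complex C N d \<and> bounded_graded C N \<and>
     (\<exists>Z i p. \<forall>k. Ses C (Z k) (i k) (N k) (p k) (Z (k - 1)) \<and>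
                  d k = i (k - 1) \<cdot>\<^bsub>C\<^esub> p k)"

text \<open>A resolution \<open>0 \<rightarrow> N m \<rightarrow> \<dots> \<rightarrow> N 0 \<rightarrow> X \<rightarrow> 0\<close>, where \<open>X\<close> is placed in degree \<open>-1\<close>.\<close>

definition has_finite_resolution :: "('o, 'm) exact_cat \<Rightarrow> 'o set \<Rightarrow> 'o \<Rightarrow> bool" where
  "has_finite_resolution C P X \<longleftrightarrow>
     (\<exists>N d (m :: nat). acyclic_complex C N d \<and> N (-1) = X \<and>
        (\<forall>k. 0 \<le> k \<and> k \<le> int m \<longrightarrow> N k \<in> P) \<and>
        (\<forall>k. k < -1 \<or> int m < k \<longrightarrow> zero_object C (N k)))"


section \<open>Acyclic binary multicomplexes\<close>

text \<open>
  To iterate the construction of binary complexes an arbitrary number of times within a single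
  type, objects and morphisms are taken in the following types of iterated
  binary complexes and iterated graded morphisms.
\<close>

datatype 'm multi_mor =
    Base_mor (base_mor: 'm)
  | Graded_mor (mor_at: "int \<Rightarrow> 'm multi_mor")

datatype ('o, 'm) multi_obj =
    Base_obj (base_obj: 'o)
  | Binary (obj_at: "int \<Rightarrow> ('o, 'm) multi_obj")
      (diff: "int \<Rightarrow> 'm multi_mor") (diff': "int \<Rightarrow> 'm multi_mor")

text \<open>A copy of \<open>C\<close> inside these types (multicomplexes of dimension \<open>0\<close>).\<close>

definition base_cat ::
  "('o, 'm) exact_cat \<Rightarrow> (('o, 'm) multi_obj, 'm multi_mor) exact_cat" where
  "base_cat C = \<lparr>
     Obj = Base_obj ` Obj C,
     Hom = (\<lambda>X Y. Base_mor ` Hom C (base_obj X) (base_obj Y)),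
     Comp = (\<lambda>g f. Base_mor (base_mor g \<cdot>\<^bsub>C\<^esub> base_mor f)),
     Ident = (\<lambda>X. Base_mor (Ident C (base_obj X))),
     Plus = (\<lambda>f g. Base_mor (Plus C (base_mor f) (base_mor g))),
     Zero = (\<lambda>X Y. Base_mor (Zero C (base_obj X) (base_obj Y))),
     Ses = (\<lambda>A i B p D.
       A \<in> Base_obj ` Obj C \<and> B \<in> Base_obj ` Obj C \<and> D \<in> Base_obj ` Obj C \<and>
       i \<in> range Base_mor \<and> p \<in> range Base_mor \<and>
       Ses C (base_obj A) (base_mor i) (base_obj B) (base_mor p) (base_obj D))\<rparr>"

definition binary_objects ::
  "(('o, 'm) multi_obj, 'm multi_mor) exact_cat \<Rightarrow> ('o, 'm) multi_obj set" where
  "binary_objects C = {Binary N d d' | N d d'. acyclic_complex C N d \<and> acyclic_complex C N d'}"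

definition binary_homs ::
  "(('o, 'm) multi_obj, 'm multi_mor) exact_cat
   \<Rightarrow> ('o, 'm) multi_obj \<Rightarrow> ('o, 'm) multi_obj \<Rightarrow> 'm multi_mor set" where
  "binary_homs C X Y = {Graded_mor f | f. \<forall>k.
     f k \<in> Hom C (obj_at X k) (obj_at Y k) \<and>
     f (k - 1) \<cdot>\<^bsub>C\<^esub> diff X k = diff Y k \<cdot>\<^bsub>C\<^esub> f k \<and>
     f (k - 1) \<cdot>\<^bsub>C\<^esub> diff' X k = diff' Y k \<cdot>\<^bsub>C\<^esub> f k}"

definition Bq ::
  "(('o, 'm) multi_obj, 'm multi_mor) exact_cat
   \<Rightarrow> (('o, 'm) multi_obj, 'm multi_mor) exact_cat" where
  "Bq C = \<lparr>
     Obj = binary_objects C,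
     Hom = binary_homs C,
     Comp = (\<lambda>g f. Graded_mor (\<lambda>k. mor_at g k \<cdot>\<^bsub>C\<^esub> mor_at f k)),
     Ident = (\<lambda>X. Graded_mor (\<lambda>k. Ident C (obj_at X k))),
     Plus = (\<lambda>f g. Graded_mor (\<lambda>k. Plus C (mor_at f k) (mor_at g k))),
     Zero = (\<lambda>X Y. Graded_mor (\<lambda>k. Zero C (obj_at X k) (obj_at Y k))),
     Ses = (\<lambda>A i B p D.
       A \<in> binary_objects C \<and> B \<in> binary_objects C \<and> D \<in> binary_objects C \<and>
       i \<in> binary_homs C A B \<and> p \<in> binary_homs C B D \<and>
       (\<forall>k. Ses C (obj_at A k) (mor_at i k) (obj_at B k) (mor_at p k) (obj_at D k)))\<rparr>"

definition multi_cat ::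
  "nat \<Rightarrow> ('o, 'm) exact_cat \<Rightarrow> (('o, 'm) multi_obj, 'm multi_mor) exact_cat" where
  "multi_cat n C = (Bq ^^ n) (base_cat C)"

text \<open>
  Directions are numbered \<open>0, \<dots>, n - 1\<close> from the outermost to the innermost binary complex
  structure.
\<close>

primrec diagonal_in_direction :: "nat \<Rightarrow> ('o, 'm) multi_obj \<Rightarrow> bool" where
  "diagonal_in_direction 0 X \<longleftrightarrow> diff X = diff' X"
| "diagonal_in_direction (Suc i) X \<longleftrightarrow> (\<forall>k. diagonal_in_direction i (obj_at X k))"

definition diagonal :: "nat \<Rightarrow> ('o, 'm) multi_obj \<Rightarrow> bool" where
  "diagonal n X \<longleftrightarrow> (\<exists>i < n. diagonal_in_direction i X)"


section \<open>K-groups\<close>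

definition K_relators :: "nat \<Rightarrow> ('o, 'm) exact_cat \<Rightarrow> (('o, 'm) multi_obj \<Rightarrow>\<^sub>0 int) set" where
  "K_relators n C =
     {frag_of X' + frag_of X'' - frag_of X | X' i X p X''. Ses (multi_cat n C) X' i X p X''} \<union>
     {frag_of T | T. T \<in> Obj (multi_cat n C) \<and> diagonal n T}"

definition K_relations :: "nat \<Rightarrow> ('o, 'm) exact_cat \<Rightarrow> (('o, 'm) multi_obj \<Rightarrow>\<^sub>0 int) set" where
  "K_relations n C = generate (free_Abelian_group (Obj (multi_cat n C))) (K_relators n C)"

definition K_group :: "nat \<Rightarrow> ('o, 'm) exact_cat \<Rightarrow> (('o, 'm) multi_obj \<Rightarrow>\<^sub>0 int) set monoid" where
  "K_group n C = free_Abelian_group (Obj (multi_cat n C)) Mod K_relations n C"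

text \<open>
  The map of K-groups induced by an exact functor given by \<open>F\<close> on objects and \<open>G\<close> on morphisms:
  it sends the class of a generator \<open>X\<close> to the class of the multicomplex obtained from \<open>X\<close> by
  applying the functor term-wise.
\<close>

definition K_map ::
  "nat \<Rightarrow> ('o, 'm) exact_cat \<Rightarrow> ('p, 'q) exact_cat \<Rightarrow> ('o \<Rightarrow> 'p) \<Rightarrow> ('m \<Rightarrow> 'q)
   \<Rightarrow> (('o, 'm) multi_obj \<Rightarrow>\<^sub>0 int) set \<Rightarrow> (('p, 'q) multi_obj \<Rightarrow>\<^sub>0 int) set" where
  "K_map n C D F G = (\<lambda>c. the_elem
     ((\<lambda>x. K_relations n D #>\<^bsub>free_Abelian_group (Obj (multi_cat n D))\<^esub>
              frag_extend (\<lambda>X. frag_of (map_multi_obj F G X)) x) ` c))"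

end

(*
  Every object of (B^q)^n M is an admissible quotient of an object of (B^q)^n P, and if the given
  object is diagonal in a direction, then the covering object can be chosen diagonal in the same
  direction.  The covering complex of a binary complex N is built degree by degree from covers of
  the N k, starting at the top; it also covers the cycles of both differentials, and this makes the
  kernel acyclic.

  Consequently every object X of (B^q)^n M has a finite resolution by objects of (B^q)^n P, and the
  inverse of K_n P -> K_n M sends [X] to the alternating sum of the classes of a resolution.
  Additivity of this assignment requires no lifting of resolutions: given X' >-> X ->> X'' and a
  cover Q ->> X with kernel K, let R be the kernel of Q ->> X ->> X''.  Then K >-> R ->> X', so the
  three covers K >-> Q ->> X, R >-> Q ->> X'' and K >-> R ->> X' show that
  ([Q] - [K]) = ([R] - [K]) + ([Q] - [R]).  On a diagonal object the value vanishes because all terms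
  of the resolution can be taken diagonal in the same direction.
*)

theory Submission
  imports Defs
begin

text \<open>Multicomplexes are treated by iterating \<open>Bq\<close>, so every notion has to
  survive one application of \<open>Bq\<close>. Most constructions are degreewise, but acyclicity is
  not a degreewise property: the kernel of a degreewise admissible epimorphism of acyclic complexes
  may fail to be acyclic. The axioms of \<open>deflation_exact\<close> therefore supply each new
  object together with a presentation as an extension, and extensions of acyclic complexes are
  acyclic.

  A cover adapted to one differential need not be compatible with the other. Each degree of the
  cover therefore contains the cycle object handed down from the degree above twice, once per
  differential, besides a cover of the term of \<open>N\<close>. Going from the top downwards, a map
  only has to be extended to a direct sum, which is always possible; upwards it would have to be
  lifted along an epimorphism. For a diagonal object a single copy suffices and keeps the
  differentials equal.

  Resolutions of multicomplexes are never built in one piece: by Schanuel's argument the kernel of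
  any cover by the class has smaller dimension, and boundedness of complexes makes the degreewise
  dimensions uniform.\<close>

section \<open>Arrows in preadditive categories\<close>

text \<open>Hom sets may overlap, and the category axioms ask for membership of all objects in
  \<open>Obj C\<close>. Carrying both pieces of information in one predicate lets composites be
  typed by chaining facts with \<open>OF\<close>.\<close>

definition arrow :: "('o, 'm, 'z) additive_cat_scheme \<Rightarrow> 'm \<Rightarrow> 'o \<Rightarrow> 'o \<Rightarrow> bool" where
  "arrow C f X Y \<longleftrightarrow> X \<in> Obj C \<and> Y \<in> Obj C \<and> f \<in> Hom C X Y"

lemma arrow_objD: "arrow C f X Y \<Longrightarrow> X \<in> Obj C" "arrow C f X Y \<Longrightarrow> Y \<in> Obj C"
  and arrow_homD: "arrow C f X Y \<Longrightarrow> f \<in> Hom C X Y"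
  by (simp_all add: arrow_def)

context category
begin

lemma arrow_ident: "X \<in> Obj C \<Longrightarrow> arrow C (Ident C X) X X"
  by (simp add: arrow_def ident_closed)

lemma arrow_comp: "\<lbrakk>arrow C f X Y; arrow C g Y Z\<rbrakk> \<Longrightarrow> arrow C (g \<cdot> f) X Z"
  by (auto simp: arrow_def intro: comp_closed)

lemma assoc:
  "\<lbrakk>arrow C f W X; arrow C g X Y; arrow C h Y Z\<rbrakk> \<Longrightarrow> (h \<cdot> g) \<cdot> f = h \<cdot> (g \<cdot> f)"
  by (meson arrow_def comp_assoc)

lemma id_left: "arrow C f X Y \<Longrightarrow> Ident C Y \<cdot> f = f"
  and id_right: "arrow C f X Y \<Longrightarrow> f \<cdot> Ident C X = f"
  by (auto simp: arrow_def ident_left ident_right)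

lemma iso_morI:
  "\<lbrakk>arrow C f X Y; arrow C g Y X; g \<cdot> f = Ident C X; f \<cdot> g = Ident C Y\<rbrakk> \<Longrightarrow> iso_mor C X f Y"
  unfolding iso_mor_def arrow_def by blast

lemma iso_ident: "X \<in> Obj C \<Longrightarrow> iso_mor C X (Ident C X) X"
  by (rule iso_morI[OF arrow_ident arrow_ident]) (simp_all add: ident_left ident_closed)

end

context preadditive_category
begin

lemma arrow_zero: "\<lbrakk>X \<in> Obj C; Y \<in> Obj C\<rbrakk> \<Longrightarrow> arrow C (Zero C X Y) X Y"
  using comm_group.axioms(1)[OF hom_comm_group[of X Y]] monoid.one_closed[of "hom_group C X Y"]
  by (auto simp: arrow_def hom_group_def comm_group_def comm_monoid_def)

lemma arrow_plus: "\<lbrakk>arrow C f X Y; arrow C g X Y\<rbrakk> \<Longrightarrow> arrow C (Plus C f g) X Y"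
  using group.is_monoid[OF comm_group.axioms(2)[OF hom_comm_group[of X Y]]]
    monoid.m_closed[of "hom_group C X Y" f g]
  by (auto simp: arrow_def hom_group_def)

lemma plus_zero:
  assumes "arrow C f X Y"
  shows "Plus C f (Zero C X Y) = f" "Plus C (Zero C X Y) f = f"
proof -
  interpret comm_group "hom_group C X Y" using assms hom_comm_group by (simp add: arrow_def)
  show "Plus C f (Zero C X Y) = f" "Plus C (Zero C X Y) f = f"
    using l_one[of f] r_one[of f] assms by (auto simp: arrow_def hom_group_def)
qed

lemma ex_minus:
  assumes "arrow C f X Y" "arrow C g X Y"
  obtains h where "arrow C h X Y" "Plus C f h = g"
proof -
  interpret comm_group "hom_group C X Y" using assms hom_comm_group by (simp add: arrow_def)
  have c: "f \<in> carrier (hom_group C X Y)" "g \<in> carrier (hom_group C X Y)"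
    using assms by (auto simp: arrow_def hom_group_def)
  let ?h = "inv\<^bsub>hom_group C X Y\<^esub> f \<otimes>\<^bsub>hom_group C X Y\<^esub> g"
  have "?h \<in> carrier (hom_group C X Y)" using c by simp
  moreover have "f \<otimes>\<^bsub>hom_group C X Y\<^esub> ?h = g" using c by (simp add: m_assoc[symmetric])
  ultimately show thesis using that[of ?h] assms by (simp add: arrow_def hom_group_def)
qed

lemma plus_eq_left:
  assumes "arrow C f X Y" "arrow C g X Y" "Plus C f g = f"
  shows "g = Zero C X Y"
proof -
  interpret comm_group "hom_group C X Y" using assms hom_comm_group by (simp add: arrow_def)
  show ?thesis using assms r_cancel_one'[of g f] l_cancel_one'[of f g]
    by (auto simp: arrow_def hom_group_def)
qed

lemma comp_plus:
  "\<lbrakk>arrow C f X Y; arrow C g Y Z; arrow C g' Y Z\<rbrakk> \<Longrightarrow> Plus C g g' \<cdot> f = Plus C (g \<cdot> f) (g' \<cdot> f)"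
  "\<lbrakk>arrow C f X Y; arrow C f' X Y; arrow C g Y Z\<rbrakk> \<Longrightarrow> g \<cdot> Plus C f f' = Plus C (g \<cdot> f) (g \<cdot> f')"
  by (auto simp: arrow_def comp_plus_left comp_plus_right)

lemma zero_comp:
  assumes "arrow C f X Y" "Z \<in> Obj C" shows "Zero C Y Z \<cdot> f = Zero C X Z"
proof -
  have z: "arrow C (Zero C Y Z) Y Z" using assms arrow_zero by (auto simp: arrow_def)
  have "Plus C (Zero C Y Z \<cdot> f) (Zero C Y Z \<cdot> f) = Zero C Y Z \<cdot> f"
    using comp_plus(1)[OF assms(1) z z] plus_zero[OF z] by simp
  then show ?thesis using plus_eq_left arrow_comp[OF assms(1) z] by blast
qed

lemma comp_zero:
  assumes "arrow C f X Y" "Z \<in> Obj C" shows "f \<cdot> Zero C Z X = Zero C Z Y"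
proof -
  have z: "arrow C (Zero C Z X) Z X" using assms arrow_zero by (auto simp: arrow_def)
  have "Plus C (f \<cdot> Zero C Z X) (f \<cdot> Zero C Z X) = f \<cdot> Zero C Z X"
    using comp_plus(2)[OF z z assms(1)] plus_zero[OF z] by simp
  then show ?thesis using plus_eq_left arrow_comp[OF z assms(1)] by blast
qed

lemma zero_objectI:
  assumes "Z \<in> Obj C" "Ident C Z = Zero C Z Z" shows "zero_object C Z"
  unfolding zero_object_def
proof (intro conjI ballI)
  fix X assume X: "X \<in> Obj C"
  show "\<exists>!f. f \<in> Hom C X Z"
  proof
    show "Zero C X Z \<in> Hom C X Z" by (rule arrow_homD[OF arrow_zero[OF X assms(1)]])
    fix f assume "f \<in> Hom C X Z"
    then have f: "arrow C f X Z" using X assms by (simp add: arrow_def)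
    show "f = Zero C X Z" using id_left[OF f] zero_comp[OF f assms(1)] assms(2) by simp
  qed
  show "\<exists>!f. f \<in> Hom C Z X"
  proof
    show "Zero C Z X \<in> Hom C Z X" by (rule arrow_homD[OF arrow_zero[OF assms(1) X]])
    fix f assume "f \<in> Hom C Z X"
    then have f: "arrow C f Z X" using X assms by (simp add: arrow_def)
    show "f = Zero C Z X" using id_right[OF f] comp_zero[OF f assms(1)] assms(2) by simp
  qed
qed (rule assms(1))

text \<open>The equational form avoids quantifying over all objects, so it can be checked degreewise
  in \<open>Bq C\<close> and through the embedding in \<open>base_cat C\<close>.\<close>

lemma zero_object_iff: "zero_object C Z \<longleftrightarrow> Z \<in> Obj C \<and> Ident C Z = Zero C Z Z"
proof
  assume z: "zero_object C Z"
  then have Z: "Z \<in> Obj C" by (simp add: zero_object_def)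
  then have "\<exists>!f. f \<in> Hom C Z Z" using z by (simp add: zero_object_def)
  moreover have "Ident C Z \<in> Hom C Z Z" "Zero C Z Z \<in> Hom C Z Z"
    using Z ident_closed arrow_zero[OF Z Z] by (auto simp: arrow_def)
  ultimately show "Z \<in> Obj C \<and> Ident C Z = Zero C Z Z" using Z by blast
qed (use zero_objectI in blast)

lemma zero_object_obj: "zero_object C Z \<Longrightarrow> Z \<in> Obj C"
  by (simp add: zero_object_def)

lemma to_zero: "\<lbrakk>zero_object C Z; arrow C f X Z\<rbrakk> \<Longrightarrow> f = Zero C X Z"
  using arrow_zero[of X Z] unfolding zero_object_def arrow_def by blast

lemma from_zero: "\<lbrakk>zero_object C Z; arrow C f Z X\<rbrakk> \<Longrightarrow> f = Zero C Z X"
  using arrow_zero[of Z X] unfolding zero_object_def arrow_def by blast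

end

section \<open>Kernels, pullbacks and biproducts\<close>

lemma kernel_arrows:
  "is_kernel C K k A f B \<Longrightarrow> arrow C k K A" "is_kernel C K k A f B \<Longrightarrow> arrow C f A B"
  by (auto simp: is_kernel_def arrow_def)

lemma kernel_zero: "is_kernel C K k A f B \<Longrightarrow> f \<cdot>\<^bsub>C\<^esub> k = Zero C K B"
  by (simp add: is_kernel_def)

lemma kernel_lift:
  assumes "is_kernel C K k A f B" "arrow C t T A" "f \<cdot>\<^bsub>C\<^esub> t = Zero C T B"
  obtains u where "arrow C u T K" "k \<cdot>\<^bsub>C\<^esub> u = t"
  using assms unfolding is_kernel_def arrow_def by blast

lemma kernelI:
  assumes "arrow C k K A" "arrow C f A B" "f \<cdot>\<^bsub>C\<^esub> k = Zero C K B"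
    and "\<And>T t. \<lbrakk>arrow C t T A; f \<cdot>\<^bsub>C\<^esub> t = Zero C T B\<rbrakk> \<Longrightarrow> \<exists>u. arrow C u T K \<and> k \<cdot>\<^bsub>C\<^esub> u = t"
    and "\<And>T u v. \<lbrakk>arrow C u T K; arrow C v T K; k \<cdot>\<^bsub>C\<^esub> u = k \<cdot>\<^bsub>C\<^esub> v\<rbrakk> \<Longrightarrow> u = v"
  shows "is_kernel C K k A f B"
  unfolding is_kernel_def
proof (intro conjI ballI impI)
  fix T t assume T: "T \<in> Obj C" "t \<in> Hom C T A" "f \<cdot>\<^bsub>C\<^esub> t = Zero C T B"
  then have "arrow C t T A" using assms(1) by (simp add: arrow_def)
  from assms(4)[OF this T(3)] obtain u where u: "arrow C u T K" "k \<cdot>\<^bsub>C\<^esub> u = t" by blast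
  show "\<exists>!u. u \<in> Hom C T K \<and> k \<cdot>\<^bsub>C\<^esub> u = t"
  proof
    show "u \<in> Hom C T K \<and> k \<cdot>\<^bsub>C\<^esub> u = t" using u by (simp add: arrow_def)
    fix v assume v: "v \<in> Hom C T K \<and> k \<cdot>\<^bsub>C\<^esub> v = t"
    then have "arrow C v T K" using u by (simp add: arrow_def)
    then show "v = u" using assms(5) u v by metis
  qed
qed (use assms in \<open>auto simp: arrow_def\<close>)

lemma pullback_arrows:
  assumes "is_pullback C D f' p' B C' p f A"
  shows "arrow C f' D B" "arrow C p' D C'" "arrow C p B A" "arrow C f C' A"
    and "p \<cdot>\<^bsub>C\<^esub> f' = f \<cdot>\<^bsub>C\<^esub> p'"
  using assms by (auto simp: is_pullback_def arrow_def)

lemma pullback_lift: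
  assumes "is_pullback C D f' p' B C' p f A" "arrow C s T B" "arrow C t T C'" "p \<cdot>\<^bsub>C\<^esub> s = f \<cdot>\<^bsub>C\<^esub> t"
  obtains u where "arrow C u T D" "f' \<cdot>\<^bsub>C\<^esub> u = s" "p' \<cdot>\<^bsub>C\<^esub> u = t"
  using assms unfolding is_pullback_def arrow_def by blast

lemma pullbackI:
  assumes "arrow C f' D B" "arrow C p' D C'" "arrow C p B A" "arrow C f C' A"
    and "p \<cdot>\<^bsub>C\<^esub> f' = f \<cdot>\<^bsub>C\<^esub> p'"
    and "\<And>T s t. \<lbrakk>arrow C s T B; arrow C t T C'; p \<cdot>\<^bsub>C\<^esub> s = f \<cdot>\<^bsub>C\<^esub> t\<rbrakk>
           \<Longrightarrow> \<exists>u. arrow C u T D \<and> f' \<cdot>\<^bsub>C\<^esub> u = s \<and> p' \<cdot>\<^bsub>C\<^esub> u = t"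
    and "\<And>T u v. \<lbrakk>arrow C u T D; arrow C v T D; f' \<cdot>\<^bsub>C\<^esub> u = f' \<cdot>\<^bsub>C\<^esub> v; p' \<cdot>\<^bsub>C\<^esub> u = p' \<cdot>\<^bsub>C\<^esub> v\<rbrakk>
           \<Longrightarrow> u = v"
  shows "is_pullback C D f' p' B C' p f A"
  unfolding is_pullback_def
proof (intro conjI ballI impI)
  fix T s t assume T: "T \<in> Obj C" "s \<in> Hom C T B" "t \<in> Hom C T C'" "p \<cdot>\<^bsub>C\<^esub> s = f \<cdot>\<^bsub>C\<^esub> t"
  then have "arrow C s T B" "arrow C t T C'" using assms(1,2) by (simp_all add: arrow_def)
  from assms(6)[OF this T(4)] obtain u
    where u: "arrow C u T D" "f' \<cdot>\<^bsub>C\<^esub> u = s" "p' \<cdot>\<^bsub>C\<^esub> u = t" by blast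
  show "\<exists>!u. u \<in> Hom C T D \<and> f' \<cdot>\<^bsub>C\<^esub> u = s \<and> p' \<cdot>\<^bsub>C\<^esub> u = t"
  proof
    show "u \<in> Hom C T D \<and> f' \<cdot>\<^bsub>C\<^esub> u = s \<and> p' \<cdot>\<^bsub>C\<^esub> u = t" using u by (simp add: arrow_def)
    fix v assume v: "v \<in> Hom C T D \<and> f' \<cdot>\<^bsub>C\<^esub> v = s \<and> p' \<cdot>\<^bsub>C\<^esub> v = t"
    then have "arrow C v T D" using u by (simp add: arrow_def)
    then show "v = u" using assms(7) u v by metis
  qed
qed (use assms in \<open>auto simp: arrow_def\<close>)

lemma biproduct_arrows:
  assumes "biproduct C X Y S inX inY prX prY"
  shows "arrow C inX X S" "arrow C inY Y S" "arrow C prX S X" "arrow C prY S Y"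
    and "prX \<cdot>\<^bsub>C\<^esub> inX = Ident C X" "prY \<cdot>\<^bsub>C\<^esub> inY = Ident C Y"
    and "prY \<cdot>\<^bsub>C\<^esub> inX = Zero C X Y" "prX \<cdot>\<^bsub>C\<^esub> inY = Zero C Y X"
  using assms by (auto simp: biproduct_def arrow_def)

context preadditive_category
begin

lemma kernel_mono:
  assumes "is_kernel C K k A f B" "arrow C u T K" "arrow C v T K" "k \<cdot> u = k \<cdot> v"
  shows "u = v"
proof -
  note k = kernel_arrows[OF assms(1)] kernel_zero[OF assms(1)]
  have "f \<cdot> (k \<cdot> u) = Zero C T B"
    using assoc[OF assms(2) k(1,2)] zero_comp[OF assms(2) arrow_objD(2)[OF k(2)]] k(3) by simp
  then have "\<exists>!w. w \<in> Hom C T K \<and> k \<cdot> w = k \<cdot> u"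
    using assms(1) arrow_comp[OF assms(2) k(1)] unfolding is_kernel_def arrow_def by blast
  then show ?thesis using assms(2-4) by (auto simp: arrow_def)
qed

lemma pullback_eq:
  assumes "is_pullback C D f' p' B C' p f A" "arrow C u T D" "arrow C v T D"
    and "f' \<cdot> u = f' \<cdot> v" "p' \<cdot> u = p' \<cdot> v"
  shows "u = v"
proof -
  note a = pullback_arrows[OF assms(1)]
  have "p \<cdot> (f' \<cdot> u) = f \<cdot> (p' \<cdot> u)"
    using assoc[OF assms(2) a(1,3)] assoc[OF assms(2) a(2,4)] a(5) by simp
  moreover have "T \<in> Obj C" "f' \<cdot> u \<in> Hom C T B" "p' \<cdot> u \<in> Hom C T C'"
    using arrow_comp[OF assms(2) a(1)] arrow_comp[OF assms(2) a(2)] by (auto simp: arrow_def)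
  ultimately have "\<exists>!w. w \<in> Hom C T D \<and> f' \<cdot> w = f' \<cdot> u \<and> p' \<cdot> w = p' \<cdot> u"
    using assms(1) unfolding is_pullback_def by blast
  then show ?thesis using assms(2-5) by (auto simp: arrow_def)
qed

lemma pullback_sym:
  assumes P: "is_pullback C D f' p' B C' p f A"
  shows "is_pullback C D p' f' C' B f p A"
proof (rule pullbackI)
  fix T s t assume "arrow C s T C'" "arrow C t T B" "f \<cdot> s = p \<cdot> t"
  then show "\<exists>u. arrow C u T D \<and> p' \<cdot> u = s \<and> f' \<cdot> u = t"
    using pullback_lift[OF P, of t T s] by metis
qed (use pullback_arrows[OF P] pullback_eq[OF P] in auto)

lemma biproduct_sum:
  assumes "biproduct C X Y S inX inY prX prY" "arrow C h S Z"
  shows "h = Plus C ((h \<cdot> inX) \<cdot> prX) ((h \<cdot> inY) \<cdot> prY)"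
proof -
  note a = biproduct_arrows[OF assms(1)]
  have "h = h \<cdot> Plus C (inX \<cdot> prX) (inY \<cdot> prY)"
    using id_right[OF assms(2)] assms(1) by (simp add: biproduct_def)
  also have "\<dots> = Plus C (h \<cdot> (inX \<cdot> prX)) (h \<cdot> (inY \<cdot> prY))"
    by (rule comp_plus(2)[OF arrow_comp[OF a(3,1)] arrow_comp[OF a(4,2)] assms(2)])
  also have "\<dots> = Plus C ((h \<cdot> inX) \<cdot> prX) ((h \<cdot> inY) \<cdot> prY)"
    using assoc[OF a(3,1) assms(2)] assoc[OF a(4,2) assms(2)] by simp
  finally show ?thesis .
qed

lemma biproduct_eq:
  assumes "biproduct C X Y S inX inY prX prY" "arrow C h S Z" "arrow C h' S Z"
    and "h \<cdot> inX = h' \<cdot> inX" "h \<cdot> inY = h' \<cdot> inY"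
  shows "h = h'"
  using biproduct_sum[OF assms(1,2)] biproduct_sum[OF assms(1,3)] assms(4,5) by simp

lemma biproduct_copair:
  assumes b: "biproduct C X Y S inX inY prX prY" and f: "arrow C f X Z" and g: "arrow C g Y Z"
  obtains h where "arrow C h S Z" "h \<cdot> inX = f" "h \<cdot> inY = g"
proof
  note a = biproduct_arrows[OF b]
  note fp = arrow_comp[OF a(3) f] and gp = arrow_comp[OF a(4) g]
  let ?h = "Plus C (f \<cdot> prX) (g \<cdot> prY)"
  have Z: "X \<in> Obj C" "Y \<in> Obj C" "Z \<in> Obj C" using f g by (auto simp: arrow_def)
  show "arrow C ?h S Z" by (rule arrow_plus[OF fp gp])
  show "?h \<cdot> inX = f"
    using comp_plus(1)[OF a(1) fp gp] assoc[OF a(1,3) f] assoc[OF a(1,4) g] a(5,7)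
      id_right[OF f] comp_zero[OF g Z(1)] plus_zero[OF f] by simp
  show "?h \<cdot> inY = g"
    using comp_plus(1)[OF a(2) fp gp] assoc[OF a(2,3) f] assoc[OF a(2,4) g] a(6,8)
      id_right[OF g] comp_zero[OF f Z(2)] plus_zero[OF g] by simp
qed

lemma biproduct_pair:
  assumes b: "biproduct C X Y S inX inY prX prY" and f: "arrow C f Z X" and g: "arrow C g Z Y"
  obtains h where "arrow C h Z S" "prX \<cdot> h = f" "prY \<cdot> h = g"
proof
  note a = biproduct_arrows[OF b]
  note fp = arrow_comp[OF f a(1)] and gp = arrow_comp[OF g a(2)]
  let ?h = "Plus C (inX \<cdot> f) (inY \<cdot> g)"
  have Z: "X \<in> Obj C" "Y \<in> Obj C" "Z \<in> Obj C" using f g by (auto simp: arrow_def)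
  show "arrow C ?h Z S" by (rule arrow_plus[OF fp gp])
  show "prX \<cdot> ?h = f"
    using comp_plus(2)[OF fp gp a(3)] assoc[OF f a(1,3)] assoc[OF g a(2,3)] a(5,8)
      id_left[OF f] zero_comp[OF g Z(1)] plus_zero[OF f] by simp
  show "prY \<cdot> ?h = g"
    using comp_plus(2)[OF fp gp a(4)] assoc[OF f a(1,4)] assoc[OF g a(2,4)] a(6,7)
      id_left[OF g] zero_comp[OF f Z(2)] plus_zero[OF g] by simp
qed

lemma biproduct_zero:
  assumes "zero_object C Z" "X \<in> Obj C"
  shows "biproduct C Z X X (Zero C Z X) (Ident C X) (Zero C X Z) (Ident C X)"
proof -
  have Z: "Z \<in> Obj C" "Ident C Z = Zero C Z Z" using assms(1) zero_object_iff by auto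
  note i = arrow_ident[OF assms(2)] and z = arrow_zero[OF Z(1) assms(2)] arrow_zero[OF assms(2) Z(1)]
  show ?thesis unfolding biproduct_def
    using Z assms(2) i z zero_comp[OF z(1) Z(1)] zero_comp[OF z(2) assms(2)] id_left[OF i]
      id_left[OF z(1)] id_right[OF z(2)] plus_zero[OF i]
    by (auto simp: arrow_def)
qed

end

section \<open>Deflation-exact categories\<close>

text \<open>The fragment that suffices for comparing kernels. It is established before the full list
  of axioms, both for Quillen exact categories and for \<open>Bq C\<close>, so that its lemmas are
  available while the remaining axioms are verified.\<close>

locale ses_category = additive_category C for C :: "('o, 'm) exact_cat" (structure) +
  assumes ses_kernel: "Ses C A i B p D \<Longrightarrow> is_kernel C A i B p D"
    and ses_iso: "\<lbrakk>Ses C A i B p D; A' \<in> Obj C; B' \<in> Obj C; D' \<in> Obj C;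
      i' \<in> Hom C A' B'; p' \<in> Hom C B' D';
      iso_mor C A a A'; iso_mor C B b B'; iso_mor C D d D';
      b \<cdot> i = i' \<cdot> a; d \<cdot> p = p' \<cdot> b\<rbrakk> \<Longrightarrow> Ses C A' i' B' p' D'"
begin

lemma ses_arrows:
  assumes "Ses C A i B p D"
  shows "arrow C i A B" "arrow C p B D" "p \<cdot> i = Zero C A D"
  using kernel_arrows[OF ses_kernel[OF assms]] kernel_zero[OF ses_kernel[OF assms]] by auto

lemma ses_objs:
  assumes "Ses C A i B p D"
  shows "A \<in> Obj C" "B \<in> Obj C" "D \<in> Obj C"
  using ses_arrows[OF assms] by (auto simp: arrow_def)

lemma ses_mono:
  "\<lbrakk>Ses C A i B p D; arrow C u T A; arrow C v T A; i \<cdot> u = i \<cdot> v\<rbrakk> \<Longrightarrow> u = v"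
  using kernel_mono[OF ses_kernel] by blast

lemma ses_lift:
  assumes "Ses C A i B p D" "arrow C t T B" "p \<cdot> t = Zero C T D"
  obtains u where "arrow C u T A" "i \<cdot> u = t"
  using kernel_lift[OF ses_kernel[OF assms(1)] assms(2,3)] by blast

lemma ses_iso_sub:
  assumes "Ses C A i B p D" "arrow C a A A'" "arrow C a' A' A" "a' \<cdot> a = Ident C A" "a \<cdot> a' = Ident C A'"
    and "arrow C i' A' B" "i = i' \<cdot> a"
  shows "Ses C A' i' B p D"
proof -
  note s = ses_arrows[OF assms(1)] ses_objs[OF assms(1)]
  have "iso_mor C A a A'" using assms iso_morI by blast
  then show ?thesis
    using ses_iso[OF assms(1), of A' B D i' p a "Ident C B" "Ident C D"] s iso_ident assms(6,7)
      id_left[OF s(1)] id_left[OF s(2)] id_right[OF s(2)] by (auto simp: arrow_def)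
qed

lemma ses_iso_mid:
  assumes "Ses C A i B p D" "arrow C b B B'" "arrow C b' B' B" "b' \<cdot> b = Ident C B" "b \<cdot> b' = Ident C B'"
  shows "Ses C A (b \<cdot> i) B' (p \<cdot> b') D"
proof -
  note s = ses_arrows[OF assms(1)] ses_objs[OF assms(1)]
  have "iso_mor C B b B'" using assms iso_morI by blast
  moreover have "arrow C (b \<cdot> i) A B'" "arrow C (p \<cdot> b') B' D"
    using arrow_comp s(1,2) assms(2,3) by blast+
  moreover have "(p \<cdot> b') \<cdot> b = p" using assoc[OF assms(2,3) s(2)] assms(4) id_right[OF s(2)] by simp
  ultimately show ?thesis
    using ses_iso[OF assms(1), of A B' D "b \<cdot> i" "p \<cdot> b'" "Ident C A" b "Ident C D"] s iso_ident
      id_left[OF s(2)] id_right[of "b \<cdot> i" A B'] by (auto simp: arrow_def)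
qed

lemma kernel_iso:
  assumes "is_kernel C K k B p D" "is_kernel C K' k' B p D"
  obtains a a' where "arrow C a K K'" "arrow C a' K' K" "a' \<cdot> a = Ident C K" "a \<cdot> a' = Ident C K'"
    "k = k' \<cdot> a" "k' = k \<cdot> a'"
proof -
  note k = kernel_arrows[OF assms(1)] and k' = kernel_arrows[OF assms(2)]
  obtain a where a: "arrow C a K K'" "k' \<cdot> a = k"
    using kernel_lift[OF assms(2) k(1) kernel_zero[OF assms(1)]] by blast
  obtain a' where a': "arrow C a' K' K" "k \<cdot> a' = k'"
    using kernel_lift[OF assms(1) k'(1) kernel_zero[OF assms(2)]] by blast
  have i: "arrow C (Ident C K) K K" "arrow C (Ident C K') K' K'"
    using arrow_ident k(1) k'(1) by (auto simp: arrow_def)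
  have "k \<cdot> (a' \<cdot> a) = k \<cdot> Ident C K"
    using assoc[OF a(1) a'(1) k(1)] a(2) a'(2) id_right[OF k(1)] by simp
  then have 1: "a' \<cdot> a = Ident C K"
    using kernel_mono[OF assms(1) arrow_comp[OF a(1) a'(1)] i(1)] by simp
  have "k' \<cdot> (a \<cdot> a') = k' \<cdot> Ident C K'"
    using assoc[OF a'(1) a(1) k'(1)] a(2) a'(2) id_right[OF k'(1)] by simp
  then have 2: "a \<cdot> a' = Ident C K'"
    using kernel_mono[OF assms(2) arrow_comp[OF a'(1) a(1)] i(2)] by simp
  show thesis by (rule that[OF a(1) a'(1) 1 2 a(2)[symmetric] a'(2)[symmetric]])
qed

text \<open>Kernels are unique up to isomorphism and \<open>ses_iso\<close> transports exactness
  along it; hence a map known to be an admissible epimorphism forms an exact sequence with every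
  kernel it has.\<close>

lemma ses_of_kernel:
  assumes "Ses C A i B p D" "is_kernel C K k B p D"
  shows "Ses C K k B p D"
proof -
  obtain a a' where "arrow C a A K" "arrow C a' K A" "a' \<cdot> a = Ident C A" "a \<cdot> a' = Ident C K" "i = k \<cdot> a"
    using kernel_iso[OF ses_kernel[OF assms(1)] assms(2)] by metis
  then show ?thesis using ses_iso_sub[OF assms(1)] kernel_arrows[OF assms(2)] by blast
qed

end

text \<open>
  These axioms follow from Quillen's and, unlike them, are inherited from \<open>C\<close> by \<open>Bq C\<close> through
  term-wise arguments.  Quillen's cancellation axiom enters only through \<open>ses_push\<close>; no property of
  admissible monomorphisms is involved.
\<close>

locale deflation_exact = ses_category C for C :: "('o, 'm) exact_cat" (structure) +
  assumes ses_epi: "\<lbrakk>Ses C A i B p D; arrow C g D T; arrow C h D T; g \<cdot> p = h \<cdot> p\<rbrakk> \<Longrightarrow> g = h"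
    and ses_split: "biproduct C X Y S inX inY prX prY \<Longrightarrow> Ses C X inX S prY Y"
    and ses_comp: "\<lbrakk>Ses C K k Q q X; Ses C X' i X p X''\<rbrakk> \<Longrightarrow>
      \<exists>R j h g. Ses C R j Q (p \<cdot> q) X'' \<and> Ses C K h R g X' \<and> j \<cdot> h = k \<and> i \<cdot> g = q \<cdot> j"
    and ses_pullback: "\<lbrakk>Ses C K k B p A; Ses C L l C' f A\<rbrakk> \<Longrightarrow>
      \<exists>D f' p' k' l'. is_pullback C D f' p' B C' p f A \<and> Ses C K k' D p' C' \<and> Ses C L l' D f' B \<and>
        f' \<cdot> k' = k \<and> p' \<cdot> l' = l"
    and ses_push: "\<lbrakk>Ses C K k A' a B'; Ses C A' i A p A''; Ses C B' j D q A''; arrow C f A D;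
      f \<cdot> i = j \<cdot> a; q \<cdot> f = p\<rbrakk> \<Longrightarrow> Ses C K (i \<cdot> k) A f D"

section \<open>From Quillen's axioms to the deflation-exact ones\<close>

sublocale exact_category \<subseteq> ses_category
  by unfold_locales (fact ses_kernel, fact ses_iso)

context exact_category
begin

text \<open>Base change supplies an admissible epimorphism only for some pullback; the comparison
  isomorphism \<open>h\<close> with inverse \<open>g\<close> carries it over to the given
  one.\<close>

lemma pullback_ses:
  assumes ses: "Ses C K k B p A" and pb: "is_pullback C D f' p' B C' p f A"
  shows "\<exists>l. Ses C K l D p' C' \<and> f' \<cdot> l = k"
proof -
  note pa = pullback_arrows[OF pb] and sa = ses_arrows[OF ses]
  obtain D0 f0 p0 where pb0: "is_pullback C D0 f0 p0 B C' p f A" and "admissible_epi C D0 p0 C'"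
    using epi_base_change[of B p A C' f] ses pa(4) unfolding admissible_epi_def arrow_def by blast
  then obtain L i0 where ses0: "Ses C L i0 D0 p0 C'" by (auto simp: admissible_epi_def)
  note pa0 = pullback_arrows[OF pb0]
  obtain h where h: "arrow C h D0 D" "f' \<cdot> h = f0" "p' \<cdot> h = p0"
    using pullback_lift[OF pb pa0(1,2,5)] by blast
  obtain g where g: "arrow C g D D0" "f0 \<cdot> g = f'" "p0 \<cdot> g = p'"
    using pullback_lift[OF pb0 pa(1,2,5)] by blast
  have id: "arrow C (Ident C D0) D0 D0" "arrow C (Ident C D) D D"
    using arrow_ident h(1) by (auto simp: arrow_def)
  have gh: "g \<cdot> h = Ident C D0"
    using pullback_eq[OF pb0 arrow_comp[OF h(1) g(1)] id(1)] assoc[OF h(1) g(1) pa0(1)]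
      assoc[OF h(1) g(1) pa0(2)] id_right[OF pa0(1)] id_right[OF pa0(2)] h g by metis
  have hg: "h \<cdot> g = Ident C D"
    using pullback_eq[OF pb arrow_comp[OF g(1) h(1)] id(2)] assoc[OF g(1) h(1) pa(1)]
      assoc[OF g(1) h(1) pa(2)] id_right[OF pa(1)] id_right[OF pa(2)] h g by metis
  have ses1: "Ses C L (h \<cdot> i0) D p' C'"
    using ses_iso_mid[OF ses0 h(1) g(1) gh hg] g(3) by simp
  have obj: "K \<in> Obj C" "C' \<in> Obj C" using sa(1) pa(2) by (auto simp: arrow_def)
  \<comment> \<open>\<open>l\<close> is the pair of \<open>k\<close> and zero. It identifies the
    kernel of \<open>p'\<close> with the old kernel \<open>K\<close>, on which Schanuel's argument
    later relies.\<close>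
  obtain l where l: "arrow C l K D" "f' \<cdot> l = k" "p' \<cdot> l = Zero C K C'"
    using pullback_lift[OF pb sa(1) arrow_zero[OF obj]] sa(3) comp_zero[OF pa(4) obj(1)] by metis
  have "is_kernel C K l D p' C'"
  proof (rule kernelI[OF l(1) pa(2) l(3)])
    fix T t assume t: "arrow C t T D" "p' \<cdot> t = Zero C T C'"
    have T: "T \<in> Obj C" using t by (simp add: arrow_def)
    have "p \<cdot> (f' \<cdot> t) = Zero C T A"
      using assoc[OF t(1) pa(1,3)] assoc[OF t(1) pa(2,4)] pa(5) t(2) comp_zero[OF pa(4) T] by simp
    then obtain u where u: "arrow C u T K" "k \<cdot> u = f' \<cdot> t"
      using ses_lift[OF ses arrow_comp[OF t(1) pa(1)]] by blast
    have "f' \<cdot> (l \<cdot> u) = f' \<cdot> t" using assoc[OF u(1) l(1) pa(1)] l(2) u(2) by simp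
    moreover have "p' \<cdot> (l \<cdot> u) = p' \<cdot> t"
      using assoc[OF u(1) l(1) pa(2)] l(3) t(2) zero_comp[OF u(1) obj(2)] by simp
    ultimately have "l \<cdot> u = t" by (rule pullback_eq[OF pb arrow_comp[OF u(1) l(1)] t(1)])
    then show "\<exists>u. arrow C u T K \<and> l \<cdot> u = t" using u by blast
  next
    fix T u v assume "arrow C u T K" "arrow C v T K" "l \<cdot> u = l \<cdot> v"
    then show "u = v"
      using ses_mono[OF ses, of u T v] assoc[OF _ l(1) pa(1), of u T] assoc[OF _ l(1) pa(1), of v T] l(2)
      by metis
  qed
  then show ?thesis using ses_of_kernel[OF ses1] l(2) by blast
qed

text \<open>In terms of elements, the kernel of \<open>p q\<close> is the preimage under
  \<open>q\<close> of the subobject \<open>X'\<close>. Once it is seen as a pullback,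
  \<open>pullback_ses\<close> makes its map to \<open>X'\<close> an admissible epimorphism whenever
  \<open>q\<close> is one, with the same kernel.\<close>

lemma kernel_comp_pullback:
  assumes "Ses C X' i X p X''" "arrow C q Q X" "is_kernel C R j Q (p \<cdot> q) X''" "arrow C g R X'" "i \<cdot> g = q \<cdot> j"
  shows "is_pullback C R j g Q X' q i X"
proof (rule pullbackI)
  note s = ses_arrows[OF assms(1)] and k = kernel_arrows[OF assms(3)]
  show "arrow C j R Q" "arrow C g R X'" "arrow C q Q X" "arrow C i X' X" "q \<cdot> j = i \<cdot> g"
    using assms s k by simp_all
  fix T s t assume t: "arrow C s T Q" "arrow C t T X'" "q \<cdot> s = i \<cdot> t"
  have "(p \<cdot> q) \<cdot> s = Zero C T X''"
    using assoc[OF t(1) assms(2) s(2)] t(3) assoc[OF t(2) s(1,2)] s(3)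
      zero_comp[OF t(2)] s(2) by (simp add: arrow_def)
  then obtain u where u: "arrow C u T R" "j \<cdot> u = s" using kernel_lift[OF assms(3) t(1)] by blast
  have "i \<cdot> (g \<cdot> u) = i \<cdot> t"
    using assoc[OF u(1) assms(4) s(1)] assoc[OF u(1) k(1) assms(2)] assms(5) u(2) t(3) by simp
  then have "g \<cdot> u = t" using ses_mono[OF assms(1) arrow_comp[OF u(1) assms(4)] t(2)] by simp
  then show "\<exists>u. arrow C u T R \<and> j \<cdot> u = s \<and> g \<cdot> u = t" using u by blast
next
  fix T u v assume "arrow C u T R" "arrow C v T R" "j \<cdot> u = j \<cdot> v"
  then show "u = v" using kernel_mono[OF assms(3)] by blast
qed

text \<open>If \<open>f t = 0\<close> then \<open>p t = q f t = 0\<close>, so \<open>t\<close> comes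
  from \<open>A'\<close>; there \<open>f i = j a\<close> with \<open>j\<close> monic, so
  \<open>a\<close> kills the preimage of \<open>t\<close>, which therefore comes from
  \<open>K\<close>.\<close>

lemma push_kernel:
  assumes S1: "Ses C K k A' a B'" and S2: "Ses C A' i A p A''" and S3: "Ses C B' j D q A''"
    and f: "arrow C f A D" "f \<cdot> i = j \<cdot> a" "q \<cdot> f = p"
  shows "is_kernel C K (i \<cdot> k) A f D"
proof (rule kernelI)
  note s1 = ses_arrows[OF S1] and s2 = ses_arrows[OF S2] and s3 = ses_arrows[OF S3]
  note ik = arrow_comp[OF s1(1) s2(1)]
  show "arrow C (i \<cdot> k) K A" "arrow C f A D" using ik f by auto
  have D: "D \<in> Obj C" "K \<in> Obj C" "B' \<in> Obj C" using f s1 by (auto simp: arrow_def)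
  show "f \<cdot> (i \<cdot> k) = Zero C K D"
    using assoc[OF s1(1) s2(1) f(1)] assoc[OF s1(1,2) s3(1)] f(2) s1(3) comp_zero[OF s3(1) D(2)]
    by simp
  fix T t assume t: "arrow C t T A" "f \<cdot> t = Zero C T D"
  have T: "T \<in> Obj C" using t by (simp add: arrow_def)
  have "p \<cdot> t = Zero C T A''"
    using assoc[OF t(1) f(1) s3(2)] f(3) t(2) comp_zero[OF s3(2) T] by simp
  then obtain u where u: "arrow C u T A'" "i \<cdot> u = t" using ses_lift[OF S2 t(1)] by blast
  have "j \<cdot> (a \<cdot> u) = j \<cdot> Zero C T B'"
    using assoc[OF u(1) s1(2) s3(1)] assoc[OF u(1) s2(1) f(1)] f(2) u(2) t(2) comp_zero[OF s3(1) T]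
    by simp
  then have "a \<cdot> u = Zero C T B'"
    using ses_mono[OF S3 arrow_comp[OF u(1) s1(2)] arrow_zero[OF T D(3)]] by simp
  then obtain w where w: "arrow C w T K" "k \<cdot> w = u" using ses_lift[OF S1 u(1)] by blast
  then have "(i \<cdot> k) \<cdot> w = t" using assoc[OF w(1) s1(1) s2(1)] u(2) by simp
  then show "\<exists>u. arrow C u T K \<and> (i \<cdot> k) \<cdot> u = t" using w(1) by blast
next
  note s1 = ses_arrows[OF S1] and s2 = ses_arrows[OF S2]
  fix T u v assume u: "arrow C u T K" "arrow C v T K" "(i \<cdot> k) \<cdot> u = (i \<cdot> k) \<cdot> v"
  then have "i \<cdot> (k \<cdot> u) = i \<cdot> (k \<cdot> v)"
    using assoc[OF u(1) s1(1) s2(1)] assoc[OF u(2) s1(1) s2(1)] by simp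
  then have "k \<cdot> u = k \<cdot> v"
    using ses_mono[OF S2 arrow_comp[OF u(1) s1(1)] arrow_comp[OF u(2) s1(1)]] by simp
  then show "u = v" using ses_mono[OF S1 u(1,2)] by simp
qed

text \<open>
  In terms of elements, \<open>f\<close> is hit as follows: given \<open>y\<close> in \<open>D\<close>, choose \<open>x\<close> in \<open>A\<close> with
  \<open>p x = q y\<close>, write \<open>y - f x = j w\<close> and \<open>w = a w'\<close>; then \<open>y = f (x + i w')\<close>.  The choices are made
  over an admissible cover \<open>N\<close> of \<open>D\<close>, and Quillen's cancellation axiom gives the claim.
\<close>

lemma push_epi:
  assumes S1: "Ses C K k A' a B'" and S2: "Ses C A' i A p A''" and S3: "Ses C B' j D q A''"
    and f: "arrow C f A D" "f \<cdot> i = j \<cdot> a" "q \<cdot> f = p"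
  shows "admissible_epi C A f D"
proof -
  note s1 = ses_arrows[OF S1] and s2 = ses_arrows[OF S2] and s3 = ses_arrows[OF S3]
  obtain E x y where pE: "is_pullback C E x y A D p q A''"
    using epi_base_change[of A p A'' D q] S2 s3(2) unfolding admissible_epi_def arrow_def by blast
  note e = pullback_arrows[OF pE]
  have yE: "admissible_epi C E y D" using pullback_ses[OF S2 pE] by (auto simp: admissible_epi_def)
  note fx = arrow_comp[OF e(1) f(1)]
  obtain h where h: "arrow C h E D" "Plus C (f \<cdot> x) h = y" using ex_minus[OF fx e(2)] by blast
  have "q \<cdot> (f \<cdot> x) = p \<cdot> x" using assoc[OF e(1) f(1) s3(2)] f(3) by simp
  then have "Plus C (p \<cdot> x) (q \<cdot> h) = p \<cdot> x" using comp_plus(2)[OF fx h(1) s3(2)] h(2) e(5) by simp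
  then have "q \<cdot> h = Zero C E A''"
    using plus_eq_left[OF arrow_comp[OF e(1) s2(2)] arrow_comp[OF h(1) s3(2)]] by simp
  then obtain w where w: "arrow C w E B'" "j \<cdot> w = h" using ses_lift[OF S3 h(1)] by blast
  obtain N w' n where pN: "is_pullback C N w' n A' E a w B'" and nE: "admissible_epi C N n E"
    using epi_base_change[of A' a B' E w] S1 w(1) unfolding admissible_epi_def arrow_def by blast
  note ne = pullback_arrows[OF pN]
  note xn = arrow_comp[OF ne(2) e(1)] and iw = arrow_comp[OF ne(1) s2(1)]
  let ?e = "Plus C (x \<cdot> n) (i \<cdot> w')"
  have ar: "arrow C ?e N A" by (rule arrow_plus[OF xn iw])
  have "f \<cdot> ?e = Plus C (f \<cdot> (x \<cdot> n)) (f \<cdot> (i \<cdot> w'))" by (rule comp_plus(2)[OF xn iw f(1)])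
  also have "f \<cdot> (x \<cdot> n) = (f \<cdot> x) \<cdot> n" using assoc[OF ne(2) e(1) f(1)] by simp
  also have "f \<cdot> (i \<cdot> w') = h \<cdot> n"
    using assoc[OF ne(1) s2(1) f(1)] f(2) assoc[OF ne(1) s1(2) s3(1)] ne(5) assoc[OF ne(2) w(1) s3(1)] w(2)
    by simp
  also have "Plus C ((f \<cdot> x) \<cdot> n) (h \<cdot> n) = y \<cdot> n"
    using comp_plus(1)[OF ne(2) fx h(1)] h(2) by simp
  finally have "f \<cdot> ?e = y \<cdot> n" .
  then have "admissible_epi C N (f \<cdot> ?e) D" using epi_comp[OF nE yE] by simp
  then show ?thesis
    using epi_cancel[OF push_kernel[OF S1 S2 S3 f]] ar by (auto simp: arrow_def)
qed

theorem deflation_exact: "deflation_exact C"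
proof unfold_locales
  fix A i B p D g h T
  assume s: "Ses C A i B p D" and gh: "arrow C g D T" "arrow C h D T" "g \<cdot> p = h \<cdot> p"
  note a = ses_arrows[OF s]
  have "(g \<cdot> p) \<cdot> i = Zero C A T"
    using assoc[OF a(1,2) gh(1)] a(3) comp_zero[OF gh(1)] a(1) by (simp add: arrow_def)
  then have "\<exists>!u. u \<in> Hom C D T \<and> u \<cdot> p = g \<cdot> p"
    using ses_cokernel[OF s] arrow_comp[OF a(2) gh(1)] unfolding is_cokernel_def arrow_def by blast
  then show "g = h" using gh by (auto simp: arrow_def)
next
  fix X Y S inX inY prX prY assume "biproduct C X Y S inX inY prX prY"
  then show "Ses C X inX S prY Y" by (rule ses_split)
next
  fix K k Q q X X' i p X''
  assume s: "Ses C K k Q q X" "Ses C X' i X p X''"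
  note s1 = ses_arrows[OF s(1)] and s2 = ses_arrows[OF s(2)]
  have "admissible_epi C Q (p \<cdot> q) X''"
    using epi_comp s unfolding admissible_epi_def by blast
  then obtain R j where R: "Ses C R j Q (p \<cdot> q) X''" by (auto simp: admissible_epi_def)
  note r = ses_arrows[OF R]
  have "p \<cdot> (q \<cdot> j) = Zero C R X''" using assoc[OF r(1) s1(2) s2(2)] r(3) by simp
  then obtain g where g: "arrow C g R X'" "i \<cdot> g = q \<cdot> j"
    using ses_lift[OF s(2) arrow_comp[OF r(1) s1(2)]] by blast
  have "is_pullback C R j g Q X' q i X"
    by (rule kernel_comp_pullback[OF s(2) s1(2) ses_kernel[OF R] g])
  from pullback_ses[OF s(1) this]
  show "\<exists>R j h g. Ses C R j Q (p \<cdot> q) X'' \<and> Ses C K h R g X' \<and> j \<cdot> h = k \<and> i \<cdot> g = q \<cdot> j"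
    using R g by blast
next
  fix K k B p A L l C' f
  assume s: "Ses C K k B p A" "Ses C L l C' f A"
  then obtain D f' p' where pb: "is_pullback C D f' p' B C' p f A"
    using epi_base_change[of B p A C' f] ses_arrows[OF s(2)] unfolding admissible_epi_def arrow_def
    by blast
  from pullback_ses[OF s(1) pb] pullback_ses[OF s(2) pullback_sym[OF pb]]
  show "\<exists>D f' p' k' l'. is_pullback C D f' p' B C' p f A \<and> Ses C K k' D p' C' \<and> Ses C L l' D f' B \<and>
        f' \<cdot> k' = k \<and> p' \<cdot> l' = l"
    using pb by blast
next
  fix K k A' a B' i A p A'' j D q f
  assume s: "Ses C K k A' a B'" "Ses C A' i A p A''" "Ses C B' j D q A''" "arrow C f A D"
    "f \<cdot> i = j \<cdot> a" "q \<cdot> f = p"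
  show "Ses C K (i \<cdot> k) A f D"
    using push_epi[OF s] push_kernel[OF s] ses_of_kernel by (auto simp: admissible_epi_def)
qed

end

section \<open>The nine lemma and split sequences\<close>

context deflation_exact
begin

text \<open>Factor \<open>b\<close> as \<open>A -> D -> B\<close> through the pullback
  \<open>D\<close> of \<open>q\<close> and \<open>c\<close>. The first map has kernel
  \<open>K'\<close> by \<open>ses_push\<close>, the second has kernel \<open>K''\<close> by
  \<open>ses_pullback\<close>, and \<open>ses_comp\<close> exhibits the kernel of the composite as
  an extension of \<open>K''\<close> by \<open>K'\<close>.\<close>

lemma nine_lemma:
  assumes SA: "Ses C A' i A p A''" and SB: "Ses C B' j B q B''"
    and Sa: "Ses C K' k' A' a B'" and Sc: "Ses C K'' k'' A'' c B''"
    and b: "arrow C b A B" "b \<cdot> i = j \<cdot> a" "q \<cdot> b = c \<cdot> p"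
  shows "\<exists>K k h g. Ses C K k A b B \<and> Ses C K' h K g K'' \<and> k \<cdot> h = i \<cdot> k' \<and> k'' \<cdot> g = p \<cdot> k"
proof -
  note sA = ses_arrows[OF SA] and sB = ses_arrows[OF SB] and sa = ses_arrows[OF Sa] and sc = ses_arrows[OF Sc]
  obtain D m r j' l where pb: "is_pullback C D m r B A'' q c B''" and Sr: "Ses C B' j' D r A''"
    and Sm: "Ses C K'' l D m B" and mj: "m \<cdot> j' = j" and rl: "r \<cdot> l = k''"
    using ses_pullback[OF SB Sc] by blast
  note pa = pullback_arrows[OF pb] and sr = ses_arrows[OF Sr] and sm = ses_arrows[OF Sm]
  obtain f where f: "arrow C f A D" "m \<cdot> f = b" "r \<cdot> f = p"
    using pullback_lift[OF pb b(1) sA(2) b(3)] by blast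
  have "m \<cdot> (f \<cdot> i) = m \<cdot> (j' \<cdot> a)"
    using assoc[OF sA(1) f(1) pa(1)] assoc[OF sa(2) sr(1) pa(1)] f mj b(2) by simp
  moreover have "r \<cdot> (f \<cdot> i) = r \<cdot> (j' \<cdot> a)"
    using assoc[OF sA(1) f(1) pa(2)] assoc[OF sa(2) sr(1) pa(2)] f sA(3) sr(3)
      zero_comp[OF sa(2)] sA(2) by (simp add: arrow_def)
  ultimately have "f \<cdot> i = j' \<cdot> a"
    using pullback_eq[OF pb arrow_comp[OF sA(1) f(1)] arrow_comp[OF sa(2) sr(1)]] by simp
  from ses_push[OF Sa SA Sr f(1) this f(3)] have Sf: "Ses C K' (i \<cdot> k') A f D" .
  obtain K k h g where K: "Ses C K k A (m \<cdot> f) B" "Ses C K' h K g K''" "k \<cdot> h = i \<cdot> k'" "l \<cdot> g = f \<cdot> k"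
    using ses_comp[OF Sf Sm] by blast
  have "k'' \<cdot> g = p \<cdot> k"
    using assoc[OF ses_arrows(2)[OF K(2)] sm(1) sr(2)] assoc[OF ses_arrows(1)[OF K(1)] f(1) sr(2)]
      rl f(3) K(4) by simp
  then show ?thesis using K f(2) by blast
qed

text \<open>The nine lemma for a kernel of \<open>b\<close> that is fixed in advance: one graded
  kernel has to carry both differentials of a binary complex.\<close>

lemma nine_lemma_kernels:
  assumes SA: "Ses C A' i A p A''" and SB: "Ses C B' j B q B''"
    and Sa: "Ses C K' k' A' a B'" and Sc: "Ses C K'' k'' A'' c B''"
    and b: "arrow C b A B" "b \<cdot> i = j \<cdot> a" "q \<cdot> b = c \<cdot> p" and Sb: "Ses C K k A b B"
  shows "\<exists>h g. Ses C K' h K g K'' \<and> k \<cdot> h = i \<cdot> k' \<and> k'' \<cdot> g = p \<cdot> k"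
proof -
  obtain K0 k0 h g where K: "Ses C K0 k0 A b B" "Ses C K' h K0 g K''" "k0 \<cdot> h = i \<cdot> k'" "k'' \<cdot> g = p \<cdot> k0"
    using nine_lemma[OF SA SB Sa Sc b] by blast
  obtain t t' where t: "arrow C t K0 K" "arrow C t' K K0" "t' \<cdot> t = Ident C K0" "t \<cdot> t' = Ident C K"
    "k0 = k \<cdot> t" "k = k0 \<cdot> t'"
    using kernel_iso[OF ses_kernel[OF K(1)] ses_kernel[OF Sb]] by blast
  note s = ses_arrows[OF K(2)]
  have "Ses C K' (t \<cdot> h) K (g \<cdot> t') K''" by (rule ses_iso_mid[OF K(2) t(1-4)])
  moreover have "k \<cdot> (t \<cdot> h) = i \<cdot> k'"
    using assoc[OF s(1) t(1) ses_arrows(1)[OF Sb]] t(5) K(3) by simp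
  moreover have "k'' \<cdot> (g \<cdot> t') = p \<cdot> k"
    using assoc[OF t(2) s(2) ses_arrows(1)[OF Sc]] K(4) t(6)
      assoc[OF t(2) ses_arrows(1)[OF K(1)] ses_arrows(2)[OF SA]] by simp
  ultimately show ?thesis by blast
qed

lemma ses_zero_left:
  assumes "zero_object C Z" "X \<in> Obj C"
  shows "Ses C Z (Zero C Z X) X (Ident C X) X"
  by (rule ses_split[OF biproduct_zero[OF assms]])

lemma biproduct_swap:
  assumes b: "biproduct C X Y S inX inY prX prY" shows "biproduct C Y X S inY inX prY prX"
proof -
  note a = biproduct_arrows[OF b]
  interpret comm_group "hom_group C S S" using a hom_comm_group by (simp add: arrow_def)
  have "Plus C (inX \<cdot> prX) (inY \<cdot> prY) = Plus C (inY \<cdot> prY) (inX \<cdot> prX)"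
    using m_comm[of "inX \<cdot> prX" "inY \<cdot> prY"] arrow_comp[OF a(3,1)] arrow_comp[OF a(4,2)]
    by (simp add: hom_group_def arrow_def)
  then show ?thesis using b by (auto simp: biproduct_def)
qed

lemma ses_zero_right:
  assumes "zero_object C Z" "X \<in> Obj C"
  shows "Ses C X (Ident C X) X (Zero C X Z) Z"
  by (rule ses_split[OF biproduct_swap[OF biproduct_zero[OF assms]]])

text \<open>\<open>h\<close> is the composite of
  \<open>(h, prU) : R \<oplus> U -> Z \<oplus> U\<close> with the projection to \<open>Z\<close>.
  The first map is \<open>f\<close> on \<open>R\<close> and the identity on the quotient
  \<open>U\<close>, so \<open>ses_push\<close> applies; the second is split.\<close>

lemma copair_deflation:
  assumes S: "Ses C L l R f Z" and b: "biproduct C R U S inR inU prR prU"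
    and h: "arrow C h S Z" "h \<cdot> inR = f"
  shows "\<exists>M m. Ses C M m S h Z"
proof -
  note a = biproduct_arrows[OF b] and s = ses_arrows[OF S]
  have o: "Z \<in> Obj C" "U \<in> Obj C" using a h by (auto simp: arrow_def)
  obtain W inZ inW prZ prW where W: "biproduct C Z U W inZ inW prZ prW" using biproduct_exists[OF o] by blast
  note w = biproduct_arrows[OF W]
  obtain F where F: "arrow C F S W" "prZ \<cdot> F = h" "prW \<cdot> F = prU"
    using biproduct_pair[OF W h(1) a(4)] by blast
  have "F \<cdot> inR = inZ \<cdot> f"
  proof -
    \<comment> \<open>\<open>G\<close> is the map with components \<open>f\<close> and zero; both
      sides of the claimed equation have these components.\<close>
    obtain G where "arrow C G R W" and G: "\<And>G'. \<lbrakk>arrow C G' R W; prZ \<cdot> G' = f; prW \<cdot> G' = Zero C R U\<rbrakk> \<Longrightarrow> G' = G"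
    proof
      let ?G = "Plus C (inZ \<cdot> f) (inW \<cdot> Zero C R U)"
      have z: "arrow C (Zero C R U) R U" using arrow_zero a o by (auto simp: arrow_def)
      show "arrow C ?G R W" by (rule arrow_plus[OF arrow_comp[OF s(2) w(1)] arrow_comp[OF z w(2)]])
      fix G' assume G': "arrow C G' R W" "prZ \<cdot> G' = f" "prW \<cdot> G' = Zero C R U"
      have "G' = Plus C (inZ \<cdot> prZ) (inW \<cdot> prW) \<cdot> G'" using W id_left[OF G'(1)] by (simp add: biproduct_def)
      then show "G' = ?G"
        using comp_plus(1)[OF G'(1) arrow_comp[OF w(3,1)] arrow_comp[OF w(4,2)]]
          assoc[OF G'(1) w(3,1)] assoc[OF G'(1) w(4,2)] G' by simp
    qed
    have R: "R \<in> Obj C" using a by (auto simp: arrow_def)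
    have "F \<cdot> inR = G"
      using G arrow_comp[OF a(1) F(1)] assoc[OF a(1) F(1) w(3)] assoc[OF a(1) F(1) w(4)] F h a(7) by simp
    moreover have "inZ \<cdot> f = G"
      using G arrow_comp[OF s(2) w(1)] assoc[OF s(2) w(1,3)] assoc[OF s(2) w(1,4)] w(5,7)
        id_left[OF s(2)] zero_comp[OF s(2) o(2)] by simp
    ultimately show ?thesis by simp
  qed
  from ses_push[OF S ses_split[OF b] ses_split[OF W] F(1) this F(3)]
  have "Ses C L (inR \<cdot> l) S F W" .
  from ses_comp[OF this ses_split[OF biproduct_swap[OF W]]] F(2) show ?thesis by auto
qed

lemma kernel_of_zero:
  assumes "Ses C A i B p D" "zero_object C B"
  shows "zero_object C A" "zero_object C D"
proof -
  note s = ses_arrows[OF assms(1)]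
  have A: "A \<in> Obj C" "D \<in> Obj C" using s by (auto simp: arrow_def)
  have "i \<cdot> Ident C A = i \<cdot> Zero C A A"
    using to_zero[OF assms(2) s(1)] id_right[OF s(1)] comp_zero[OF s(1) A(1)] by simp
  then have "Ident C A = Zero C A A"
    using ses_mono[OF assms(1) arrow_ident[OF A(1)] arrow_zero[OF A(1) A(1)]] by simp
  then show "zero_object C A" using A zero_object_iff by simp
  have "Ident C D \<cdot> p = Zero C D D \<cdot> p"
    using from_zero[OF assms(2) s(2)] id_left[OF s(2)] zero_comp[OF s(2) A(2)] by simp
  then have "Ident C D = Zero C D D"
    using ses_epi[OF assms(1) arrow_ident[OF A(2)] arrow_zero[OF A(2) A(2)]] by simp
  then show "zero_object C D" using A zero_object_iff by simp
qed

lemma extension_of_zero: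
  assumes "Ses C A i B p D" "zero_object C A" "zero_object C D"
  shows "zero_object C B"
proof -
  note s = ses_arrows[OF assms(1)]
  have B: "B \<in> Obj C" using s by (auto simp: arrow_def)
  note id = arrow_ident[OF B]
  have "p \<cdot> Ident C B = Zero C B D" using to_zero[OF assms(3) s(2)] id_right[OF s(2)] by simp
  then obtain u where u: "arrow C u B A" "i \<cdot> u = Ident C B" using ses_lift[OF assms(1) id] by blast
  then have "Ident C B = Zero C B B"
    using to_zero[OF assms(2) u(1)] comp_zero[OF s(1) B] by simp
  then show ?thesis using B zero_object_iff by simp
qed

lemma ses_zeros:
  assumes "zero_object C A" "zero_object C B" "zero_object C D"
  shows "Ses C A (Zero C A B) B (Zero C B D) D"
proof -
  have o: "A \<in> Obj C" "B \<in> Obj C" "D \<in> Obj C" using assms zero_object_iff by auto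
  note z = arrow_zero[OF o(1,2)] arrow_zero[OF o(2,1)] arrow_zero[OF o(2,3)] arrow_zero[OF o(3,2)]
  have "biproduct C A D B (Zero C A B) (Zero C D B) (Zero C B A) (Zero C B D)"
    unfolding biproduct_def
    using o z zero_comp[OF z(1) o(1)] zero_comp[OF z(4) o(3)] zero_comp[OF z(1) o(3)] zero_comp[OF z(4) o(1)]
      zero_comp[OF z(2) o(2)] zero_comp[OF z(3) o(2)] assms zero_object_iff plus_zero[OF arrow_zero[OF o(2) o(2)]]
    by (auto simp: arrow_def)
  then show ?thesis by (rule ses_split)
qed

end

section \<open>Acyclic complexes in deflation-exact categories\<close>

text \<open>Dependent choice indexed by the integers: the values are prescribed by \<open>g\<close>
  up to \<open>a\<close>, a range where the complexes in question vanish, and only the degrees above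
  are chosen recursively.\<close>

lemma int_choice_up:
  assumes base: "\<And>k::int. k \<le> a \<Longrightarrow> P k (g k)" "\<And>k. k < a \<Longrightarrow> Q k (g k) (g (k + 1))"
    and step: "\<And>k x. \<lbrakk>k \<ge> a; P k x\<rbrakk> \<Longrightarrow> \<exists>y. P (k + 1) y \<and> Q k x y"
  shows "\<exists>f. \<forall>k. P k (f k) \<and> Q k (f k) (f (k + 1))"
proof -
  \<comment> \<open>The clause for \<open>n = 0\<close> pins the start of the recursion to
    \<open>g a\<close>, so that it fits the prescribed values below \<open>a\<close>.\<close>
  let ?P = "\<lambda>n x. P (a + int n) x \<and> (n = 0 \<longrightarrow> x = g a)"
  have "\<exists>h. \<forall>n. ?P n (h n) \<and> Q (a + int n) (h n) (h (Suc n))"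
  proof (rule dependent_nat_choice)
    show "\<exists>x. ?P 0 x" using base(1)[of a] by auto
    fix x n assume "?P n x"
    then show "\<exists>y. ?P (Suc n) y \<and> Q (a + int n) x y"
      using step[of "a + int n" x] by (auto simp: ac_simps)
  qed
  then obtain h where h: "\<And>n. ?P n (h n)" "\<And>n. Q (a + int n) (h n) (h (Suc n))" by blast
  let ?f = "\<lambda>k. if k < a then g k else h (nat (k - a))"
  have "P k (?f k) \<and> Q k (?f k) (?f (k + 1))" for k
  proof (cases "k < a")
    case True
    then show ?thesis using base(1)[of k] base(2)[of k] h(1)[of 0]
      by (cases "k + 1 < a") (auto simp: not_less dest: antisym)
  next
    case False
    then have "nat (k + 1 - a) = Suc (nat (k - a))" "a + int (nat (k - a)) = k" by auto
    then show ?thesis using False h[of "nat (k - a)"] by auto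
  qed
  then show ?thesis by (intro exI[of _ ?f]) blast
qed

lemma int_choice_down:
  assumes base: "\<And>k::int. k \<ge> b \<Longrightarrow> P k (g k)" "\<And>k. k > b \<Longrightarrow> Q k (g k) (g (k - 1))"
    and step: "\<And>k x. \<lbrakk>k \<le> b; P k x\<rbrakk> \<Longrightarrow> \<exists>y. P (k - 1) y \<and> Q k x y"
  shows "\<exists>f. \<forall>k. P k (f k) \<and> Q k (f k) (f (k - 1))"
proof -
  have "\<exists>f. \<forall>k. P (- k) (f k) \<and> Q (- k) (f k) (f (k + 1))"
  proof (rule int_choice_up[where g = "\<lambda>k. g (- k)" and a = "- b"])
    show "P (- k) (g (- k))" if "k \<le> - b" for k using base(1)[of "- k"] that by simp
    show "Q (- k) (g (- k)) (g (- (k + 1)))" if "k < - b" for k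
      using base(2)[of "- k"] that minus_add_distrib[of k 1] by simp
    show "\<exists>y. P (- (k + 1)) y \<and> Q (- k) x y" if "- b \<le> k" "P (- k) x" for k x
      using step[of "- k" x] that minus_add_distrib[of k 1] by simp
  qed
  then obtain f where f: "\<And>k. P (- k) (f k)" "\<And>k. Q (- k) (f k) (f (k + 1))" by blast
  have "P k (f (- k)) \<and> Q k (f (- k)) (f (- (k - 1)))" for k
    using f[of "- k"] minus_diff_eq[of k 1] by (simp add: add.commute)
  then show ?thesis by (intro exI[of _ "\<lambda>k. f (- k)"]) blast
qed

definition chain_map where
  "chain_map C X dX f Y dY \<longleftrightarrow>
     (\<forall>k::int. arrow C (f k) (X k) (Y k) \<and> f (k - 1) \<cdot>\<^bsub>C\<^esub> dX k = dY k \<cdot>\<^bsub>C\<^esub> f k)"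

lemma chain_mapD:
  assumes "chain_map C X dX f Y dY"
  shows "arrow C (f k) (X k) (Y k)" "f (k - 1) \<cdot>\<^bsub>C\<^esub> dX k = dY k \<cdot>\<^bsub>C\<^esub> f k"
  using assms by (auto simp: chain_map_def)

lemma chain_complexD:
  assumes "chain_complex C N d"
  shows "arrow C (d k) (N k) (N (k - 1))" "N k \<in> Obj C"
    and "d (k - 1) \<cdot>\<^bsub>C\<^esub> d k = Zero C (N k) (N (k - 2))"
  using assms by (auto simp: chain_complex_def arrow_def)

lemma chain_complexI:
  assumes "\<And>k. arrow C (d k) (N k) (N (k - 1))"
    and "\<And>k. d (k - 1) \<cdot>\<^bsub>C\<^esub> d k = Zero C (N k) (N (k - 2))"
  shows "chain_complex C N d"
  using assms by (auto simp: chain_complex_def arrow_def)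

lemma acyclicD:
  assumes "acyclic_complex C N d"
  shows "chain_complex C N d" "bounded_graded C N"
  using assms by (auto simp: acyclic_complex_def)

lemma acyclicE:
  assumes "acyclic_complex C N d"
  obtains Z i p where "\<And>k. Ses C (Z k) (i k) (N k) (p k) (Z (k - 1))" "\<And>k. d k = i (k - 1) \<cdot>\<^bsub>C\<^esub> p k"
  using assms by (auto simp: acyclic_complex_def)

context deflation_exact
begin

text \<open>Postcomposition with the monic \<open>i\<close> does not change kernels. With
  \<open>i\<close> an inclusion of cycles, this turns a kernel of the map onto the cycles into a
  kernel of the differential.\<close>

lemma kernel_comp_mono:
  assumes S: "Ses C K k A e Z" and i: "is_kernel C Z i B d D"
  shows "is_kernel C K k A (i \<cdot> e) B"
proof (rule kernelI)
  note s = ses_arrows[OF S] and i' = kernel_arrows[OF i]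
  show "arrow C k K A" "arrow C (i \<cdot> e) A B" using s arrow_comp i' by blast+
  have o: "K \<in> Obj C" "Z \<in> Obj C" using s by (auto simp: arrow_def)
  show "(i \<cdot> e) \<cdot> k = Zero C K B" using assoc[OF s(1,2) i'(1)] s(3) comp_zero[OF i'(1) o(1)] by simp
  fix T t assume t: "arrow C t T A" "(i \<cdot> e) \<cdot> t = Zero C T B"
  have T: "T \<in> Obj C" using t by (simp add: arrow_def)
  have "i \<cdot> (e \<cdot> t) = i \<cdot> Zero C T Z"
    using assoc[OF t(1) s(2) i'(1)] t(2) comp_zero[OF i'(1) T] by simp
  then have "e \<cdot> t = Zero C T Z"
    using kernel_mono[OF i arrow_comp[OF t(1) s(2)] arrow_zero[OF T o(2)]] by simp
  then show "\<exists>u. arrow C u T K \<and> k \<cdot> u = t" using ses_lift[OF S t(1)] by blast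
next
  fix T u v assume "arrow C u T K" "arrow C v T K" "k \<cdot> u = k \<cdot> v"
  then show "u = v" using ses_mono[OF S] by blast
qed

lemma acyclicI:
  assumes Z: "\<And>k. Ses C (Z k) (i k) (N k) (p k) (Z (k - 1))" "\<And>k. d k = i (k - 1) \<cdot> p k"
    and b: "bounded_graded C N"
  shows "acyclic_complex C N d"
  unfolding acyclic_complex_def
proof (intro conjI b chain_complexI)
  fix k
  have s1: "arrow C (p k) (N k) (Z (k - 1))" and s2: "arrow C (i (k - 1)) (Z (k - 1)) (N (k - 1))"
    and s3: "arrow C (p (k - 1)) (N (k - 1)) (Z (k - 2))" and s4: "arrow C (i (k - 2)) (Z (k - 2)) (N (k - 2))"
    and z: "p (k - 1) \<cdot> i (k - 1) = Zero C (Z (k - 1)) (Z (k - 2))"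
    using ses_arrows[OF Z(1)[of k]] ses_arrows[OF Z(1)[of "k - 1"]] ses_arrows[OF Z(1)[of "k - 2"]]
    by simp_all
  note d1 = arrow_comp[OF s1 s2]
  show "arrow C (d k) (N k) (N (k - 1))" using d1 Z(2) by simp
  have o: "N k \<in> Obj C" "Z (k - 2) \<in> Obj C" using s1 s3 by (auto simp: arrow_def)
  have "p (k - 1) \<cdot> d k = Zero C (N k) (Z (k - 2))"
    using assoc[OF s1 s2 s3] z zero_comp[OF s1 o(2)] Z(2)[of k] by simp
  then show "d (k - 1) \<cdot> d k = Zero C (N k) (N (k - 2))"
    using assoc[OF d1 s3 s4] Z(2)[of k] Z(2)[of "k - 1"] comp_zero[OF s4 o(1)] by simp
qed (use Z in blast)

text \<open>One step up in degree for the middle complex: \<open>d\<close> lands in the cycles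
  \<open>Z\<close>, and the resulting \<open>e : X -> Z\<close> is compatible with the rows
  \<open>X' -> X -> X''\<close> and \<open>Z' -> Z -> Z''\<close>. The nine lemma makes
  \<open>e\<close> an admissible epimorphism and its kernel \<open>Y\<close> again an extension of
  the outer cycles.\<close>

lemma extension_step:
  assumes S': "Ses C Y' i' X' p' Z'" and S'': "Ses C Y'' i'' X'' p'' Z''"
    and S: "Ses C X' u X v X''" and d: "arrow C d X W" and i: "is_kernel C Z i W dW V"
    and d0: "dW \<cdot> d = Zero C X V" and SZ: "Ses C Z' z' Z z'' Z''"
    and j': "arrow C j' Z' W'" and j'': "is_kernel C Z'' j'' W'' dW'' V''"
    and uv: "arrow C u0 W' W" "arrow C v0 W W''"
    and comm: "d \<cdot> u = u0 \<cdot> (j' \<cdot> p')" "v0 \<cdot> d = (j'' \<cdot> p'') \<cdot> v" "i \<cdot> z' = u0 \<cdot> j'" "j'' \<cdot> z'' = v0 \<cdot> i"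
  shows "\<exists>Y k e h g. Ses C Y k X e Z \<and> d = i \<cdot> e \<and> is_kernel C Y k X d W \<and>
    Ses C Y' h Y g Y'' \<and> k \<cdot> h = u \<cdot> i' \<and> i'' \<cdot> g = v \<cdot> k"
proof -
  note s' = ses_arrows[OF S'] and s'' = ses_arrows[OF S''] and s = ses_arrows[OF S] and sZ = ses_arrows[OF SZ]
  note ia = kernel_arrows(1)[OF i] and ja = kernel_arrows(1)[OF j'']
  obtain e where e: "arrow C e X Z" "i \<cdot> e = d" using kernel_lift[OF i d d0] by blast
  have "i \<cdot> (e \<cdot> u) = i \<cdot> (z' \<cdot> p')"
    using assoc[OF s(1) e(1) ia] e(2) comm(1,3) assoc[OF s'(2) j' uv(1)] assoc[OF s'(2) sZ(1) ia] by metis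
  then have 1: "e \<cdot> u = z' \<cdot> p'"
    using kernel_mono[OF i arrow_comp[OF s(1) e(1)] arrow_comp[OF s'(2) sZ(1)]] by simp
  have "j'' \<cdot> (z'' \<cdot> e) = v0 \<cdot> d"
    using assoc[OF e(1) sZ(2) ja] comm(4) assoc[OF e(1) ia uv(2)] e(2) by simp
  also have "\<dots> = j'' \<cdot> (p'' \<cdot> v)" using assoc[OF s(2) s''(2) ja] comm(2) by simp
  finally have 2: "z'' \<cdot> e = p'' \<cdot> v"
    using kernel_mono[OF j'' arrow_comp[OF e(1) sZ(2)] arrow_comp[OF s(2) s''(2)]] by simp
  obtain Y k h g where "Ses C Y k X e Z" "Ses C Y' h Y g Y''" "k \<cdot> h = u \<cdot> i'" "i'' \<cdot> g = v \<cdot> k"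
    using nine_lemma[OF S SZ S' S'' e(1) 1 2] by blast
  moreover from this(1) have "is_kernel C Y k X d W" using kernel_comp_mono[OF _ i] e(2) by metis
  ultimately show ?thesis using e(2) by blast
qed

text \<open>The cycles of the middle complex are constructed upwards from the degrees where all
  three complexes vanish. The induction also carries their presentation as extensions of the outer
  cycles, without which the nine lemma could not be applied in the next degree.\<close>

lemma acyclic_extension:
  assumes X: "chain_complex C X d" and X': "acyclic_complex C X' d'" and X'': "acyclic_complex C X'' d''"
    and S: "\<And>k. Ses C (X' k) (u k) (X k) (v k) (X'' k)"
    and u: "chain_map C X' d' u X d" and v: "chain_map C X d v X'' d''"
  shows "acyclic_complex C X d"
proof -
  obtain Z' i' p' where Z': "\<And>k. Ses C (Z' k) (i' k) (X' k) (p' k) (Z' (k - 1))" "\<And>k. d' k = i' (k - 1) \<cdot> p' k"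
    using acyclicE[OF X'] by blast
  obtain Z'' i'' p'' where Z'': "\<And>k. Ses C (Z'' k) (i'' k) (X'' k) (p'' k) (Z'' (k - 1))"
      "\<And>k. d'' k = i'' (k - 1) \<cdot> p'' k"
    using acyclicE[OF X''] by blast
  obtain a' b' where ab': "\<And>k. k < a' \<or> b' < k \<Longrightarrow> zero_object C (X' k)"
    using acyclicD(2)[OF X'] unfolding bounded_graded_def by blast
  obtain a'' b'' where ab'': "\<And>k. k < a'' \<or> b'' < k \<Longrightarrow> zero_object C (X'' k)"
    using acyclicD(2)[OF X''] unfolding bounded_graded_def by blast
  \<comment> \<open>One below both lower bounds, so that all terms and all outer cycles vanish in
    degree \<open>a\<close> itself, where the recursion starts.\<close>
  define a where "a = min a' a'' - 1"
  have zero: "zero_object C (X k)" if "k < min a' a'' \<or> max b' b'' < k" for k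
    using extension_of_zero[OF S[of k]] ab'[of k] ab''[of k] that by auto
  then have bd: "bounded_graded C X" unfolding bounded_graded_def by blast
  have zX: "zero_object C (X k)" "zero_object C (Z' k)" "zero_object C (Z'' k)"
      "zero_object C (X' k)" "zero_object C (X'' k)" if "k \<le> a" for k
    using that zero[of k] kernel_of_zero(1)[OF Z'(1)[of k]] kernel_of_zero(1)[OF Z''(1)[of k]] ab'[of k] ab''[of k]
    by (auto simp: a_def)
  \<comment> \<open>A state consists of a cycle object of \<open>X k\<close>, its inclusion, and the
    two maps presenting it as an extension. \<open>Q\<close> links consecutive states by an exact
    sequence through which the differential factors.\<close>
  define P where "P k s \<longleftrightarrow> (case s of (Z, i, z', z'') \<Rightarrow> is_kernel C Z i (X k) (d k) (X (k - 1)) \<and>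
      Ses C (Z' k) z' Z z'' (Z'' k) \<and> i \<cdot> z' = u k \<cdot> i' k \<and> i'' k \<cdot> z'' = v k \<cdot> i)"
    for k and s :: "'o \<times> 'm \<times> 'm \<times> 'm"
  define Q where "Q k s t \<longleftrightarrow> (case s of (Z, i, _) \<Rightarrow> case t of (Y, j, _) \<Rightarrow>
      \<exists>e. Ses C Y j (X (k + 1)) e Z \<and> d (k + 1) = i \<cdot> e)" for k and s t :: "'o \<times> 'm \<times> 'm \<times> 'm"
  define g where "g k = (X k, Ident C (X k), Zero C (Z' k) (X k), Zero C (X k) (Z'' k))" for k
  note Xd = chain_complexD[OF X]
  have "\<exists>f. \<forall>k. P k (f k) \<and> Q k (f k) (f (k + 1))"
  proof (rule int_choice_up[where g = g and a = a])
    fix k assume k: "k \<le> a"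
    note z = zX[OF k]
    have o: "X k \<in> Obj C" "Z' k \<in> Obj C" "Z'' k \<in> Obj C" using z zero_object_obj by auto
    note id = arrow_ident[OF o(1)]
    have "d k = Zero C (X k) (X (k - 1))" using from_zero[OF z(1) Xd(1)] .
    then have ker: "is_kernel C (X k) (Ident C (X k)) (X k) (d k) (X (k - 1))"
      using kernel_comp_mono[OF ses_zero_right[OF zX(1)[of "k - 1"] o(1)]
          ses_kernel[OF ses_zero_right[OF z(1) Xd(2)[of "k - 1"]]]] k id_left[OF arrow_zero[OF o(1) Xd(2)[of "k - 1"]]] by auto
    have "Ses C (Z' k) (Zero C (Z' k) (X k)) (X k) (Zero C (X k) (Z'' k)) (Z'' k)"
      by (rule ses_zeros[OF z(2,1,3)])
    moreover have "Ident C (X k) \<cdot> Zero C (Z' k) (X k) = u k \<cdot> i' k"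
      using id_left[OF arrow_zero[OF o(2,1)]]
        from_zero[OF z(2) arrow_comp[OF ses_arrows(1)[OF Z'(1)] chain_mapD(1)[OF u]]] by simp
    moreover have "i'' k \<cdot> Zero C (X k) (Z'' k) = v k \<cdot> Ident C (X k)"
      using id_right[OF chain_mapD(1)[OF v, of k]] to_zero[OF z(5) chain_mapD(1)[OF v]]
        comp_zero[OF ses_arrows(1)[OF Z''(1)[of k]] o(1)] by metis
    ultimately show "P k (g k)" using ker by (simp add: P_def g_def)
  next
    fix k assume k: "k < a"
    have "d (k + 1) = Zero C (X (k + 1)) (X k)"
      using from_zero[OF zX(1)[of "k + 1"] Xd(1)[of "k + 1"]] k by simp
    moreover have "Ses C (X (k + 1)) (Ident C (X (k + 1))) (X (k + 1)) (Zero C (X (k + 1)) (X k)) (X k)"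
      by (rule ses_zero_right[OF zX(1) Xd(2)]) (use k in simp)
    ultimately show "Q k (g k) (g (k + 1))"
      using id_left[OF arrow_zero[OF Xd(2)[of "k + 1"] Xd(2)[of k]]] by (auto simp: Q_def g_def)
  next
    fix k s assume "P k s"
    then obtain Z i z' z'' where s: "s = (Z, i, z', z'')" and ker: "is_kernel C Z i (X k) (d k) (X (k - 1))"
      and SZ: "Ses C (Z' k) z' Z z'' (Z'' k)" and c: "i \<cdot> z' = u k \<cdot> i' k" "i'' k \<cdot> z'' = v k \<cdot> i"
      by (cases s) (auto simp: P_def)
    have S': "Ses C (Z' (k + 1)) (i' (k + 1)) (X' (k + 1)) (p' (k + 1)) (Z' k)"
      and S'': "Ses C (Z'' (k + 1)) (i'' (k + 1)) (X'' (k + 1)) (p'' (k + 1)) (Z'' k)"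
      using Z'(1)[of "k + 1"] Z''(1)[of "k + 1"] by simp_all
    have dk: "arrow C (d (k + 1)) (X (k + 1)) (X k)" "d k \<cdot> d (k + 1) = Zero C (X (k + 1)) (X (k - 1))"
      using Xd(1)[of "k + 1"] Xd(3)[of "k + 1"] by simp_all
    have m: "d (k + 1) \<cdot> u (k + 1) = u k \<cdot> (i' k \<cdot> p' (k + 1))" "v k \<cdot> d (k + 1) = (i'' k \<cdot> p'' (k + 1)) \<cdot> v (k + 1)"
      using chain_mapD(2)[OF u, of "k + 1"] chain_mapD(2)[OF v, of "k + 1"] Z'(2)[of "k + 1"] Z''(2)[of "k + 1"]
      by simp_all
    show "\<exists>t. P (k + 1) t \<and> Q k s t"
      using extension_step[OF S' S'' S[of "k + 1"] dk(1) ker dk(2) SZ ses_arrows(1)[OF Z'(1)[of k]]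
          ses_kernel[OF Z''(1)[of k]] chain_mapD(1)[OF u] chain_mapD(1)[OF v] m c]
      by (fastforce simp: P_def Q_def s)
  qed
  then obtain f where f: "\<And>k. P k (f k)" "\<And>k. Q k (f k) (f (k + 1))" by blast
  have "\<exists>e. Ses C (fst (f k)) (fst (snd (f k))) (X k) e (fst (f (k - 1))) \<and> d k = fst (snd (f (k - 1))) \<cdot> e" for k
    using f(2)[of "k - 1"] by (auto simp: Q_def split: prod.splits)
  then obtain e where "\<And>k. Ses C (fst (f k)) (fst (snd (f k))) (X k) (e k) (fst (f (k - 1)))"
    "\<And>k. d k = fst (snd (f (k - 1))) \<cdot> e k" by metis
  then show ?thesis using acyclicI[where Z = "\<lambda>k. fst (f k)" and i = "\<lambda>k. fst (snd (f k))"] bd by blast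
qed

lemma chain_map_factor:
  assumes m: "\<And>k T a b. \<lbrakk>arrow C a T (R k); arrow C b T (R k); j k \<cdot> a = j k \<cdot> b\<rbrakk> \<Longrightarrow> a = b"
    and j: "chain_map C R dR j Q dQ" and jh: "chain_map C S dS (\<lambda>k. j k \<cdot> h k) Q dQ"
    and h: "\<And>k. arrow C (h k) (S k) (R k)"
    and d: "\<And>k. arrow C (dR k) (R k) (R (k - 1))" "\<And>k. arrow C (dS k) (S k) (S (k - 1))"
      "\<And>k. arrow C (dQ k) (Q k) (Q (k - 1))"
  shows "chain_map C S dS h R dR"
  unfolding chain_map_def
proof (intro allI conjI h)
  fix k
  note jk = chain_mapD[OF j, of k] and jk1 = chain_mapD(1)[OF j, of "k - 1"]
  have "j (k - 1) \<cdot> (h (k - 1) \<cdot> dS k) = j (k - 1) \<cdot> (dR k \<cdot> h k)"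
    using chain_mapD(2)[OF jh, of k] assoc[OF d(2) h jk1] assoc[OF h d(1) jk1] jk(2)
      assoc[OF h jk(1) d(3)] by simp
  then show "h (k - 1) \<cdot> dS k = dR k \<cdot> h k"
    using m[OF arrow_comp[OF d(2) h] arrow_comp[OF h d(1)]] by simp
qed

text \<open>The universal property supplies the differentials, and monicity shows that they square
  to zero. Acyclicity is not automatic and is obtained separately where it holds.\<close>

lemma kernel_complex:
  assumes ker: "\<And>k. is_kernel C (R k) (j k) (Q k) (g k) (X k)"
    and Q: "chain_complex C Q dQ" and X: "chain_complex C X dX" and g: "chain_map C Q dQ g X dX"
  shows "\<exists>dR. chain_complex C R dR \<and> chain_map C R dR j Q dQ"
proof -
  note Qd = chain_complexD[OF Q] and Xd = chain_complexD[OF X] and ga = chain_mapD[OF g]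
  have ja: "arrow C (j k) (R k) (Q k)" for k using kernel_arrows(1)[OF ker] .
  have R: "R k \<in> Obj C" for k using ja[of k] by (simp add: arrow_def)
  have "\<exists>d. arrow C d (R k) (R (k - 1)) \<and> j (k - 1) \<cdot> d = dQ k \<cdot> j k" for k
  proof -
    have "g (k - 1) \<cdot> (dQ k \<cdot> j k) = Zero C (R k) (X (k - 1))"
      using assoc[OF ja[of k] Qd(1)[of k] ga(1)[of "k - 1"]] ga(2)[of k]
        assoc[OF ja[of k] ga(1)[of k] Xd(1)[of k]] kernel_zero[OF ker[of k]] comp_zero[OF Xd(1)[of k] R[of k]]
      by simp
    then show ?thesis using kernel_lift[OF ker arrow_comp[OF ja Qd(1)]] by blast
  qed
  then obtain dR where dR: "\<And>k. arrow C (dR k) (R k) (R (k - 1))" "\<And>k. j (k - 1) \<cdot> dR k = dQ k \<cdot> j k" by metis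
  have "chain_complex C R dR"
  proof (rule chain_complexI)
    fix k
    show "arrow C (dR k) (R k) (R (k - 1))" by (rule dR(1))
    have d2: "arrow C (dR (k - 1)) (R (k - 1)) (R (k - 2))" "arrow C (dQ (k - 1)) (Q (k - 1)) (Q (k - 2))"
        "j (k - 2) \<cdot> dR (k - 1) = dQ (k - 1) \<cdot> j (k - 1)"
      using dR[of "k - 1"] Qd(1)[of "k - 1"] by simp_all
    have "j (k - 2) \<cdot> (dR (k - 1) \<cdot> dR k) = dQ (k - 1) \<cdot> (dQ k \<cdot> j k)"
      using assoc[OF dR(1) d2(1) ja] d2(3) assoc[OF dR(1) ja d2(2)] dR(2)[of k] by simp
    also have "\<dots> = j (k - 2) \<cdot> Zero C (R k) (R (k - 2))"
      using assoc[OF ja Qd(1) d2(2)] Qd(3)[of k] zero_comp[OF ja Qd(2)] comp_zero[OF ja R] by simp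
    finally show "dR (k - 1) \<cdot> dR k = Zero C (R k) (R (k - 2))"
      using kernel_mono[OF ker arrow_comp[OF dR(1) d2(1)] arrow_zero[OF R R]] by simp
  qed
  then show ?thesis using dR(2) ja by (auto simp: chain_map_def)
qed

lemma pullback_complex:
  assumes pb: "\<And>k. is_pullback C (D k) (f' k) (p' k) (B k) (E k) (p k) (f k) (A k)"
    and B: "chain_complex C B dB" and E: "chain_complex C E dE" and A: "chain_complex C A dA"
    and p: "chain_map C B dB p A dA" and f: "chain_map C E dE f A dA"
  shows "\<exists>dD. chain_complex C D dD \<and> chain_map C D dD f' B dB \<and> chain_map C D dD p' E dE"
proof -
  note Bd = chain_complexD[OF B] and Ed = chain_complexD[OF E] and Ad = chain_complexD[OF A]
    and pa = chain_mapD[OF p] and fa = chain_mapD[OF f]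
  have a: "arrow C (f' k) (D k) (B k)" "arrow C (p' k) (D k) (E k)" "p k \<cdot> f' k = f k \<cdot> p' k" for k
    using pullback_arrows[OF pb] by auto
  have D: "D k \<in> Obj C" for k using a(1)[of k] by (simp add: arrow_def)
  have "\<exists>d. arrow C d (D k) (D (k - 1)) \<and> f' (k - 1) \<cdot> d = dB k \<cdot> f' k \<and> p' (k - 1) \<cdot> d = dE k \<cdot> p' k" for k
  proof -
    have "p (k - 1) \<cdot> (dB k \<cdot> f' k) = f (k - 1) \<cdot> (dE k \<cdot> p' k)"
      using assoc[OF a(1)[of k] Bd(1)[of k] pa(1)[of "k - 1"]] assoc[OF a(2)[of k] Ed(1)[of k] fa(1)[of "k - 1"]]
        pa(2)[of k] fa(2)[of k] assoc[OF a(1)[of k] pa(1)[of k] Ad(1)[of k]]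
        assoc[OF a(2)[of k] fa(1)[of k] Ad(1)[of k]] a(3)[of k] by simp
    then show ?thesis
      using pullback_lift[OF pb arrow_comp[OF a(1) Bd(1)] arrow_comp[OF a(2) Ed(1)]] by metis
  qed
  then obtain dD where d: "\<And>k. arrow C (dD k) (D k) (D (k - 1))" "\<And>k. f' (k - 1) \<cdot> dD k = dB k \<cdot> f' k"
    "\<And>k. p' (k - 1) \<cdot> dD k = dE k \<cdot> p' k" by metis
  have "chain_complex C D dD"
  proof (rule chain_complexI)
    fix k
    show "arrow C (dD k) (D k) (D (k - 1))" by (rule d(1))
    have d2: "arrow C (dD (k - 1)) (D (k - 1)) (D (k - 2))" "arrow C (dB (k - 1)) (B (k - 1)) (B (k - 2))"
        "arrow C (dE (k - 1)) (E (k - 1)) (E (k - 2))" "f' (k - 2) \<cdot> dD (k - 1) = dB (k - 1) \<cdot> f' (k - 1)"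
        "p' (k - 2) \<cdot> dD (k - 1) = dE (k - 1) \<cdot> p' (k - 1)"
      using d[of "k - 1"] Bd(1)[of "k - 1"] Ed(1)[of "k - 1"] by simp_all
    have "f' (k - 2) \<cdot> (dD (k - 1) \<cdot> dD k) = dB (k - 1) \<cdot> (dB k \<cdot> f' k)"
      using assoc[OF d(1) d2(1) a(1)] d2(4) assoc[OF d(1) a(1) d2(2)] d(2)[of k] by simp
    also have "\<dots> = f' (k - 2) \<cdot> Zero C (D k) (D (k - 2))"
      using assoc[OF a(1) Bd(1) d2(2)] Bd(3)[of k] zero_comp[OF a(1) Bd(2)] comp_zero[OF a(1) D] by simp
    finally have 1: "f' (k - 2) \<cdot> (dD (k - 1) \<cdot> dD k) = f' (k - 2) \<cdot> Zero C (D k) (D (k - 2))" .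
    have "p' (k - 2) \<cdot> (dD (k - 1) \<cdot> dD k) = dE (k - 1) \<cdot> (dE k \<cdot> p' k)"
      using assoc[OF d(1) d2(1) a(2)] d2(5) assoc[OF d(1) a(2) d2(3)] d(3)[of k] by simp
    also have "\<dots> = p' (k - 2) \<cdot> Zero C (D k) (D (k - 2))"
      using assoc[OF a(2) Ed(1) d2(3)] Ed(3)[of k] zero_comp[OF a(2) Ed(2)] comp_zero[OF a(2) D] by simp
    finally show "dD (k - 1) \<cdot> dD k = Zero C (D k) (D (k - 2))"
      using pullback_eq[OF pb arrow_comp[OF d(1) d2(1)] arrow_zero[OF D D] 1] by simp
  qed
  then show ?thesis using d a by (auto simp: chain_map_def)
qed

lemma biproduct_complex:
  assumes b: "\<And>k. biproduct C (X k) (Y k) (S k) (inX k) (inY k) (prX k) (prY k)"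
    and X: "chain_complex C X dX" and Y: "chain_complex C Y dY"
  shows "\<exists>d. chain_complex C S d \<and> chain_map C X dX inX S d \<and> chain_map C Y dY inY S d \<and>
    chain_map C S d prX X dX \<and> chain_map C S d prY Y dY"
proof -
  note Xd = chain_complexD[OF X] and Yd = chain_complexD[OF Y] and a = biproduct_arrows[OF b]
  have "\<exists>d. arrow C d (S k) (S (k - 1)) \<and> d \<cdot> inX k = inX (k - 1) \<cdot> dX k \<and> d \<cdot> inY k = inY (k - 1) \<cdot> dY k" for k
    using biproduct_copair[OF b arrow_comp[OF Xd(1) a(1)] arrow_comp[OF Yd(1) a(2)]] by metis
  then obtain d where d: "\<And>k. arrow C (d k) (S k) (S (k - 1))" "\<And>k. d k \<cdot> inX k = inX (k - 1) \<cdot> dX k"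
    "\<And>k. d k \<cdot> inY k = inY (k - 1) \<cdot> dY k" by metis
  have S: "S k \<in> Obj C" for k using d(1)[of k] by (simp add: arrow_def)
  have "chain_complex C S d"
  proof (rule chain_complexI)
    fix k
    show "arrow C (d k) (S k) (S (k - 1))" by (rule d(1))
    have d2: "arrow C (d (k - 1)) (S (k - 1)) (S (k - 2))" "d (k - 1) \<cdot> inX (k - 1) = inX (k - 2) \<cdot> dX (k - 1)"
        "d (k - 1) \<cdot> inY (k - 1) = inY (k - 2) \<cdot> dY (k - 1)" "arrow C (dX (k - 1)) (X (k - 1)) (X (k - 2))"
        "arrow C (dY (k - 1)) (Y (k - 1)) (Y (k - 2))"
      using d[of "k - 1"] Xd(1)[of "k - 1"] Yd(1)[of "k - 1"] by simp_all
    have "(d (k - 1) \<cdot> d k) \<cdot> inX k = (d (k - 1) \<cdot> inX (k - 1)) \<cdot> dX k"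
      using assoc[OF a(1) d(1) d2(1)] d(2)[of k] assoc[OF Xd(1) a(1) d2(1)] by simp
    also have "\<dots> = Zero C (S k) (S (k - 2)) \<cdot> inX k"
      using d2(2) assoc[OF Xd(1) d2(4) a(1)] Xd(3)[of k] comp_zero[OF a(1) Xd(2)] zero_comp[OF a(1) S] by simp
    finally have 1: "(d (k - 1) \<cdot> d k) \<cdot> inX k = Zero C (S k) (S (k - 2)) \<cdot> inX k" .
    have "(d (k - 1) \<cdot> d k) \<cdot> inY k = (d (k - 1) \<cdot> inY (k - 1)) \<cdot> dY k"
      using assoc[OF a(2) d(1) d2(1)] d(3)[of k] assoc[OF Yd(1) a(2) d2(1)] by simp
    also have "\<dots> = Zero C (S k) (S (k - 2)) \<cdot> inY k"
      using d2(3) assoc[OF Yd(1) d2(5) a(2)] Yd(3)[of k] comp_zero[OF a(2) Yd(2)] zero_comp[OF a(2) S] by simp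
    finally show "d (k - 1) \<cdot> d k = Zero C (S k) (S (k - 2))"
      by (rule biproduct_eq[OF b arrow_comp[OF d(1) d2(1)] arrow_zero[OF S S] 1])
  qed
  moreover have "prX (k - 1) \<cdot> d k = dX k \<cdot> prX k" for k
  proof (rule biproduct_eq[OF b arrow_comp[OF d(1) a(3)] arrow_comp[OF a(3) Xd(1)]])
    show "(prX (k - 1) \<cdot> d k) \<cdot> inX k = (dX k \<cdot> prX k) \<cdot> inX k"
      using assoc[OF a(1) d(1) a(3)] d(2)[of k] assoc[OF Xd(1) a(1,3)] assoc[OF a(1,3) Xd(1)] a(5)
        id_left[OF Xd(1)] id_right[OF Xd(1)] by simp
    show "(prX (k - 1) \<cdot> d k) \<cdot> inY k = (dX k \<cdot> prX k) \<cdot> inY k"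
      using assoc[OF a(2) d(1) a(3)] d(3)[of k] assoc[OF Yd(1) a(2,3)] assoc[OF a(2,3) Xd(1)] a(8)
        comp_zero[OF Xd(1) Yd(2)] zero_comp[OF Yd(1) Xd(2)] by simp
  qed
  moreover have "prY (k - 1) \<cdot> d k = dY k \<cdot> prY k" for k
  proof (rule biproduct_eq[OF b arrow_comp[OF d(1) a(4)] arrow_comp[OF a(4) Yd(1)]])
    show "(prY (k - 1) \<cdot> d k) \<cdot> inX k = (dY k \<cdot> prY k) \<cdot> inX k"
      using assoc[OF a(1) d(1) a(4)] d(2)[of k] assoc[OF Xd(1) a(1,4)] assoc[OF a(1,4) Yd(1)] a(7)
        comp_zero[OF Yd(1) Xd(2)] zero_comp[OF Xd(1) Yd(2)] by simp
    show "(prY (k - 1) \<cdot> d k) \<cdot> inY k = (dY k \<cdot> prY k) \<cdot> inY k"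
      using assoc[OF a(2) d(1) a(4)] d(3)[of k] assoc[OF Yd(1) a(2,4)] assoc[OF a(2,4) Yd(1)] a(6)
        id_left[OF Yd(1)] id_right[OF Yd(1)] by simp
  qed
  ultimately show ?thesis using d a(1-4) unfolding chain_map_def by metis
qed

text \<open>
  The kernel of a term-wise admissible epimorphism of acyclic complexes need not be acyclic; it is
  if the induced maps \<open>v\<close> on cycles are admissible epimorphisms too.
\<close>

lemma acyclic_kernel:
  assumes V: "\<And>k. Ses C (V k) (\<iota> k) (T k) (\<pi> k) (V (k - 1))" "\<And>k. dT k = \<iota> (k - 1) \<cdot> \<pi> k"
    and Z: "\<And>k. Ses C (Z k) (i k) (N k) (p k) (Z (k - 1))"
    and v: "\<And>k. Ses C (L k) (l k) (V k) (v k) (Z k)"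
    and c: "\<And>k. \<phi> k \<cdot> \<iota> k = i k \<cdot> v k" "\<And>k. p k \<cdot> \<phi> k = v (k - 1) \<cdot> \<pi> k"
    and K: "\<And>k. Ses C (K k) (\<kappa> k) (T k) (\<phi> k) (N k)"
    and d: "chain_complex C K \<delta>" "chain_map C K \<delta> \<kappa> T dT"
    and b: "bounded_graded C T"
  shows "acyclic_complex C K \<delta>"
proof -
  have "\<exists>h g. Ses C (L k) h (K k) g (L (k - 1)) \<and> \<kappa> k \<cdot> h = \<iota> k \<cdot> l k \<and> l (k - 1) \<cdot> g = \<pi> k \<cdot> \<kappa> k" for k
    using nine_lemma_kernels[OF V(1)[of k] Z[of k] v[of k] v[of "k - 1"] ses_arrows(2)[OF K[of k]]
        c(1)[of k] c(2)[of k] K[of k]] .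
  then obtain h g where hg: "\<And>k. Ses C (L k) (h k) (K k) (g k) (L (k - 1))" "\<And>k. \<kappa> k \<cdot> h k = \<iota> k \<cdot> l k"
    "\<And>k. l (k - 1) \<cdot> g k = \<pi> k \<cdot> \<kappa> k" by metis
  have "\<delta> k = h (k - 1) \<cdot> g k" for k
  proof -
    note hk = ses_arrows(1)[OF hg(1)[of "k - 1"]] and gk = ses_arrows(2)[OF hg(1)[of k]]
    note \<kappa> = ses_arrows(1)[OF K] and V1 = ses_arrows(1)[OF V(1)[of "k - 1"]] and V2 = ses_arrows(2)[OF V(1)[of k]]
      and lk = ses_arrows(1)[OF v[of "k - 1"]]
    have "\<kappa> (k - 1) \<cdot> (h (k - 1) \<cdot> g k) = \<iota> (k - 1) \<cdot> (l (k - 1) \<cdot> g k)"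
      using assoc[OF gk hk \<kappa>] hg(2)[of "k - 1"] assoc[OF gk lk V1] by simp
    also have "\<dots> = \<kappa> (k - 1) \<cdot> \<delta> k"
      using hg(3)[of k] assoc[OF \<kappa> V2 V1] V(2)[of k] chain_mapD(2)[OF d(2), of k] by simp
    finally show ?thesis
      using ses_mono[OF K chain_complexD(1)[OF d(1)] arrow_comp[OF gk hk]] by simp
  qed
  moreover have "bounded_graded C K"
    using b kernel_of_zero(1)[OF K] unfolding bounded_graded_def by blast
  ultimately show ?thesis using acyclicI[where Z = L and i = h and p = g] hg(1) by blast
qed

end

context preadditive_category
begin

lemma plus_assoc_comm:
  assumes "arrow C f X Y" "arrow C g X Y" "arrow C h X Y"
  shows "Plus C (Plus C f g) h = Plus C f (Plus C g h)" "Plus C f g = Plus C g f"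
proof -
  interpret comm_group "hom_group C X Y" using assms hom_comm_group by (simp add: arrow_def)
  show "Plus C (Plus C f g) h = Plus C f (Plus C g h)" "Plus C f g = Plus C g f"
    using m_assoc[of f g h] m_comm[of f g] assms by (auto simp: arrow_def hom_group_def)
qed

lemma plus_cancel:
  assumes "arrow C f X Y" "arrow C g X Y" "arrow C h X Y" "Plus C f g = Plus C f h"
  shows "g = h"
proof -
  interpret comm_group "hom_group C X Y" using assms hom_comm_group by (simp add: arrow_def)
  show ?thesis using Units_l_cancel[of f g h] Units_eq assms by (auto simp: arrow_def hom_group_def)
qed

lemma chain_map_comp:
  assumes f: "chain_map C X dX f Y dY" and g: "chain_map C Y dY g Z dZ"
    and d: "\<And>k. arrow C (dX k) (X k) (X (k - 1))" "\<And>k. arrow C (dY k) (Y k) (Y (k - 1))"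
      "\<And>k. arrow C (dZ k) (Z k) (Z (k - 1))"
  shows "chain_map C X dX (\<lambda>k. g k \<cdot> f k) Z dZ"
  unfolding chain_map_def
proof (intro allI conjI)
  fix k
  note fk = chain_mapD[OF f, of k] and gk = chain_mapD[OF g, of k]
    and f1 = chain_mapD(1)[OF f, of "k - 1"] and g1 = chain_mapD(1)[OF g, of "k - 1"]
  show "arrow C (g k \<cdot> f k) (X k) (Z k)" by (rule arrow_comp[OF fk(1) gk(1)])
  show "(g (k - 1) \<cdot> f (k - 1)) \<cdot> dX k = dZ k \<cdot> (g k \<cdot> f k)"
    using assoc[OF d(1)[of k] f1 g1] fk(2) assoc[OF fk(1) d(2)[of k] g1] gk(2) assoc[OF fk(1) gk(1) d(3)[of k]]
    by simp
qed

lemma chain_map_pullback: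
  assumes pb: "\<And>k. is_pullback C (D k) (f' k) (p' k) (B k) (E k) (p k) (f k) (A k)"
    and f': "chain_map C D dD f' B dB" and p': "chain_map C D dD p' E dE"
    and fh: "chain_map C S dS (\<lambda>k. f' k \<cdot> h k) B dB" and ph: "chain_map C S dS (\<lambda>k. p' k \<cdot> h k) E dE"
    and h: "\<And>k. arrow C (h k) (S k) (D k)"
    and d: "\<And>k. arrow C (dD k) (D k) (D (k - 1))" "\<And>k. arrow C (dS k) (S k) (S (k - 1))"
      "\<And>k. arrow C (dB k) (B k) (B (k - 1))" "\<And>k. arrow C (dE k) (E k) (E (k - 1))"
  shows "chain_map C S dS h D dD"
  unfolding chain_map_def
proof (intro allI conjI h)
  fix k
  note f'k = chain_mapD[OF f', of k] and f'1 = chain_mapD(1)[OF f', of "k - 1"]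
  note p'k = chain_mapD[OF p', of k] and p'1 = chain_mapD(1)[OF p', of "k - 1"]
  have 1: "f' (k - 1) \<cdot> (h (k - 1) \<cdot> dS k) = f' (k - 1) \<cdot> (dD k \<cdot> h k)"
    using chain_mapD(2)[OF fh, of k] assoc[OF d(2)[of k] h f'1] assoc[OF h[of k] d(1)[of k] f'1] f'k(2)
      assoc[OF h[of k] f'k(1) d(3)[of k]] by simp
  have 2: "p' (k - 1) \<cdot> (h (k - 1) \<cdot> dS k) = p' (k - 1) \<cdot> (dD k \<cdot> h k)"
    using chain_mapD(2)[OF ph, of k] assoc[OF d(2)[of k] h p'1] assoc[OF h[of k] d(1)[of k] p'1] p'k(2)
      assoc[OF h[of k] p'k(1) d(4)[of k]] by simp
  show "h (k - 1) \<cdot> dS k = dD k \<cdot> h k"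
    by (rule pullback_eq[OF pb arrow_comp[OF d(2) h] arrow_comp[OF h d(1)] 1 2])
qed

end

section \<open>Binary complexes in a deflation-exact category\<close>

lemma Bq_simps [simp]:
  "Obj (Bq C) = binary_objects C" "Hom (Bq C) = binary_homs C"
  "mor_at (g \<cdot>\<^bsub>Bq C\<^esub> f) k = mor_at g k \<cdot>\<^bsub>C\<^esub> mor_at f k"
  "mor_at (Ident (Bq C) X) k = Ident C (obj_at X k)"
  "mor_at (Plus (Bq C) f g) k = Plus C (mor_at f k) (mor_at g k)"
  "mor_at (Zero (Bq C) X Y) k = Zero C (obj_at X k) (obj_at Y k)"
  by (simp_all add: Bq_def)

lemma graded_eqI:
  "\<lbrakk>f \<in> range Graded_mor; g \<in> range Graded_mor; \<And>k. mor_at f k = mor_at g k\<rbrakk> \<Longrightarrow> f = g"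
  by (auto intro!: ext)

lemma Bq_range:
  "g \<cdot>\<^bsub>Bq C\<^esub> f \<in> range Graded_mor" "Ident (Bq C) X \<in> range Graded_mor"
  "Plus (Bq C) f g \<in> range Graded_mor" "Zero (Bq C) X Y \<in> range Graded_mor"
  by (simp_all add: Bq_def)

lemma binary_objectsD:
  assumes "X \<in> binary_objects C"
  shows "X = Binary (obj_at X) (diff X) (diff' X)"
    and "acyclic_complex C (obj_at X) (diff X)" "acyclic_complex C (obj_at X) (diff' X)"
    and "chain_complex C (obj_at X) (diff X)" "chain_complex C (obj_at X) (diff' X)"
    and "obj_at X k \<in> Obj C"
    and "arrow C (diff X k) (obj_at X k) (obj_at X (k - 1))"
    and "arrow C (diff' X k) (obj_at X k) (obj_at X (k - 1))"
  using assms acyclicD(1)[THEN chain_complexD(1), of C "obj_at X" _ k] acyclicD(1)[of C "obj_at X"]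
    acyclicD(1)[THEN chain_complexD(2), of C "obj_at X" _ k]
  by (auto simp: binary_objects_def)

lemma arrow_BqD:
  assumes "arrow (Bq C) f X Y"
  shows "X \<in> binary_objects C" "Y \<in> binary_objects C" "f \<in> range Graded_mor"
    and "arrow C (mor_at f k) (obj_at X k) (obj_at Y k)"
    and "chain_map C (obj_at X) (diff X) (mor_at f) (obj_at Y) (diff Y)"
    and "chain_map C (obj_at X) (diff' X) (mor_at f) (obj_at Y) (diff' Y)"
  using assms binary_objectsD(6)[of X C] binary_objectsD(6)[of Y C]
  by (auto simp: arrow_def chain_map_def binary_homs_def)

lemma arrow_BqI:
  assumes "X \<in> binary_objects C" "Y \<in> binary_objects C" "f \<in> range Graded_mor"
    and "chain_map C (obj_at X) (diff X) (mor_at f) (obj_at Y) (diff Y)"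
    and "chain_map C (obj_at X) (diff' X) (mor_at f) (obj_at Y) (diff' Y)"
  shows "arrow (Bq C) f X Y"
  using assms by (auto simp: arrow_def chain_map_def binary_homs_def)

lemma arrow_Bq_eqI:
  assumes "arrow (Bq C) f X Y" "arrow (Bq C) g X Y" "\<And>k. mor_at f k = mor_at g k"
  shows "f = g"
  by (rule graded_eqI[OF arrow_BqD(3)[OF assms(1)] arrow_BqD(3)[OF assms(2)] assms(3)])

lemma Ses_Bq:
  "Ses (Bq C) A i B p D \<longleftrightarrow> arrow (Bq C) i A B \<and> arrow (Bq C) p B D \<and>
     (\<forall>k. Ses C (obj_at A k) (mor_at i k) (obj_at B k) (mor_at p k) (obj_at D k))"
  by (auto simp: Bq_def arrow_def)

locale multi_deflation_exact = deflation_exact C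
  for C :: "(('o, 'm) multi_obj, 'm multi_mor) exact_cat" (structure)
begin

lemma category_Bq: "category (Bq C)"
proof
  fix X assume X: "X \<in> Obj (Bq C)"
  have "arrow (Bq C) (Ident (Bq C) X) X X"
    using X arrow_ident binary_objectsD(6)[of X C] id_left[OF binary_objectsD(7)[of X C]]
      id_right[OF binary_objectsD(7)[of X C]] id_left[OF binary_objectsD(8)[of X C]]
      id_right[OF binary_objectsD(8)[of X C]]
    by (intro arrow_BqI) (simp_all add: Bq_range chain_map_def)
  then show "Ident (Bq C) X \<in> Hom (Bq C) X X" by (rule arrow_homD)
next
  fix X Y Z f g assume "X \<in> Obj (Bq C)" "Y \<in> Obj (Bq C)" "Z \<in> Obj (Bq C)"
    "f \<in> Hom (Bq C) X Y" "g \<in> Hom (Bq C) Y Z"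
  then have f: "arrow (Bq C) f X Y" and g: "arrow (Bq C) g Y Z" by (simp_all add: arrow_def)
  note fd = arrow_BqD[OF f] and gd = arrow_BqD[OF g]
  note d = binary_objectsD(7,8)[OF fd(1)] binary_objectsD(7,8)[OF fd(2)] binary_objectsD(7,8)[OF gd(2)]
  have "arrow (Bq C) (g \<cdot>\<^bsub>Bq C\<^esub> f) X Z"
    using chain_map_comp[OF fd(5), OF gd(5), OF d(1,3,5)] chain_map_comp[OF fd(6), OF gd(6), OF d(2,4,6)]
    by (intro arrow_BqI[OF fd(1) gd(2)]) (simp_all add: Bq_range chain_map_def)
  then show "g \<cdot>\<^bsub>Bq C\<^esub> f \<in> Hom (Bq C) X Z" by (rule arrow_homD)
next
  fix W X Y Z f g h assume "W \<in> Obj (Bq C)" "X \<in> Obj (Bq C)" "Y \<in> Obj (Bq C)" "Z \<in> Obj (Bq C)"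
    "f \<in> Hom (Bq C) W X" "g \<in> Hom (Bq C) X Y" "h \<in> Hom (Bq C) Y Z"
  then have f: "arrow (Bq C) f W X" and g: "arrow (Bq C) g X Y" and h: "arrow (Bq C) h Y Z"
    by (simp_all add: arrow_def)
  show "(h \<cdot>\<^bsub>Bq C\<^esub> g) \<cdot>\<^bsub>Bq C\<^esub> f = h \<cdot>\<^bsub>Bq C\<^esub> (g \<cdot>\<^bsub>Bq C\<^esub> f)"
    by (rule graded_eqI)
      (simp_all add: Bq_range assoc[OF arrow_BqD(4)[OF f] arrow_BqD(4)[OF g] arrow_BqD(4)[OF h]])
next
  fix X Y f assume "X \<in> Obj (Bq C)" "Y \<in> Obj (Bq C)" "f \<in> Hom (Bq C) X Y"
  then have f: "arrow (Bq C) f X Y" by (simp add: arrow_def)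
  note fd = arrow_BqD(3,4)[OF f]
  show "Ident (Bq C) Y \<cdot>\<^bsub>Bq C\<^esub> f = f" "f \<cdot>\<^bsub>Bq C\<^esub> Ident (Bq C) X = f"
    by (rule graded_eqI[OF Bq_range(1) fd(1)], simp add: id_left[OF fd(2)] id_right[OF fd(2)])+
qed

lemma chain_map_minus:
  assumes f: "chain_map C X dX f Y dY" and d: "\<And>k. arrow C (dX k) (X k) (X (k - 1))" "\<And>k. arrow C (dY k) (Y k) (Y (k - 1))"
    and h: "\<And>k. arrow C (h k) (X k) (Y k)" "\<And>k. Plus C (f k) (h k) = Zero C (X k) (Y k)"
  shows "chain_map C X dX h Y dY"
  unfolding chain_map_def
proof (intro allI conjI h)
  fix k
  note fk = chain_mapD[OF f, of k] and f1 = chain_mapD(1)[OF f, of "k - 1"]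
  have o: "X k \<in> Obj C" "Y (k - 1) \<in> Obj C" using fk(1) f1 by (auto simp: arrow_def)
  have "Plus C (f (k - 1) \<cdot> dX k) (h (k - 1) \<cdot> dX k) = Zero C (X k) (Y (k - 1))"
    using comp_plus(1)[OF d(1)[of k] f1 h(1)] h(2)[of "k - 1"] zero_comp[OF d(1)[of k] o(2)] by simp
  moreover have "Plus C (f (k - 1) \<cdot> dX k) (dY k \<cdot> h k) = Zero C (X k) (Y (k - 1))"
    using comp_plus(2)[OF fk(1) h(1) d(2)[of k]] h(2)[of k] comp_zero[OF d(2)[of k] o(1)] fk(2) by simp
  ultimately show "h (k - 1) \<cdot> dX k = dY k \<cdot> h k"
    using plus_cancel[OF arrow_comp[OF d(1) f1] arrow_comp[OF d(1) h(1)] arrow_comp[OF h(1) d(2)]] by simp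
qed

lemma preadditive_Bq: "preadditive_category (Bq C)"
proof -
  interpret B: category "Bq C" by (rule category_Bq)
  have zero: "arrow (Bq C) (Zero (Bq C) X Y) X Y" if "X \<in> Obj (Bq C)" "Y \<in> Obj (Bq C)" for X Y
    using that binary_objectsD(6)[of X C] binary_objectsD(6)[of Y C] arrow_zero
      zero_comp[OF binary_objectsD(7)[of X C]] zero_comp[OF binary_objectsD(8)[of X C]]
      comp_zero[OF binary_objectsD(7)[of Y C]] comp_zero[OF binary_objectsD(8)[of Y C]]
    by (intro arrow_BqI) (simp_all add: Bq_range chain_map_def)
  have plus: "arrow (Bq C) (Plus (Bq C) f g) X Y" if "arrow (Bq C) f X Y" "arrow (Bq C) g X Y" for f g X Y
  proof (intro arrow_BqI)
    note f = arrow_BqD[OF that(1)] and g = arrow_BqD[OF that(2)]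
    note d = binary_objectsD(7,8)[OF f(1)] binary_objectsD(7,8)[OF f(2)]
    show "X \<in> binary_objects C" "Y \<in> binary_objects C" by fact+
    show "chain_map C (obj_at X) (diff X) (mor_at (Plus (Bq C) f g)) (obj_at Y) (diff Y)"
      "chain_map C (obj_at X) (diff' X) (mor_at (Plus (Bq C) f g)) (obj_at Y) (diff' Y)"
      unfolding chain_map_def
      using arrow_plus[OF f(4) g(4)] comp_plus(1)[OF d(1) f(4) g(4)] comp_plus(2)[OF f(4) g(4) d(3)]
        comp_plus(1)[OF d(2) f(4) g(4)] comp_plus(2)[OF f(4) g(4) d(4)] chain_mapD(2)[OF f(5)]
        chain_mapD(2)[OF g(5)] chain_mapD(2)[OF f(6)] chain_mapD(2)[OF g(6)] by simp_all
  qed (simp add: Bq_range)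
  show ?thesis
  proof (intro preadditive_category.intro category_Bq preadditive_category_axioms.intro)
    fix X Y assume XY: "X \<in> Obj (Bq C)" "Y \<in> Obj (Bq C)"
    show "comm_group (hom_group (Bq C) X Y)"
    proof (rule comm_groupI)
      let ?G = "hom_group (Bq C) X Y"
      have car: "f \<in> carrier ?G \<longleftrightarrow> arrow (Bq C) f X Y" for f using XY by (simp add: hom_group_def arrow_def)
      have ops: "f \<otimes>\<^bsub>?G\<^esub> g = Plus (Bq C) f g" "\<one>\<^bsub>?G\<^esub> = Zero (Bq C) X Y" for f g
        by (simp_all add: hom_group_def)
      show "\<one>\<^bsub>?G\<^esub> \<in> carrier ?G" using car ops zero XY by simp
      fix f assume "f \<in> carrier ?G"
      then have f: "arrow (Bq C) f X Y" using car by simp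
      note fd = arrow_BqD[OF f]
      note d = binary_objectsD(7,8)[OF fd(1)] binary_objectsD(7,8)[OF fd(2)]
      show "\<one>\<^bsub>?G\<^esub> \<otimes>\<^bsub>?G\<^esub> f = f" unfolding ops
        by (rule graded_eqI) (simp_all add: Bq_range fd(3) plus_zero[OF fd(4)])
      have "\<exists>h. arrow C h (obj_at X k) (obj_at Y k) \<and> Plus C (mor_at f k) h = Zero C (obj_at X k) (obj_at Y k)" for k
        using ex_minus[OF fd(4)[of k] arrow_zero[of "obj_at X k" "obj_at Y k"]] fd(4)[of k] unfolding arrow_def by metis
      then obtain h where h: "\<And>k. arrow C (h k) (obj_at X k) (obj_at Y k)"
          "\<And>k. Plus C (mor_at f k) (h k) = Zero C (obj_at X k) (obj_at Y k)" by metis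
      have "arrow (Bq C) (Graded_mor h) X Y"
        using chain_map_minus[OF fd(5), OF d(1,3) h] chain_map_minus[OF fd(6), OF d(2,4) h] fd(1,2)
        by (intro arrow_BqI) simp_all
      moreover have "Plus (Bq C) (Graded_mor h) f = Zero (Bq C) X Y"
        by (rule graded_eqI) (use plus_assoc_comm(2)[OF h(1) fd(4) h(1)] h(2) in \<open>simp_all add: Bq_range\<close>)
      ultimately show "\<exists>y\<in>carrier ?G. y \<otimes>\<^bsub>?G\<^esub> f = \<one>\<^bsub>?G\<^esub>" using car ops by auto
      fix g assume "g \<in> carrier ?G"
      then have g: "arrow (Bq C) g X Y" using car by simp
      note gd = arrow_BqD[OF g]
      show "f \<otimes>\<^bsub>?G\<^esub> g \<in> carrier ?G" using plus[OF f g] car ops by simp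
      show "f \<otimes>\<^bsub>?G\<^esub> g = g \<otimes>\<^bsub>?G\<^esub> f" unfolding ops
        by (rule graded_eqI) (simp_all add: Bq_range plus_assoc_comm(2)[OF fd(4) gd(4) gd(4)])
      fix h assume "h \<in> carrier ?G"
      then have h: "arrow (Bq C) h X Y" using car by simp
      show "f \<otimes>\<^bsub>?G\<^esub> g \<otimes>\<^bsub>?G\<^esub> h = f \<otimes>\<^bsub>?G\<^esub> (g \<otimes>\<^bsub>?G\<^esub> h)" unfolding ops
        by (rule graded_eqI) (simp_all add: Bq_range plus_assoc_comm(1)[OF fd(4) gd(4) arrow_BqD(4)[OF h]])
    qed
  next
    fix X Y Z f g g' assume "X \<in> Obj (Bq C)" "Y \<in> Obj (Bq C)" "Z \<in> Obj (Bq C)"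
      "f \<in> Hom (Bq C) X Y" "g \<in> Hom (Bq C) Y Z" "g' \<in> Hom (Bq C) Y Z"
    then have a: "arrow (Bq C) f X Y" "arrow (Bq C) g Y Z" "arrow (Bq C) g' Y Z" by (simp_all add: arrow_def)
    show "Plus (Bq C) g g' \<cdot>\<^bsub>Bq C\<^esub> f = Plus (Bq C) (g \<cdot>\<^bsub>Bq C\<^esub> f) (g' \<cdot>\<^bsub>Bq C\<^esub> f)"
      by (rule graded_eqI)
        (simp_all add: Bq_range comp_plus(1)[OF arrow_BqD(4)[OF a(1)] arrow_BqD(4)[OF a(2)] arrow_BqD(4)[OF a(3)]])
  next
    fix X Y Z f f' g assume "X \<in> Obj (Bq C)" "Y \<in> Obj (Bq C)" "Z \<in> Obj (Bq C)"
      "f \<in> Hom (Bq C) X Y" "f' \<in> Hom (Bq C) X Y" "g \<in> Hom (Bq C) Y Z"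
    then have a: "arrow (Bq C) f X Y" "arrow (Bq C) f' X Y" "arrow (Bq C) g Y Z" by (simp_all add: arrow_def)
    show "g \<cdot>\<^bsub>Bq C\<^esub> Plus (Bq C) f f' = Plus (Bq C) (g \<cdot>\<^bsub>Bq C\<^esub> f) (g \<cdot>\<^bsub>Bq C\<^esub> f')"
      by (rule graded_eqI)
        (simp_all add: Bq_range comp_plus(2)[OF arrow_BqD(4)[OF a(1)] arrow_BqD(4)[OF a(2)] arrow_BqD(4)[OF a(3)]])
  qed
qed

lemma zero_object_Bq:
  "zero_object (Bq C) X \<longleftrightarrow> X \<in> binary_objects C \<and> (\<forall>k. zero_object C (obj_at X k))"
proof -
  interpret B: preadditive_category "Bq C" by (rule preadditive_Bq)
  have "Ident (Bq C) X = Zero (Bq C) X X \<longleftrightarrow> (\<forall>k. Ident C (obj_at X k) = Zero C (obj_at X k) (obj_at X k))"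
    by (auto simp: Bq_def fun_eq_iff)
  then show ?thesis using B.zero_object_iff zero_object_iff binary_objectsD(6) by auto
qed

lemma acyclic_zero:
  assumes "zero_object C Z"
  shows "acyclic_complex C (\<lambda>_. Z) (\<lambda>_. Zero C Z Z)"
proof (rule acyclicI[where Z = "\<lambda>_. Z"])
  have o: "Z \<in> Obj C" using assms zero_object_obj by simp
  show "Ses C Z (Zero C Z Z) Z (Zero C Z Z) Z" for k :: int by (rule ses_zeros[OF assms assms assms])
  show "Zero C Z Z = Zero C Z Z \<cdot> Zero C Z Z" for k :: int using zero_comp[OF arrow_zero[OF o o] o] by simp
  show "bounded_graded C (\<lambda>_. Z)" using assms by (simp add: bounded_graded_def)
qed

lemma zero_binary:
  assumes "zero_object C Z"
  shows "zero_object (Bq C) (Binary (\<lambda>_. Z) (\<lambda>_. Zero C Z Z) (\<lambda>_. Zero C Z Z))"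
  using acyclic_zero[OF assms] assms by (simp add: zero_object_Bq binary_objects_def)

lemma biproduct_at:
  assumes "biproduct (Bq C) X Y S inX inY prX prY"
  shows "biproduct C (obj_at X k) (obj_at Y k) (obj_at S k) (mor_at inX k) (mor_at inY k) (mor_at prX k) (mor_at prY k)"
proof -
  note a = biproduct_arrows[OF assms]
  note ar = arrow_BqD(4)[OF a(1), of k] arrow_BqD(4)[OF a(2), of k] arrow_BqD(4)[OF a(3), of k] arrow_BqD(4)[OF a(4), of k]
  have s: "Plus (Bq C) (inX \<cdot>\<^bsub>Bq C\<^esub> prX) (inY \<cdot>\<^bsub>Bq C\<^esub> prY) = Ident (Bq C) S"
    using assms by (simp add: biproduct_def)
  show ?thesis unfolding biproduct_def
    using arg_cong[OF a(5), of "\<lambda>f. mor_at f k"] arg_cong[OF a(6), of "\<lambda>f. mor_at f k"]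
      arg_cong[OF a(7), of "\<lambda>f. mor_at f k"] arg_cong[OF a(8), of "\<lambda>f. mor_at f k"]
      arg_cong[OF s, of "\<lambda>f. mor_at f k"] ar by (auto simp: arrow_def)
qed

text \<open>The sum is acyclic as an extension of acyclic complexes. The final clause keeps sums of
  diagonal objects diagonal, so that the diagonal objects of a class can themselves serve as a
  covering class.\<close>

lemma biproduct_Bq:
  assumes X: "X \<in> binary_objects C" and Y: "Y \<in> binary_objects C"
    and b: "\<And>k. biproduct C (obj_at X k) (obj_at Y k) (S k) (inX k) (inY k) (prX k) (prY k)"
  shows "\<exists>d d'. biproduct (Bq C) X Y (Binary S d d') (Graded_mor inX) (Graded_mor inY) (Graded_mor prX) (Graded_mor prY) \<and>
    (diff X = diff' X \<and> diff Y = diff' Y \<longrightarrow> d = d')"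
proof -
  note x = binary_objectsD[OF X] and y = binary_objectsD[OF Y]
  obtain d where d: "chain_complex C S d" "chain_map C (obj_at X) (diff X) inX S d"
      "chain_map C (obj_at Y) (diff Y) inY S d" "chain_map C S d prX (obj_at X) (diff X)"
      "chain_map C S d prY (obj_at Y) (diff Y)"
    using biproduct_complex[OF b x(4) y(4)] by blast
  \<comment> \<open>The differentials come from an existence statement; in the diagonal case the
    same witness is taken twice.\<close>
  obtain d' where d': "chain_complex C S d'" "chain_map C (obj_at X) (diff' X) inX S d'"
      "chain_map C (obj_at Y) (diff' Y) inY S d'" "chain_map C S d' prX (obj_at X) (diff' X)"
      "chain_map C S d' prY (obj_at Y) (diff' Y)" and eq: "diff X = diff' X \<and> diff Y = diff' Y \<longrightarrow> d = d'"
  proof (cases "diff X = diff' X \<and> diff Y = diff' Y")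
    case True then show ?thesis using that[of d] d by simp
  next
    case False then show ?thesis using that biproduct_complex[OF b x(5) y(5)] by blast
  qed
  have ac: "acyclic_complex C S d" "acyclic_complex C S d'"
    using acyclic_extension[OF d(1) x(2) y(2) ses_split[OF b] d(2,5)]
      acyclic_extension[OF d'(1) x(3) y(3) ses_split[OF b] d'(2,5)] by blast+
  then have S: "Binary S d d' \<in> binary_objects C" by (simp add: binary_objects_def)
  have ar: "arrow (Bq C) (Graded_mor inX) X (Binary S d d')" "arrow (Bq C) (Graded_mor inY) Y (Binary S d d')"
    "arrow (Bq C) (Graded_mor prX) (Binary S d d') X" "arrow (Bq C) (Graded_mor prY) (Binary S d d') Y"
    using d d' X Y S by (auto intro!: arrow_BqI)
  have "biproduct (Bq C) X Y (Binary S d d') (Graded_mor inX) (Graded_mor inY) (Graded_mor prX) (Graded_mor prY)"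
    unfolding biproduct_def
  proof (intro conjI)
    show "Graded_mor prX \<cdot>\<^bsub>Bq C\<^esub> Graded_mor inX = Ident (Bq C) X"
      "Graded_mor prY \<cdot>\<^bsub>Bq C\<^esub> Graded_mor inY = Ident (Bq C) Y"
      by (rule graded_eqI[OF Bq_range(1,2)], simp add: b[unfolded biproduct_def])+
    show "Graded_mor prY \<cdot>\<^bsub>Bq C\<^esub> Graded_mor inX = Zero (Bq C) X Y"
      "Graded_mor prX \<cdot>\<^bsub>Bq C\<^esub> Graded_mor inY = Zero (Bq C) Y X"
      by (rule graded_eqI[OF Bq_range(1,4)], simp add: b[unfolded biproduct_def])+
    show "Plus (Bq C) (Graded_mor inX \<cdot>\<^bsub>Bq C\<^esub> Graded_mor prX) (Graded_mor inY \<cdot>\<^bsub>Bq C\<^esub> Graded_mor prY)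
        = Ident (Bq C) (Binary S d d')"
      by (rule graded_eqI[OF Bq_range(3,2)], simp add: b[unfolded biproduct_def])
  qed (use ar in \<open>simp_all add: arrow_def\<close>)
  then show ?thesis using eq by blast
qed

lemma additive_Bq: "additive_category (Bq C)"
proof -
  interpret B: preadditive_category "Bq C" by (rule preadditive_Bq)
  show ?thesis
  proof unfold_locales
    show "\<exists>Z. zero_object (Bq C) Z" using zero_binary zero_object_exists by blast
    fix X Y assume XY: "X \<in> Obj (Bq C)" "Y \<in> Obj (Bq C)"
    have "\<exists>S inX inY prX prY. biproduct C (obj_at X k) (obj_at Y k) S inX inY prX prY" for k
      using biproduct_exists XY binary_objectsD(6)[of X C k] binary_objectsD(6)[of Y C k] by simp
    then obtain S inX inY prX prY where
      "\<And>k. biproduct C (obj_at X k) (obj_at Y k) (S k) (inX k) (inY k) (prX k) (prY k)" by metis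
    then show "\<exists>S inX inY prX prY. biproduct (Bq C) X Y S inX inY prX prY"
      using biproduct_Bq XY by simp blast
  qed
qed

text \<open>The map \<open>j\<close> is monic in each degree, so commutation of the factorization
  with the differentials can be tested after composing with \<open>j\<close>.\<close>

lemma arrow_Bq_factor:
  assumes j: "arrow (Bq C) j R Q" and t: "arrow (Bq C) t S Q"
    and ker: "\<And>k. is_kernel C (obj_at R k) (mor_at j k) (obj_at Q k) (g k) (X k)"
    and h: "\<And>k. arrow C (h k) (obj_at S k) (obj_at R k)" "\<And>k. mor_at j k \<cdot> h k = mor_at t k"
  shows "arrow (Bq C) (Graded_mor h) S R" "j \<cdot>\<^bsub>Bq C\<^esub> Graded_mor h = t"
proof -
  have m: "a = b" if "arrow C a T (obj_at R k)" "arrow C b T (obj_at R k)" "mor_at j k \<cdot> a = mor_at j k \<cdot> b" for k T a b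
    by (rule kernel_mono[OF ker that])
  note jd = arrow_BqD[OF j] and td = arrow_BqD[OF t]
  note R = binary_objectsD(7,8)[OF jd(1)] and Q = binary_objectsD(7,8)[OF jd(2)] and S = binary_objectsD(7,8)[OF td(1)]
  have "chain_map C (obj_at S) (diff S) h (obj_at R) (diff R)"
    by (rule chain_map_factor[where j = "mor_at j" and R = "obj_at R" and Q = "obj_at Q" and dQ = "diff Q"])
      (use m jd(5) td(5) h R(1) S(1) Q(1) in simp_all)
  moreover have "chain_map C (obj_at S) (diff' S) h (obj_at R) (diff' R)"
    by (rule chain_map_factor[where j = "mor_at j" and R = "obj_at R" and Q = "obj_at Q" and dQ = "diff' Q"])
      (use m jd(6) td(6) h R(2) S(2) Q(2) in simp_all)
  ultimately show "arrow (Bq C) (Graded_mor h) S R" using jd td by (intro arrow_BqI) simp_all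
  show "j \<cdot>\<^bsub>Bq C\<^esub> Graded_mor h = t" by (rule graded_eqI[OF Bq_range(1) td(3)]) (simp add: h(2))
qed

lemma ses_category_Bq: "ses_category (Bq C)"
proof -
  interpret B: additive_category "Bq C" by (rule additive_Bq)
  show ?thesis
  proof unfold_locales
    fix A i B p D assume S: "Ses (Bq C) A i B p D"
    then have i: "arrow (Bq C) i A B" and p: "arrow (Bq C) p B D"
      and Sk: "\<And>k. Ses C (obj_at A k) (mor_at i k) (obj_at B k) (mor_at p k) (obj_at D k)" by (simp_all add: Ses_Bq)
    show "is_kernel (Bq C) A i B p D"
    proof (rule kernelI[OF i p])
      show "p \<cdot>\<^bsub>Bq C\<^esub> i = Zero (Bq C) A D"
        by (rule graded_eqI) (simp_all add: Bq_range ses_arrows(3)[OF Sk])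
      fix T t assume t: "arrow (Bq C) t T B" "p \<cdot>\<^bsub>Bq C\<^esub> t = Zero (Bq C) T D"
      have "\<exists>u. arrow C u (obj_at T k) (obj_at A k) \<and> mor_at i k \<cdot> u = mor_at t k" for k
        using ses_lift[OF Sk[of k] arrow_BqD(4)[OF t(1), of k]] arg_cong[OF t(2), of "\<lambda>f. mor_at f k"]
        unfolding Bq_simps by metis
      then obtain u where u: "\<And>k. arrow C (u k) (obj_at T k) (obj_at A k)" "\<And>k. mor_at i k \<cdot> u k = mor_at t k"
        by metis
      show "\<exists>u. arrow (Bq C) u T A \<and> i \<cdot>\<^bsub>Bq C\<^esub> u = t"
        using arrow_Bq_factor[OF i t(1) ses_kernel[OF Sk] u] by blast
    next
      fix T u v assume u: "arrow (Bq C) u T A" "arrow (Bq C) v T A" "i \<cdot>\<^bsub>Bq C\<^esub> u = i \<cdot>\<^bsub>Bq C\<^esub> v"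
      show "u = v"
        using ses_mono[OF Sk arrow_BqD(4)[OF u(1)] arrow_BqD(4)[OF u(2)]] u(3) arrow_Bq_eqI[OF u(1,2)]
        by (metis Bq_simps(3))
    qed
  next
    fix A i B p D A' B' D' i' p' a b d
    assume S: "Ses (Bq C) A i B p D" "A' \<in> Obj (Bq C)" "B' \<in> Obj (Bq C)" "D' \<in> Obj (Bq C)"
      "i' \<in> Hom (Bq C) A' B'" "p' \<in> Hom (Bq C) B' D'"
      "iso_mor (Bq C) A a A'" "iso_mor (Bq C) B b B'" "iso_mor (Bq C) D d D'"
      "b \<cdot>\<^bsub>Bq C\<^esub> i = i' \<cdot>\<^bsub>Bq C\<^esub> a" "d \<cdot>\<^bsub>Bq C\<^esub> p = p' \<cdot>\<^bsub>Bq C\<^esub> b"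
    have ip: "arrow (Bq C) i' A' B'" "arrow (Bq C) p' B' D'" using S by (simp_all add: arrow_def)
    have iso: "iso_mor C (obj_at X k) (mor_at f k) (obj_at Y k)" if im: "iso_mor (Bq C) X f Y" "X \<in> binary_objects C"
      "Y \<in> binary_objects C" for X f Y k
    proof -
      obtain g where g: "arrow (Bq C) f X Y" "arrow (Bq C) g Y X" "g \<cdot>\<^bsub>Bq C\<^esub> f = Ident (Bq C) X" "f \<cdot>\<^bsub>Bq C\<^esub> g = Ident (Bq C) Y"
        using im unfolding iso_mor_def arrow_def Bq_simps by blast
      show ?thesis
        using iso_morI[OF arrow_BqD(4)[OF g(1)] arrow_BqD(4)[OF g(2)]] arg_cong[OF g(3), of "\<lambda>f. mor_at f k"]
          arg_cong[OF g(4), of "\<lambda>f. mor_at f k"] by simp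
    qed
    have AB: "A \<in> binary_objects C" "B \<in> binary_objects C" "D \<in> binary_objects C"
      using S(1) arrow_BqD(1,2) unfolding Ses_Bq by blast+
    have "Ses C (obj_at A' k) (mor_at i' k) (obj_at B' k) (mor_at p' k) (obj_at D' k)" for k
    proof (rule ses_iso[OF _ _ _ _ _ _ iso[OF S(7)] iso[OF S(8)] iso[OF S(9)]])
      show "Ses C (obj_at A k) (mor_at i k) (obj_at B k) (mor_at p k) (obj_at D k)" using S(1) by (simp add: Ses_Bq)
      show "mor_at b k \<cdot> mor_at i k = mor_at i' k \<cdot> mor_at a k" "mor_at d k \<cdot> mor_at p k = mor_at p' k \<cdot> mor_at b k"
        using arg_cong[OF S(10), of "\<lambda>f. mor_at f k"] arg_cong[OF S(11), of "\<lambda>f. mor_at f k"] by simp_all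
    qed (use AB S(2-4) arrow_BqD(4)[OF ip(1), of k] arrow_BqD(4)[OF ip(2), of k] in \<open>auto simp: arrow_def\<close>)
    then show "Ses (Bq C) A' i' B' p' D'" using ip by (simp add: Ses_Bq)
  qed
qed

end

section \<open>Kernels and pullbacks of complexes that are again acyclic\<close>

context deflation_exact
begin

text \<open>As a kernel, \<open>R\<close> receives a differential but not acyclicity. The latter
  comes from the second sequence \<open>K -> R -> X'\<close>, an extension of acyclic complexes;
  this is one reason why \<open>ses_comp\<close> records that sequence.\<close>

lemma ses_comp_complex:
  assumes R: "\<And>n. Ses C (R n) (j n) (Q n) (p n \<cdot> q n) (X'' n)"
    and H: "\<And>n. Ses C (K n) (h n) (R n) (g n) (X' n)"
    and P: "\<And>n. Ses C (X' n) (i n) (X n) (p n) (X'' n)"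
    and e: "\<And>n. j n \<cdot> h n = k n" "\<And>n. i n \<cdot> g n = q n \<cdot> j n"
    and c: "acyclic_complex C K dK" "acyclic_complex C X' dX'" "chain_complex C Q dQ" "chain_complex C X dX"
      "chain_complex C X'' dX''"
    and m: "chain_map C K dK k Q dQ" "chain_map C Q dQ q X dX" "chain_map C X' dX' i X dX" "chain_map C X dX p X'' dX''"
  shows "\<exists>dR. acyclic_complex C R dR \<and> chain_map C R dR j Q dQ \<and> chain_map C K dK h R dR \<and> chain_map C R dR g X' dX'"
proof -
  note d = chain_complexD(1)[OF acyclicD(1)[OF c(1)]] chain_complexD(1)[OF acyclicD(1)[OF c(2)]]
    chain_complexD(1)[OF c(3)] chain_complexD(1)[OF c(4)] chain_complexD(1)[OF c(5)]
  have pq: "chain_map C Q dQ (\<lambda>n. p n \<cdot> q n) X'' dX''" by (rule chain_map_comp[OF m(2), OF m(4), OF d(3), OF d(4), OF d(5)])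
  obtain dR where dR: "chain_complex C R dR" "chain_map C R dR j Q dQ"
    using kernel_complex[OF ses_kernel[OF R], OF c(3), OF c(5), OF pq] by blast
  note r = chain_complexD(1)[OF dR(1)]
  have h: "chain_map C K dK h R dR"
  proof (rule chain_map_factor[where j = j and Q = Q and dQ = dQ])
    show "a = b" if "arrow C a T (R n)" "arrow C b T (R n)" "j n \<cdot> a = j n \<cdot> b" for n T a b
      by (rule ses_mono[OF R that])
  qed (use dR m e(1) d r ses_arrows(1)[OF H] in simp_all)
  have "chain_map C R dR (\<lambda>n. q n \<cdot> j n) X dX" by (rule chain_map_comp[OF dR(2), OF m(2), OF r, OF d(3), OF d(4)])
  then have ig: "chain_map C R dR (\<lambda>n. i n \<cdot> g n) X dX" using e(2) by simp
  have g: "chain_map C R dR g X' dX'"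
  proof (rule chain_map_factor[where j = i and Q = X and dQ = dX])
    show "a = b" if "arrow C a T (X' n)" "arrow C b T (X' n)" "i n \<cdot> a = i n \<cdot> b" for n T a b
      by (rule ses_mono[OF P that])
  qed (use m ig d r ses_arrows(2)[OF H] in simp_all)
  show ?thesis using acyclic_extension[OF dR(1), OF c(1), OF c(2), OF H, OF h, OF g] dR(2) h g by blast
qed

text \<open>The pullback is acyclic as an extension of \<open>E\<close> by \<open>K\<close>. The
  maps \<open>k'\<close> and \<open>l'\<close> are chain maps because both their components are: one
  component is \<open>k\<close> or \<open>l\<close>, the other is zero.\<close>

lemma ses_pullback_complex:
  assumes pb: "\<And>n. is_pullback C (D n) (f' n) (p' n) (B n) (E n) (p n) (f n) (A n)"
    and K: "\<And>n. Ses C (K n) (k' n) (D n) (p' n) (E n)" and L: "\<And>n. Ses C (L n) (l' n) (D n) (f' n) (B n)"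
    and e: "\<And>n. f' n \<cdot> k' n = k n" "\<And>n. p' n \<cdot> l' n = l n"
    and c: "acyclic_complex C K dK" "acyclic_complex C L dL" "chain_complex C B dB" "acyclic_complex C E dE"
      "chain_complex C A dA"
    and m: "chain_map C K dK k B dB" "chain_map C L dL l E dE" "chain_map C B dB p A dA" "chain_map C E dE f A dA"
  shows "\<exists>dD. acyclic_complex C D dD \<and> chain_map C D dD f' B dB \<and> chain_map C D dD p' E dE \<and>
    chain_map C K dK k' D dD \<and> chain_map C L dL l' D dD"
proof -
  note d = chain_complexD(1)[OF acyclicD(1)[OF c(1)]] chain_complexD(1)[OF acyclicD(1)[OF c(2)]]
    chain_complexD(1)[OF c(3)] chain_complexD(1)[OF acyclicD(1)[OF c(4)]] chain_complexD(1)[OF c(5)]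
  obtain dD where dD: "chain_complex C D dD" "chain_map C D dD f' B dB" "chain_map C D dD p' E dE"
    using pullback_complex[OF pb, OF c(3), OF acyclicD(1)[OF c(4)], OF c(5), OF m(3), OF m(4)] by blast
  note r = chain_complexD(1)[OF dD(1)]
  have zero: "chain_map C S dS (\<lambda>n. Zero C (S n) (T n)) T dT"
    if "chain_complex C S dS" "chain_complex C T dT" for S dS T dT
    using chain_complexD(2)[OF that(1)] chain_complexD(2)[OF that(2)] arrow_zero
      zero_comp[OF chain_complexD(1)[OF that(1)]] comp_zero[OF chain_complexD(1)[OF that(2)]]
    by (simp add: chain_map_def)
  note c' = acyclicD(1)[OF c(1)] acyclicD(1)[OF c(2)] acyclicD(1)[OF c(4)]
  have k': "chain_map C K dK k' D dD"
    by (rule chain_map_pullback[OF pb, OF dD(2), OF dD(3)])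
      (use m e(1) ses_arrows(3)[OF K] zero[OF c'(1,3)] d r ses_arrows(1)[OF K] in simp_all)
  have l': "chain_map C L dL l' D dD"
    by (rule chain_map_pullback[OF pb, OF dD(2), OF dD(3)])
      (use m e(2) ses_arrows(3)[OF L] zero[OF c'(2) c(3)] d r ses_arrows(1)[OF L] in simp_all)
  show ?thesis using acyclic_extension[OF dD(1), OF c(1), OF c(4), OF K, OF k', OF dD(3)] dD k' l' by blast
qed

end

section \<open>The deflation-exact structure on binary complexes\<close>

context multi_deflation_exact
begin

text \<open>The graded object \<open>R\<close> and its maps are chosen once, before any
  differential; the two differentials of \<open>Q\<close> are then restricted to this same graded
  object.\<close>

lemma ses_comp_Bq:
  assumes S: "Ses (Bq C) K k Q q X" and P: "Ses (Bq C) X' i X p X''"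
  shows "\<exists>R j h g. Ses (Bq C) R j Q (p \<cdot>\<^bsub>Bq C\<^esub> q) X'' \<and> Ses (Bq C) K h R g X' \<and>
    j \<cdot>\<^bsub>Bq C\<^esub> h = k \<and> i \<cdot>\<^bsub>Bq C\<^esub> g = q \<cdot>\<^bsub>Bq C\<^esub> j"
proof -
  interpret B: category "Bq C" by (rule category_Bq)
  have ar: "arrow (Bq C) k K Q" "arrow (Bq C) q Q X" "arrow (Bq C) i X' X" "arrow (Bq C) p X X''"
    using S P by (simp_all add: Ses_Bq)
  have Sk: "Ses C (obj_at K n) (mor_at k n) (obj_at Q n) (mor_at q n) (obj_at X n)"
    and Pk: "Ses C (obj_at X' n) (mor_at i n) (obj_at X n) (mor_at p n) (obj_at X'' n)" for n
    using S P by (simp_all add: Ses_Bq)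
  from ses_comp[OF Sk Pk] obtain R j h g where
    R: "\<And>n. Ses C (R n) (j n) (obj_at Q n) (mor_at p n \<cdot> mor_at q n) (obj_at X'' n)"
      "\<And>n. Ses C (obj_at K n) (h n) (R n) (g n) (obj_at X' n)"
      "\<And>n. j n \<cdot> h n = mor_at k n" "\<And>n. mor_at i n \<cdot> g n = mor_at q n \<cdot> j n"
    by metis
  note a = arrow_BqD[OF ar(1)] and b = arrow_BqD[OF ar(2)] and c = arrow_BqD[OF ar(3)] and e = arrow_BqD[OF ar(4)]
  note bK = binary_objectsD[OF a(1)] and bX' = binary_objectsD[OF c(1)] and bQ = binary_objectsD[OF a(2)]
    and bX = binary_objectsD[OF b(2)] and bX'' = binary_objectsD[OF e(2)]
  obtain dR where dR: "acyclic_complex C R dR" "chain_map C R dR j (obj_at Q) (diff Q)"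
    "chain_map C (obj_at K) (diff K) h R dR" "chain_map C R dR g (obj_at X') (diff X')"
    using ses_comp_complex[OF R(1), OF R(2), OF Pk, OF R(3), OF R(4), OF bK(2), OF bX'(2), OF bQ(4), OF bX(4), OF bX''(4), OF a(5), OF b(5), OF c(5), OF e(5)] by blast
  obtain dR' where dR': "acyclic_complex C R dR'" "chain_map C R dR' j (obj_at Q) (diff' Q)"
    "chain_map C (obj_at K) (diff' K) h R dR'" "chain_map C R dR' g (obj_at X') (diff' X')"
    using ses_comp_complex[OF R(1), OF R(2), OF Pk, OF R(3), OF R(4), OF bK(3), OF bX'(3), OF bQ(5), OF bX(5), OF bX''(5), OF a(6), OF b(6), OF c(6), OF e(6)] by blast
  let ?R = "Binary R dR dR'"
  have "?R \<in> binary_objects C" using dR(1) dR'(1) by (simp add: binary_objects_def)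
  then have jhg: "arrow (Bq C) (Graded_mor j) ?R Q" "arrow (Bq C) (Graded_mor h) K ?R" "arrow (Bq C) (Graded_mor g) ?R X'"
    using dR dR' a c by (auto intro!: arrow_BqI)
  show ?thesis
  proof (intro exI conjI)
    show "Ses (Bq C) ?R (Graded_mor j) Q (p \<cdot>\<^bsub>Bq C\<^esub> q) X''"
      unfolding Ses_Bq using jhg(1) B.arrow_comp[OF ar(2,4)] R(1) by simp
    show "Ses (Bq C) K (Graded_mor h) ?R (Graded_mor g) X'" unfolding Ses_Bq using jhg R(2) by simp
    show "Graded_mor j \<cdot>\<^bsub>Bq C\<^esub> Graded_mor h = k" by (rule graded_eqI[OF Bq_range(1) a(3)]) (simp add: R(3))
    show "i \<cdot>\<^bsub>Bq C\<^esub> Graded_mor g = q \<cdot>\<^bsub>Bq C\<^esub> Graded_mor j"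
      by (rule graded_eqI[OF Bq_range(1) Bq_range(1)]) (simp add: R(4))
  qed
qed

lemma pullback_BqI:
  assumes ar: "arrow (Bq C) f' D B" "arrow (Bq C) p' D E" "arrow (Bq C) p B A" "arrow (Bq C) f E A"
    and pb: "\<And>n. is_pullback C (obj_at D n) (mor_at f' n) (mor_at p' n) (obj_at B n) (obj_at E n)
      (mor_at p n) (mor_at f n) (obj_at A n)"
  shows "is_pullback (Bq C) D f' p' B E p f A"
proof (rule pullbackI[OF ar])
  show "p \<cdot>\<^bsub>Bq C\<^esub> f' = f \<cdot>\<^bsub>Bq C\<^esub> p'"
    by (rule graded_eqI[OF Bq_range(1) Bq_range(1)]) (simp add: pullback_arrows(5)[OF pb])
  fix T s t assume st: "arrow (Bq C) s T B" "arrow (Bq C) t T E" "p \<cdot>\<^bsub>Bq C\<^esub> s = f \<cdot>\<^bsub>Bq C\<^esub> t"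
  have "\<exists>u. arrow C u (obj_at T n) (obj_at D n) \<and> mor_at f' n \<cdot> u = mor_at s n \<and> mor_at p' n \<cdot> u = mor_at t n" for n
    using pullback_lift[OF pb arrow_BqD(4)[OF st(1), of n] arrow_BqD(4)[OF st(2), of n]]
      arg_cong[OF st(3), of "\<lambda>f. mor_at f n"] unfolding Bq_simps by metis
  then obtain u where u: "\<And>n. arrow C (u n) (obj_at T n) (obj_at D n)" "\<And>n. mor_at f' n \<cdot> u n = mor_at s n"
    "\<And>n. mor_at p' n \<cdot> u n = mor_at t n" by metis
  note s = arrow_BqD[OF st(1)] and t = arrow_BqD[OF st(2)] and f' = arrow_BqD[OF ar(1)] and p' = arrow_BqD[OF ar(2)]
  note bT = binary_objectsD(7,8)[OF s(1)] and bD = binary_objectsD(7,8)[OF f'(1)] and bB = binary_objectsD(7,8)[OF f'(2)]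
    and bE = binary_objectsD(7,8)[OF p'(2)]
  have "chain_map C (obj_at T) (diff T) u (obj_at D) (diff D)"
    by (rule chain_map_pullback[OF pb, OF f'(5), OF p'(5)]) (use s t u bD(1) bT(1) bB(1) bE(1) in simp_all)
  moreover have "chain_map C (obj_at T) (diff' T) u (obj_at D) (diff' D)"
    by (rule chain_map_pullback[OF pb, OF f'(6), OF p'(6)]) (use s t u bD(2) bT(2) bB(2) bE(2) in simp_all)
  ultimately have "arrow (Bq C) (Graded_mor u) T D" using s f' by (intro arrow_BqI) simp_all
  moreover have "f' \<cdot>\<^bsub>Bq C\<^esub> Graded_mor u = s" by (rule graded_eqI[OF Bq_range(1) s(3)]) (simp add: u)
  moreover have "p' \<cdot>\<^bsub>Bq C\<^esub> Graded_mor u = t" by (rule graded_eqI[OF Bq_range(1) t(3)]) (simp add: u)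
  ultimately show "\<exists>u. arrow (Bq C) u T D \<and> f' \<cdot>\<^bsub>Bq C\<^esub> u = s \<and> p' \<cdot>\<^bsub>Bq C\<^esub> u = t" by blast
next
  fix T u v assume uv: "arrow (Bq C) u T D" "arrow (Bq C) v T D"
    and e: "f' \<cdot>\<^bsub>Bq C\<^esub> u = f' \<cdot>\<^bsub>Bq C\<^esub> v" "p' \<cdot>\<^bsub>Bq C\<^esub> u = p' \<cdot>\<^bsub>Bq C\<^esub> v"
  show "u = v"
  proof (rule arrow_Bq_eqI[OF uv])
    fix n show "mor_at u n = mor_at v n"
      using pullback_eq[OF pb arrow_BqD(4)[OF uv(1), of n] arrow_BqD(4)[OF uv(2), of n]]
        arg_cong[OF e(1), of "\<lambda>f. mor_at f n"] arg_cong[OF e(2), of "\<lambda>f. mor_at f n"] by simp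
  qed
qed

lemma ses_pullback_Bq:
  assumes S: "Ses (Bq C) K k B p A" and P: "Ses (Bq C) L l E f A"
  shows "\<exists>D f' p' k' l'. is_pullback (Bq C) D f' p' B E p f A \<and> Ses (Bq C) K k' D p' E \<and>
    Ses (Bq C) L l' D f' B \<and> f' \<cdot>\<^bsub>Bq C\<^esub> k' = k \<and> p' \<cdot>\<^bsub>Bq C\<^esub> l' = l"
proof -
  have ar: "arrow (Bq C) k K B" "arrow (Bq C) p B A" "arrow (Bq C) l L E" "arrow (Bq C) f E A"
    using S P by (simp_all add: Ses_Bq)
  have Sk: "Ses C (obj_at K n) (mor_at k n) (obj_at B n) (mor_at p n) (obj_at A n)"
    and Pk: "Ses C (obj_at L n) (mor_at l n) (obj_at E n) (mor_at f n) (obj_at A n)" for n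
    using S P by (simp_all add: Ses_Bq)
  from ses_pullback[OF Sk Pk] obtain D f' p' k' l' where
    R: "\<And>n. is_pullback C (D n) (f' n) (p' n) (obj_at B n) (obj_at E n) (mor_at p n) (mor_at f n) (obj_at A n)"
      "\<And>n. Ses C (obj_at K n) (k' n) (D n) (p' n) (obj_at E n)"
      "\<And>n. Ses C (obj_at L n) (l' n) (D n) (f' n) (obj_at B n)"
      "\<And>n. f' n \<cdot> k' n = mor_at k n" "\<And>n. p' n \<cdot> l' n = mor_at l n"
    by metis
  note a = arrow_BqD[OF ar(1)] and b = arrow_BqD[OF ar(2)] and c = arrow_BqD[OF ar(3)] and e = arrow_BqD[OF ar(4)]
  note bK = binary_objectsD[OF a(1)] and bB = binary_objectsD[OF a(2)] and bL = binary_objectsD[OF c(1)]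
    and bE = binary_objectsD[OF c(2)] and bA = binary_objectsD[OF b(2)]
  obtain d where d: "acyclic_complex C D d" "chain_map C D d f' (obj_at B) (diff B)" "chain_map C D d p' (obj_at E) (diff E)"
    "chain_map C (obj_at K) (diff K) k' D d" "chain_map C (obj_at L) (diff L) l' D d"
    using ses_pullback_complex[OF R(1), OF R(2), OF R(3), OF R(4), OF R(5), OF bK(2), OF bL(2), OF bB(4), OF bE(2), OF bA(4), OF a(5), OF c(5), OF b(5), OF e(5)] by blast
  obtain d' where d': "acyclic_complex C D d'" "chain_map C D d' f' (obj_at B) (diff' B)" "chain_map C D d' p' (obj_at E) (diff' E)"
    "chain_map C (obj_at K) (diff' K) k' D d'" "chain_map C (obj_at L) (diff' L) l' D d'"
    using ses_pullback_complex[OF R(1), OF R(2), OF R(3), OF R(4), OF R(5), OF bK(3), OF bL(3), OF bB(5), OF bE(3), OF bA(5), OF a(6), OF c(6), OF b(6), OF e(6)] by blast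
  let ?D = "Binary D d d'"
  have "?D \<in> binary_objects C" using d(1) d'(1) by (simp add: binary_objects_def)
  then have A: "arrow (Bq C) (Graded_mor f') ?D B" "arrow (Bq C) (Graded_mor p') ?D E"
      "arrow (Bq C) (Graded_mor k') K ?D" "arrow (Bq C) (Graded_mor l') L ?D"
    using d d' a c by (auto intro!: arrow_BqI)
  show ?thesis
  proof (intro exI conjI)
    show "is_pullback (Bq C) ?D (Graded_mor f') (Graded_mor p') B E p f A"
      by (rule pullback_BqI[OF A(1,2) ar(2,4)]) (simp add: R(1))
    show "Ses (Bq C) K (Graded_mor k') ?D (Graded_mor p') E" "Ses (Bq C) L (Graded_mor l') ?D (Graded_mor f') B"
      unfolding Ses_Bq using A R(2,3) by simp_all
    show "Graded_mor f' \<cdot>\<^bsub>Bq C\<^esub> Graded_mor k' = k" by (rule graded_eqI[OF Bq_range(1) a(3)]) (simp add: R(4))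
    show "Graded_mor p' \<cdot>\<^bsub>Bq C\<^esub> Graded_mor l' = l" by (rule graded_eqI[OF Bq_range(1) c(3)]) (simp add: R(5))
  qed
qed

text \<open>\<open>ses_split\<close> and \<open>ses_push\<close> introduce no new object and hold
  degreewise. \<open>ses_comp\<close> and \<open>ses_pullback\<close> introduce one object each, and
  its acyclicity is the content of the preceding lemmas.\<close>

theorem deflation_exact_Bq: "deflation_exact (Bq C)"
proof -
  interpret B: ses_category "Bq C" by (rule ses_category_Bq)
  show ?thesis
  proof unfold_locales
    fix A i B p D g h T
    assume S: "Ses (Bq C) A i B p D" and gh: "arrow (Bq C) g D T" "arrow (Bq C) h D T" "g \<cdot>\<^bsub>Bq C\<^esub> p = h \<cdot>\<^bsub>Bq C\<^esub> p"
    show "g = h"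
    proof (rule arrow_Bq_eqI[OF gh(1,2)])
      fix n
      have "Ses C (obj_at A n) (mor_at i n) (obj_at B n) (mor_at p n) (obj_at D n)" using S by (simp add: Ses_Bq)
      then show "mor_at g n = mor_at h n"
        using ses_epi[OF _ arrow_BqD(4)[OF gh(1), of n] arrow_BqD(4)[OF gh(2), of n]]
          arg_cong[OF gh(3), of "\<lambda>f. mor_at f n"] by simp
    qed
  next
    fix X Y S inX inY prX prY assume b: "biproduct (Bq C) X Y S inX inY prX prY"
    show "Ses (Bq C) X inX S prY Y"
      unfolding Ses_Bq using biproduct_arrows[OF b] ses_split[OF biproduct_at[OF b]] by blast
  next
    fix K k A' a B' i A p A'' j D q f
    assume s: "Ses (Bq C) K k A' a B'" "Ses (Bq C) A' i A p A''" "Ses (Bq C) B' j D q A''" "arrow (Bq C) f A D"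
      "f \<cdot>\<^bsub>Bq C\<^esub> i = j \<cdot>\<^bsub>Bq C\<^esub> a" "q \<cdot>\<^bsub>Bq C\<^esub> f = p"
    have "arrow (Bq C) (i \<cdot>\<^bsub>Bq C\<^esub> k) K A" using s(1,2) B.arrow_comp unfolding Ses_Bq by blast
    moreover have "Ses C (obj_at K n) (mor_at (i \<cdot>\<^bsub>Bq C\<^esub> k) n) (obj_at A n) (mor_at f n) (obj_at D n)" for n
      unfolding Bq_simps
      by (rule ses_push[of _ _ "obj_at A' n" "mor_at a n" "obj_at B' n" _ _ "mor_at p n" "obj_at A'' n" "mor_at j n" _ "mor_at q n"])
        (use s(1-3) arrow_BqD(4)[OF s(4)] arg_cong[OF s(5), of "\<lambda>f. mor_at f n"] arg_cong[OF s(6), of "\<lambda>f. mor_at f n"]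
          in \<open>simp_all add: Ses_Bq\<close>)
    ultimately show "Ses (Bq C) K (i \<cdot>\<^bsub>Bq C\<^esub> k) A f D" using s(4) by (simp add: Ses_Bq)
  qed (fact ses_comp_Bq, fact ses_pullback_Bq)
qed

end

section \<open>Multicomplexes of dimension zero\<close>

lemma base_cat_simps [simp]:
  "Obj (base_cat C) = Base_obj ` Obj C"
  "Hom (base_cat C) X Y = Base_mor ` Hom C (base_obj X) (base_obj Y)"
  "g \<cdot>\<^bsub>base_cat C\<^esub> f = Base_mor (base_mor g \<cdot>\<^bsub>C\<^esub> base_mor f)"
  "Ident (base_cat C) X = Base_mor (Ident C (base_obj X))"
  "Plus (base_cat C) f g = Base_mor (Plus C (base_mor f) (base_mor g))"
  "Zero (base_cat C) X Y = Base_mor (Zero C (base_obj X) (base_obj Y))"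
  by (simp_all add: base_cat_def)

lemma arrow_base_cat:
  "arrow (base_cat C) f X Y \<longleftrightarrow> X \<in> range Base_obj \<and> Y \<in> range Base_obj \<and> f \<in> range Base_mor \<and>
     arrow C (base_mor f) (base_obj X) (base_obj Y)"
  by (auto simp: arrow_def)

lemma Ses_base_cat:
  "Ses (base_cat C) A i B p D \<longleftrightarrow>
     A \<in> Base_obj ` Obj C \<and> B \<in> Base_obj ` Obj C \<and> D \<in> Base_obj ` Obj C \<and>
     i \<in> range Base_mor \<and> p \<in> range Base_mor \<and>
     Ses C (base_obj A) (base_mor i) (base_obj B) (base_mor p) (base_obj D)"
  by (simp add: base_cat_def)

lemma biproduct_base_cat:
  "biproduct (base_cat C) X Y S inX inY prX prY \<longleftrightarrow>
     X \<in> range Base_obj \<and> Y \<in> range Base_obj \<and> S \<in> range Base_obj \<and>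
     inX \<in> range Base_mor \<and> inY \<in> range Base_mor \<and> prX \<in> range Base_mor \<and> prY \<in> range Base_mor \<and>
     biproduct C (base_obj X) (base_obj Y) (base_obj S) (base_mor inX) (base_mor inY) (base_mor prX) (base_mor prY)"
  by (auto simp: biproduct_def)

context deflation_exact
begin

lemma preadditive_base_cat: "preadditive_category (base_cat C)"
proof (intro preadditive_category.intro category.intro preadditive_category_axioms.intro)
  fix X Y assume "X \<in> Obj (base_cat C)" "Y \<in> Obj (base_cat C)"
  then obtain X' Y' where XY: "X = Base_obj X'" "Y = Base_obj Y'" "X' \<in> Obj C" "Y' \<in> Obj C" by auto
  interpret G: comm_group "hom_group C X' Y'" using hom_comm_group XY by blast
  let ?G = "hom_group (base_cat C) X Y"
  have c: "carrier ?G = Base_mor ` carrier (hom_group C X' Y')" "\<one>\<^bsub>?G\<^esub> = Base_mor \<one>\<^bsub>hom_group C X' Y'\<^esub>"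
    "Base_mor x \<otimes>\<^bsub>?G\<^esub> Base_mor y = Base_mor (x \<otimes>\<^bsub>hom_group C X' Y'\<^esub> y)" for x y
    using XY by (simp_all add: hom_group_def)
  show "comm_group ?G"
  proof (rule comm_groupI)
    fix x assume "x \<in> carrier ?G"
    then obtain x' where x: "x = Base_mor x'" "x' \<in> carrier (hom_group C X' Y')" using c by auto
    show "\<exists>y\<in>carrier ?G. y \<otimes>\<^bsub>?G\<^esub> x = \<one>\<^bsub>?G\<^esub>"
      using x c G.inv_closed[OF x(2)] G.l_inv[OF x(2)] by (intro bexI[of _ "Base_mor (inv\<^bsub>hom_group C X' Y'\<^esub> x')"]) auto
  qed (auto simp: c G.m_assoc intro: G.m_comm)
qed (auto simp: ident_closed comp_assoc ident_left ident_right comp_plus_left comp_plus_right intro!: imageI intro: comp_closed)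

lemma zero_object_base_cat:
  "zero_object (base_cat C) Z \<longleftrightarrow> Z \<in> range Base_obj \<and> zero_object C (base_obj Z)"
proof -
  interpret B: preadditive_category "base_cat C" by (rule preadditive_base_cat)
  show ?thesis by (auto simp: B.zero_object_iff zero_object_iff)
qed

lemma additive_base_cat: "additive_category (base_cat C)"
proof (intro additive_category.intro preadditive_base_cat additive_category_axioms.intro)
  show "\<exists>Z. zero_object (base_cat C) Z"
    using zero_object_exists zero_object_base_cat by (metis multi_obj.sel(1) rangeI)
  fix X Y assume "X \<in> Obj (base_cat C)" "Y \<in> Obj (base_cat C)"
  then obtain X' Y' where XY: "X = Base_obj X'" "Y = Base_obj Y'" "X' \<in> Obj C" "Y' \<in> Obj C" by auto
  then obtain S inX inY prX prY where "biproduct C X' Y' S inX inY prX prY" using biproduct_exists by blast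
  then have "biproduct (base_cat C) X Y (Base_obj S) (Base_mor inX) (Base_mor inY) (Base_mor prX) (Base_mor prY)"
    using XY by (simp add: biproduct_base_cat)
  then show "\<exists>S inX inY prX prY. biproduct (base_cat C) X Y S inX inY prX prY" by blast
qed

lemma ses_base_catI: "Ses C A i B p D \<Longrightarrow> Ses (base_cat C) (Base_obj A) (Base_mor i) (Base_obj B) (Base_mor p) (Base_obj D)"
  using ses_objs[of A i B p D] by (simp add: Ses_base_cat)

lemma ses_base_catE:
  assumes "Ses (base_cat C) A i B p D"
  obtains A' i' B' p' D' where "A = Base_obj A'" "i = Base_mor i'" "B = Base_obj B'" "p = Base_mor p'"
    "D = Base_obj D'" "Ses C A' i' B' p' D'"
  using assms by (auto simp: Ses_base_cat)

lemma arrow_base_catE: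
  assumes "arrow (base_cat C) f X Y"
  obtains f' X' Y' where "f = Base_mor f'" "X = Base_obj X'" "Y = Base_obj Y'" "arrow C f' X' Y'"
  using assms by (auto simp: arrow_base_cat)

lemma kernel_base_catI:
  assumes k: "is_kernel C K k A f B"
  shows "is_kernel (base_cat C) (Base_obj K) (Base_mor k) (Base_obj A) (Base_mor f) (Base_obj B)"
proof (rule kernelI)
  fix T t assume t: "arrow (base_cat C) t T (Base_obj A)" "Base_mor f \<cdot>\<^bsub>base_cat C\<^esub> t = Zero (base_cat C) T (Base_obj B)"
  then obtain t' T' where t': "t = Base_mor t'" "T = Base_obj T'" "arrow C t' T' A" by (auto simp: arrow_base_cat)
  then obtain u where "arrow C u T' K" "k \<cdot> u = t'" using kernel_lift[OF k t'(3)] t(2) by auto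
  then show "\<exists>u. arrow (base_cat C) u T (Base_obj K) \<and> Base_mor k \<cdot>\<^bsub>base_cat C\<^esub> u = t"
    using t' by (intro exI[of _ "Base_mor u"]) (simp add: arrow_base_cat)
next
  fix T u v assume uv: "arrow (base_cat C) u T (Base_obj K)" "arrow (base_cat C) v T (Base_obj K)"
    "Base_mor k \<cdot>\<^bsub>base_cat C\<^esub> u = Base_mor k \<cdot>\<^bsub>base_cat C\<^esub> v"
  then show "u = v" using kernel_mono[OF k, of "base_mor u" "base_obj T" "base_mor v"] by (auto simp: arrow_base_cat)
qed (use kernel_arrows[OF k] kernel_zero[OF k] in \<open>simp_all add: arrow_base_cat\<close>)

lemma pullback_base_catI:
  assumes pb: "is_pullback C D f' p' B E p f A"
  shows "is_pullback (base_cat C) (Base_obj D) (Base_mor f') (Base_mor p') (Base_obj B) (Base_obj E)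
    (Base_mor p) (Base_mor f) (Base_obj A)"
proof (rule pullbackI)
  fix T s t assume st: "arrow (base_cat C) s T (Base_obj B)" "arrow (base_cat C) t T (Base_obj E)"
    "Base_mor p \<cdot>\<^bsub>base_cat C\<^esub> s = Base_mor f \<cdot>\<^bsub>base_cat C\<^esub> t"
  then obtain s' t' T' where s': "s = Base_mor s'" "t = Base_mor t'" "T = Base_obj T'" "arrow C s' T' B" "arrow C t' T' E"
    by (auto simp: arrow_base_cat)
  then obtain u where "arrow C u T' D" "f' \<cdot> u = s'" "p' \<cdot> u = t'" using pullback_lift[OF pb s'(4,5)] st(3) by auto
  then show "\<exists>u. arrow (base_cat C) u T (Base_obj D) \<and> Base_mor f' \<cdot>\<^bsub>base_cat C\<^esub> u = s \<and> Base_mor p' \<cdot>\<^bsub>base_cat C\<^esub> u = t"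
    using s' by (intro exI[of _ "Base_mor u"]) (simp add: arrow_base_cat)
next
  fix T u v assume uv: "arrow (base_cat C) u T (Base_obj D)" "arrow (base_cat C) v T (Base_obj D)"
    "Base_mor f' \<cdot>\<^bsub>base_cat C\<^esub> u = Base_mor f' \<cdot>\<^bsub>base_cat C\<^esub> v" "Base_mor p' \<cdot>\<^bsub>base_cat C\<^esub> u = Base_mor p' \<cdot>\<^bsub>base_cat C\<^esub> v"
  then show "u = v" using pullback_eq[OF pb, of "base_mor u" "base_obj T" "base_mor v"] by (auto simp: arrow_base_cat)
qed (use pullback_arrows[OF pb] in \<open>simp_all add: arrow_base_cat\<close>)

theorem deflation_exact_base_cat: "deflation_exact (base_cat C)"
proof (intro deflation_exact.intro ses_category.intro additive_base_cat ses_category_axioms.intro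
    deflation_exact_axioms.intro)
  fix A i B p D assume "Ses (base_cat C) A i B p D"
  then show "is_kernel (base_cat C) A i B p D"
    by (elim ses_base_catE) (simp add: kernel_base_catI ses_kernel)
next
  fix A i B p D A' B' D' i' p' a b d
  assume S: "Ses (base_cat C) A i B p D" "A' \<in> Obj (base_cat C)" "B' \<in> Obj (base_cat C)" "D' \<in> Obj (base_cat C)"
    "i' \<in> Hom (base_cat C) A' B'" "p' \<in> Hom (base_cat C) B' D'"
    "iso_mor (base_cat C) A a A'" "iso_mor (base_cat C) B b B'" "iso_mor (base_cat C) D d D'"
    "b \<cdot>\<^bsub>base_cat C\<^esub> i = i' \<cdot>\<^bsub>base_cat C\<^esub> a" "d \<cdot>\<^bsub>base_cat C\<^esub> p = p' \<cdot>\<^bsub>base_cat C\<^esub> b"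
  have iso: "iso_mor C (base_obj X) (base_mor f) (base_obj Y)" if "iso_mor (base_cat C) X f Y" for X f Y
    using that by (auto simp: iso_mor_def)
  show "Ses (base_cat C) A' i' B' p' D'"
    using ses_iso[OF _ _ _ _ _ _ iso[OF S(7)] iso[OF S(8)] iso[OF S(9)]] S(1-6,10,11) by (auto simp: Ses_base_cat)
next
  fix A i B p D g h T assume "Ses (base_cat C) A i B p D" "arrow (base_cat C) g D T" "arrow (base_cat C) h D T"
    "g \<cdot>\<^bsub>base_cat C\<^esub> p = h \<cdot>\<^bsub>base_cat C\<^esub> p"
  then show "g = h" using ses_epi by (elim ses_base_catE arrow_base_catE) auto
next
  fix X Y S inX inY prX prY assume b: "biproduct (base_cat C) X Y S inX inY prX prY"
  then have "Ses C (base_obj X) (base_mor inX) (base_obj S) (base_mor prY) (base_obj Y)"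
    using ses_split unfolding biproduct_base_cat by blast
  then show "Ses (base_cat C) X inX S prY Y"
    using b ses_objs by (auto simp: Ses_base_cat biproduct_base_cat)
next
  fix K k Q q X X' i p X''
  assume s: "Ses (base_cat C) K k Q q X" "Ses (base_cat C) X' i X p X''"
  from s(1) obtain K0 k0 Q0 q0 X0 where a: "K = Base_obj K0" "k = Base_mor k0" "Q = Base_obj Q0" "q = Base_mor q0"
    "X = Base_obj X0" "Ses C K0 k0 Q0 q0 X0" by (rule ses_base_catE)
  from s(2) obtain Y0 i0 p0 Z0 where b: "X' = Base_obj Y0" "i = Base_mor i0" "p = Base_mor p0"
    "X'' = Base_obj Z0" "Ses C Y0 i0 X0 p0 Z0" by (rule ses_base_catE) (use a(5) in simp)
  obtain R j h g where r: "Ses C R j Q0 (p0 \<cdot> q0) Z0" "Ses C K0 h R g Y0" "j \<cdot> h = k0" "i0 \<cdot> g = q0 \<cdot> j"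
    using ses_comp[OF a(6) b(5)] by blast
  show "\<exists>R j h g. Ses (base_cat C) R j Q (p \<cdot>\<^bsub>base_cat C\<^esub> q) X'' \<and> Ses (base_cat C) K h R g X' \<and>
      j \<cdot>\<^bsub>base_cat C\<^esub> h = k \<and> i \<cdot>\<^bsub>base_cat C\<^esub> g = q \<cdot>\<^bsub>base_cat C\<^esub> j"
    using ses_base_catI[OF r(1)] ses_base_catI[OF r(2)] r(3,4) a b
    by (intro exI[of _ "Base_obj R"] exI[of _ "Base_mor j"] exI[of _ "Base_mor h"] exI[of _ "Base_mor g"]) simp
next
  fix K k B p A L l E f
  assume s: "Ses (base_cat C) K k B p A" "Ses (base_cat C) L l E f A"
  from s(1) obtain K0 k0 B0 p0 A0 where a: "K = Base_obj K0" "k = Base_mor k0" "B = Base_obj B0" "p = Base_mor p0"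
    "A = Base_obj A0" "Ses C K0 k0 B0 p0 A0" by (rule ses_base_catE)
  from s(2) obtain L0 l0 E0 f0 where b: "L = Base_obj L0" "l = Base_mor l0" "E = Base_obj E0" "f = Base_mor f0"
    "Ses C L0 l0 E0 f0 A0" by (rule ses_base_catE) (use a(5) in simp)
  obtain D f' p' k' l' where r: "is_pullback C D f' p' B0 E0 p0 f0 A0" "Ses C K0 k' D p' E0" "Ses C L0 l' D f' B0"
    "f' \<cdot> k' = k0" "p' \<cdot> l' = l0" using ses_pullback[OF a(6) b(5)] by blast
  show "\<exists>D f' p' k' l'. is_pullback (base_cat C) D f' p' B E p f A \<and> Ses (base_cat C) K k' D p' E \<and>
      Ses (base_cat C) L l' D f' B \<and> f' \<cdot>\<^bsub>base_cat C\<^esub> k' = k \<and> p' \<cdot>\<^bsub>base_cat C\<^esub> l' = l"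
    using pullback_base_catI[OF r(1)] ses_base_catI[OF r(2)] ses_base_catI[OF r(3)] r(4,5) a b
    by (intro exI[of _ "Base_obj D"] exI[of _ "Base_mor f'"] exI[of _ "Base_mor p'"] exI[of _ "Base_mor k'"]
        exI[of _ "Base_mor l'"]) simp
next
  fix K k A' a B' i A p A'' j D q f
  assume s: "Ses (base_cat C) K k A' a B'" "Ses (base_cat C) A' i A p A''" "Ses (base_cat C) B' j D q A''"
    "arrow (base_cat C) f A D" "f \<cdot>\<^bsub>base_cat C\<^esub> i = j \<cdot>\<^bsub>base_cat C\<^esub> a" "q \<cdot>\<^bsub>base_cat C\<^esub> f = p"
  have "Ses C (base_obj K) (base_mor i \<cdot> base_mor k) (base_obj A) (base_mor f) (base_obj D)"
    by (rule ses_push[of _ _ "base_obj A'" "base_mor a" "base_obj B'" _ _ "base_mor p" "base_obj A''" "base_mor j" _ "base_mor q"])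
      (use s in \<open>auto simp: Ses_base_cat arrow_base_cat\<close>)
  then show "Ses (base_cat C) K (i \<cdot>\<^bsub>base_cat C\<^esub> k) A f D"
    using s by (auto simp: Ses_base_cat arrow_base_cat)
qed

end

lemma deflation_exact_multi_cat:
  assumes "deflation_exact C"
  shows "deflation_exact (multi_cat n C)"
proof (induction n)
  case 0
  interpret deflation_exact C by fact
  show ?case using deflation_exact_base_cat by (simp add: multi_cat_def)
next
  case (Suc n)
  then interpret multi_deflation_exact "multi_cat n C" by (rule multi_deflation_exact.intro)
  show ?case using deflation_exact_Bq by (simp add: multi_cat_def)
qed

section \<open>Covering binary complexes\<close>

text \<open>What a class needs for its members to be assembled into covering complexes. Sums are
  used rather than extensions because diagonal objects need not be closed under extensions: the two
  differentials of an extension may differ in the entry from the quotient to the subobject.\<close>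

definition biproduct_class :: "('o, 'm, 'z) additive_cat_scheme \<Rightarrow> 'o set \<Rightarrow> bool" where
  "biproduct_class C Q \<longleftrightarrow> Q \<subseteq> Obj C \<and> (\<exists>Z\<in>Q. zero_object C Z) \<and>
     (\<forall>X\<in>Q. \<forall>Y\<in>Q. \<exists>S\<in>Q. \<exists>inX inY prX prY. biproduct C X Y S inX inY prX prY)"

definition covered_by :: "('o, 'm) exact_cat \<Rightarrow> 'o set \<Rightarrow> 'o \<Rightarrow> bool" where
  "covered_by C Q X \<longleftrightarrow> (\<exists>R\<in>Q. \<exists>K k r. Ses C K k R r X)"

context deflation_exact
begin

lemma ses_comp_epi:
  "\<lbrakk>Ses C K k Q q X; Ses C X' i X p X''\<rbrakk> \<Longrightarrow> \<exists>R j. Ses C R j Q (p \<cdot> q) X''"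
  using ses_comp by blast

text \<open>For a single differential take \<open>\<phi> = (i v, r)\<close> on
  \<open>T = U \<oplus> R\<close>. Since \<open>p i = 0\<close>, the composite
  \<open>p \<phi>\<close> factors through the quotient \<open>R\<close>, and the induced map
  \<open>v' = p r\<close> to the next cycles is a composite of admissible epimorphisms.\<close>

lemma cover_step_diagonal:
  assumes bU: "biproduct C U R T inU inR prU prR"
    and N: "Ses C Z i N p Z1" and v: "arrow C v U Z" and r: "Ses C K k R r N"
  shows "\<exists>\<phi> v'. Ses C U inU T prR R \<and> arrow C \<phi> T N \<and> \<phi> \<cdot> inU = i \<cdot> v \<and> p \<cdot> \<phi> = v' \<cdot> prR \<and>
    (\<exists>L l. Ses C L l R v' Z1)"
proof -
  note a = biproduct_arrows[OF bU] and n = ses_arrows[OF N] and ra = ses_arrows[OF r]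
  note iv = arrow_comp[OF v n(1)] and pr = arrow_comp[OF ra(2) n(2)]
  have o: "U \<in> Obj C" "Z1 \<in> Obj C" using v n by (auto simp: arrow_def)
  obtain \<phi> where \<phi>: "arrow C \<phi> T N" "\<phi> \<cdot> inU = i \<cdot> v" "\<phi> \<cdot> inR = r"
    using biproduct_copair[OF bU iv ra(2)] by blast
  have "p \<cdot> \<phi> = (p \<cdot> r) \<cdot> prR"
  proof (rule biproduct_eq[OF bU arrow_comp[OF \<phi>(1) n(2)] arrow_comp[OF a(4) pr]])
    show "(p \<cdot> \<phi>) \<cdot> inU = ((p \<cdot> r) \<cdot> prR) \<cdot> inU"
      using assoc[OF a(1) \<phi>(1) n(2)] \<phi>(2) assoc[OF v n(1,2)] n(3) zero_comp[OF v o(2)]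
        assoc[OF a(1,4) pr] a(7) comp_zero[OF pr o(1)] by simp
    show "(p \<cdot> \<phi>) \<cdot> inR = ((p \<cdot> r) \<cdot> prR) \<cdot> inR"
      using assoc[OF a(2) \<phi>(1) n(2)] \<phi>(3) assoc[OF a(2,4) pr] a(6) id_right[OF pr] by simp
  qed
  then show ?thesis using ses_split[OF bU] \<phi> ses_comp_epi[OF r N] by blast
qed

text \<open>
  With \<open>U' = U \<oplus> R\<close> and \<open>T = U \<oplus> U' = U \<oplus> U \<oplus> R\<close>, the two copies of \<open>U\<close> in \<open>T\<close> serve as the cycles
  for the two differentials; \<open>\<sigma>\<close> interchanges them.
\<close>

lemma cover_step:
  assumes bU: "biproduct C U R U' inU inR prU prR" and bT: "biproduct C U U' T in1 in2 pr1 pr2"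
    and N: "Ses C Z i N p Z1" and N': "Ses C Z' i' N p' Z1'"
    and v: "arrow C v U Z" and w: "arrow C w U Z'" and r: "Ses C K k R r N"
  shows "\<exists>\<iota> \<pi> \<phi> v' w'. Ses C U in1 T pr2 U' \<and> Ses C U \<iota> T \<pi> U' \<and> arrow C \<phi> T N \<and>
    \<phi> \<cdot> in1 = i \<cdot> v \<and> p \<cdot> \<phi> = v' \<cdot> pr2 \<and> \<phi> \<cdot> \<iota> = i' \<cdot> w \<and> p' \<cdot> \<phi> = w' \<cdot> \<pi> \<and>
    (\<exists>L l. Ses C L l U' v' Z1) \<and> (\<exists>L l. Ses C L l U' w' Z1')"
proof -
  note u = biproduct_arrows[OF bU] and t = biproduct_arrows[OF bT] and n = ses_arrows[OF N]
    and n' = ses_arrows[OF N'] and ra = ses_arrows[OF r]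
  note iv = arrow_comp[OF v n(1)] and iw = arrow_comp[OF w n'(1)]
  have o: "U \<in> Obj C" "Z1 \<in> Obj C" "Z1' \<in> Obj C" "T \<in> Obj C" using v n n' t by (auto simp: arrow_def)
  \<comment> \<open>On \<open>T = U \<oplus> U \<oplus> R\<close> the map \<open>\<phi>\<close> will
    be \<open>(i v, i' w, r)\<close>; \<open>\<psi>\<close> is its restriction to the last two
    summands.\<close>
  obtain \<psi> where \<psi>: "arrow C \<psi> U' N" "\<psi> \<cdot> inU = i' \<cdot> w" "\<psi> \<cdot> inR = r"
    using biproduct_copair[OF bU iw ra(2)] by blast
  obtain \<phi> where \<phi>: "arrow C \<phi> T N" "\<phi> \<cdot> in1 = i \<cdot> v" "\<phi> \<cdot> in2 = \<psi>"
    using biproduct_copair[OF bT iv \<psi>(1)] by blast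
  note iU = arrow_comp[OF u(1) t(2)] and iR = arrow_comp[OF u(2) t(2)]
  obtain \<tau> where \<tau>: "arrow C \<tau> U' T" "\<tau> \<cdot> inU = in1" "\<tau> \<cdot> inR = in2 \<cdot> inR"
    using biproduct_copair[OF bU t(1) iR] by blast
  obtain \<sigma> where \<sigma>: "arrow C \<sigma> T T" "\<sigma> \<cdot> in1 = in2 \<cdot> inU" "\<sigma> \<cdot> in2 = \<tau>"
    using biproduct_copair[OF bT iU \<tau>(1)] by blast
  note idT = arrow_ident[OF o(4)] and \<sigma>\<sigma> = arrow_comp[OF \<sigma>(1) \<sigma>(1)]
  have s2U: "\<sigma> \<cdot> (in2 \<cdot> inU) = in1" and s2R: "\<sigma> \<cdot> (in2 \<cdot> inR) = in2 \<cdot> inR"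
    using assoc[OF u(1) t(2) \<sigma>(1)] assoc[OF u(2) t(2) \<sigma>(1)] \<sigma>(3) \<tau>(2,3) by simp_all
  have 1: "(\<sigma> \<cdot> \<sigma>) \<cdot> in2 = Ident C T \<cdot> in2"
  proof (rule biproduct_eq[OF bU arrow_comp[OF t(2) \<sigma>\<sigma>] arrow_comp[OF t(2) idT]])
    show "((\<sigma> \<cdot> \<sigma>) \<cdot> in2) \<cdot> inU = (Ident C T \<cdot> in2) \<cdot> inU"
      using assoc[OF u(1) t(2) \<sigma>\<sigma>] assoc[OF iU \<sigma>(1) \<sigma>(1)] s2U \<sigma>(2) id_left[OF t(2)] by simp
    show "((\<sigma> \<cdot> \<sigma>) \<cdot> in2) \<cdot> inR = (Ident C T \<cdot> in2) \<cdot> inR"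
      using assoc[OF u(2) t(2) \<sigma>\<sigma>] assoc[OF iR \<sigma>(1) \<sigma>(1)] s2R id_left[OF t(2)] by simp
  qed
  have "(\<sigma> \<cdot> \<sigma>) \<cdot> in1 = Ident C T \<cdot> in1"
    using assoc[OF t(1) \<sigma>(1) \<sigma>(1)] \<sigma>(2) s2U id_left[OF t(1)] by simp
  from biproduct_eq[OF bT \<sigma>\<sigma> idT this 1] have inv: "\<sigma> \<cdot> \<sigma> = Ident C T" .
  have S: "Ses C U in1 T pr2 U'" by (rule ses_split[OF bT])
  have S': "Ses C U (\<sigma> \<cdot> in1) T (pr2 \<cdot> \<sigma>) U'" by (rule ses_iso_mid[OF S \<sigma>(1) \<sigma>(1) inv inv])
  note p\<psi> = arrow_comp[OF \<psi>(1) n(2)] and p\<phi> = arrow_comp[OF \<phi>(1) n(2)] and p'\<phi> = arrow_comp[OF \<phi>(1) n'(2)]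
  note p'\<phi>\<sigma> = arrow_comp[OF \<sigma>(1) p'\<phi>]
  \<comment> \<open>\<open>p' \<phi>\<close> vanishes on the second copy of \<open>U\<close>, so
    after the swap it factors through \<open>pr2\<close>; \<open>w'\<close> is the induced map on
    that quotient.\<close>
  define w' where "w' = ((p' \<cdot> \<phi>) \<cdot> \<sigma>) \<cdot> in2"
  have w': "arrow C w' U' Z1'" unfolding w'_def by (rule arrow_comp[OF t(2) p'\<phi>\<sigma>])
  have c1: "p \<cdot> \<phi> = (p \<cdot> \<psi>) \<cdot> pr2"
  proof (rule biproduct_eq[OF bT p\<phi> arrow_comp[OF t(4) p\<psi>]])
    show "(p \<cdot> \<phi>) \<cdot> in1 = ((p \<cdot> \<psi>) \<cdot> pr2) \<cdot> in1"
      using assoc[OF t(1) \<phi>(1) n(2)] \<phi>(2) assoc[OF v n(1,2)] n(3) zero_comp[OF v o(2)]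
        assoc[OF t(1,4) p\<psi>] t(7) comp_zero[OF p\<psi> o(1)] by simp
    show "(p \<cdot> \<phi>) \<cdot> in2 = ((p \<cdot> \<psi>) \<cdot> pr2) \<cdot> in2"
      using assoc[OF t(2) \<phi>(1) n(2)] \<phi>(3) assoc[OF t(2,4) p\<psi>] t(6) id_right[OF p\<psi>] by simp
  qed
  have c2: "\<phi> \<cdot> (\<sigma> \<cdot> in1) = i' \<cdot> w"
    using \<sigma>(2) assoc[OF u(1) t(2) \<phi>(1)] \<phi>(3) \<psi>(2) by simp
  have "(p' \<cdot> \<phi>) \<cdot> \<sigma> = w' \<cdot> pr2"
  proof (rule biproduct_eq[OF bT p'\<phi>\<sigma> arrow_comp[OF t(4) w']])
    have "((p' \<cdot> \<phi>) \<cdot> \<sigma>) \<cdot> in1 = Zero C U Z1'"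
      using assoc[OF t(1) \<sigma>(1) p'\<phi>] assoc[OF arrow_comp[OF t(1) \<sigma>(1)] \<phi>(1) n'(2)] c2 assoc[OF w n'(1,2)] n'(3)
        zero_comp[OF w o(3)] by simp
    then show "((p' \<cdot> \<phi>) \<cdot> \<sigma>) \<cdot> in1 = (w' \<cdot> pr2) \<cdot> in1"
      using assoc[OF t(1,4) w'] t(7) comp_zero[OF w' o(1)] by simp
    show "((p' \<cdot> \<phi>) \<cdot> \<sigma>) \<cdot> in2 = (w' \<cdot> pr2) \<cdot> in2"
      using assoc[OF t(2,4) w'] t(6) id_right[OF w'] by (simp add: w'_def)
  qed
  then have "((p' \<cdot> \<phi>) \<cdot> \<sigma>) \<cdot> \<sigma> = w' \<cdot> (pr2 \<cdot> \<sigma>)" using assoc[OF \<sigma>(1) t(4) w'] by simp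
  then have c3: "p' \<cdot> \<phi> = w' \<cdot> (pr2 \<cdot> \<sigma>)" using assoc[OF \<sigma>(1) \<sigma>(1) p'\<phi>] inv id_right[OF p'\<phi>] by simp
  \<comment> \<open>On the summand \<open>R\<close> of \<open>U'\<close> the maps
    \<open>p \<psi>\<close> and \<open>w'\<close> are \<open>p r\<close> and \<open>p' r\<close>,
    both admissible epimorphisms; \<open>copair_deflation\<close> extends this property to all of
    \<open>U'\<close>.\<close>
  obtain R1 j1 where R1: "Ses C R1 j1 R (p \<cdot> r) Z1" using ses_comp_epi[OF r N] by blast
  obtain R2 j2 where R2: "Ses C R2 j2 R (p' \<cdot> r) Z1'" using ses_comp_epi[OF r N'] by blast
  have "(p \<cdot> \<psi>) \<cdot> inR = p \<cdot> r" using assoc[OF u(2) \<psi>(1) n(2)] \<psi>(3) by simp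
  then have e1: "\<exists>L l. Ses C L l U' (p \<cdot> \<psi>) Z1" by (rule copair_deflation[OF R1 biproduct_swap[OF bU] p\<psi>])
  have "w' \<cdot> inR = (p' \<cdot> \<phi>) \<cdot> (in2 \<cdot> inR)"
    unfolding w'_def using assoc[OF u(2) t(2) p'\<phi>\<sigma>] assoc[OF iR \<sigma>(1) p'\<phi>] s2R by simp
  also have "\<dots> = p' \<cdot> r" using assoc[OF iR \<phi>(1) n'(2)] assoc[OF u(2) t(2) \<phi>(1)] \<phi>(3) \<psi>(3) by simp
  finally have e2: "\<exists>L l. Ses C L l U' w' Z1'" by (rule copair_deflation[OF R2 biproduct_swap[OF bU] w'])
  show ?thesis using S S' \<phi>(1,2) c1 c2 c3 e1 e2 by blast
qed

text \<open>One degree of the cover. The cycle object \<open>V\<close>, and likewise the next one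
  \<open>V'\<close>, is shared by the two differentials; only its embeddings \<open>\<iota>\<close>,
  \<open>\<iota>'\<close> and its maps \<open>v\<close>, \<open>w\<close> to the cycles of the
  covered complex may differ. The flag \<open>diag\<close> makes the two exact sequences
  equal.\<close>

definition cover_step_data where
  "cover_step_data Q diag N i p i' p' V v w V' v' w' T \<iota> \<pi> \<iota>' \<pi>' \<phi> \<longleftrightarrow>
     T \<in> Q \<and> Ses C V \<iota> T \<pi> V' \<and> Ses C V \<iota>' T \<pi>' V' \<and> arrow C \<phi> T N \<and> \<phi> \<cdot> \<iota> = i \<cdot> v \<and> p \<cdot> \<phi> = v' \<cdot> \<pi> \<and>
     \<phi> \<cdot> \<iota>' = i' \<cdot> w \<and> p' \<cdot> \<phi> = w' \<cdot> \<pi>' \<and> (diag \<longrightarrow> \<iota> = \<iota>' \<and> \<pi> = \<pi>')"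

lemma cover_step_exists:
  assumes Q: "biproduct_class C Q" and V: "V \<in> Q" and cov: "covered_by C Q N"
    and N: "Ses C Z i N p Z1" and N': "Ses C Z' i' N p' Z1'" and v: "arrow C v V Z" and w: "arrow C w V Z'"
    and diag: "diag \<longrightarrow> Z' = Z \<and> i' = i \<and> p' = p \<and> Z1' = Z1 \<and> v = w"
  shows "\<exists>V' v' w' T \<iota> \<pi> \<iota>' \<pi>' \<phi>. cover_step_data Q diag N i p i' p' V v w V' v' w' T \<iota> \<pi> \<iota>' \<pi>' \<phi> \<and> V' \<in> Q \<and>
    (\<exists>L l. Ses C L l V' v' Z1) \<and> (\<exists>L l. Ses C L l V' w' Z1') \<and> (diag \<longrightarrow> v' = w')"
proof -
  obtain R K k r where R: "R \<in> Q" "Ses C K k R r N" using cov by (auto simp: covered_by_def)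
  obtain U' inU inR prU prR where U': "U' \<in> Q" "biproduct C V R U' inU inR prU prR"
    using Q V R(1) unfolding biproduct_class_def by blast
  show ?thesis
  proof (cases diag)
    \<comment> \<open>One copy of \<open>V\<close> serves both differentials when they coincide; the
      construction with two copies would make the embeddings different.\<close>
    case True
    with cover_step_diagonal[OF U'(2) N v R(2)] diag U'(1) R(1) show ?thesis
      unfolding cover_step_data_def by blast
  next
    case False
    obtain T in1 in2 pr1 pr2 where T: "T \<in> Q" "biproduct C V U' T in1 in2 pr1 pr2"
      using Q V U'(1) unfolding biproduct_class_def by blast
    from cover_step[OF U'(2) T(2) N N' v w R(2)] obtain \<iota> \<pi> \<phi> v' w' where
      "Ses C V in1 T pr2 U'" "Ses C V \<iota> T \<pi> U'" "arrow C \<phi> T N"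
      "\<phi> \<cdot> in1 = i \<cdot> v" "p \<cdot> \<phi> = v' \<cdot> pr2" "\<phi> \<cdot> \<iota> = i' \<cdot> w" "p' \<cdot> \<phi> = w' \<cdot> \<pi>"
      "\<exists>L l. Ses C L l U' v' Z1" "\<exists>L l. Ses C L l U' w' Z1'" by blast
    moreover from this have "cover_step_data Q diag N i p i' p' V v w U' v' w' T in1 pr2 \<iota> \<pi> \<phi>"
      using T(1) False by (simp add: cover_step_data_def)
    ultimately show ?thesis using U'(1) False by blast
  qed
qed

text \<open>
  The covering complex is built from the top degree downwards; the construction is closed off by
  putting its last cycle object one degree below the bottom of \<open>N\<close>.
\<close>

lemma cover_sequence:
  assumes Q: "biproduct_class C Q" and cov: "\<And>k. covered_by C Q (N k)"
    and Z: "\<And>k::int. Ses C (Z k) (i k) (N k) (p k) (Z (k - 1))"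
    and Z': "\<And>k. Ses C (Z' k) (i' k) (N k) (p' k) (Z' (k - 1))"
    and bd: "\<And>k. k < a \<or> b < k \<longrightarrow> zero_object C (N k)"
    and diag: "diag \<longrightarrow> Z' = Z \<and> i' = i \<and> p' = p"
  shows "\<exists>V v w T \<iota> \<pi> \<iota>' \<pi>' \<phi>. \<forall>k. (\<exists>L l. Ses C L l (V k) (v k) (Z k)) \<and> (\<exists>L l. Ses C L l (V k) (w k) (Z' k)) \<and>
    cover_step_data Q diag (N k) (i k) (p k) (i' k) (p' k) (V k) (v k) (w k) (V (k - 1)) (v (k - 1)) (w (k - 1))
      (T k) (\<iota> k) (\<pi> k) (\<iota>' k) (\<pi>' k) (\<phi> k) \<and> (k < a - 1 \<or> b < k \<longrightarrow> zero_object C (T k))"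
proof -
  obtain W where W: "W \<in> Q" "zero_object C W" using Q unfolding biproduct_class_def by blast
  have oO: "W \<in> Obj C" using W zero_object_obj by blast
  \<comment> \<open>The cycle object can be taken zero from \<open>b\<close> upwards because
    \<open>Z k\<close> is a quotient of \<open>N (k + 1)\<close>. In degree \<open>a - 1\<close> it
    may be nonzero although \<open>N\<close> has already ended there.\<close>
  define P where "P k s \<longleftrightarrow> (case s of (V, v, w) \<Rightarrow> V \<in> Q \<and> (\<exists>L l. Ses C L l V v (Z k)) \<and> (\<exists>L l. Ses C L l V w (Z' k)) \<and>
    (k \<ge> b \<or> k < a - 1 \<longrightarrow> zero_object C V) \<and> (diag \<longrightarrow> v = w))" for k s
  define R where "R k s t \<longleftrightarrow> (case s of (V, v, w) \<Rightarrow> case t of (V', v', w') \<Rightarrow>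
    \<exists>T \<iota> \<pi> \<iota>' \<pi>' \<phi>. cover_step_data Q diag (N k) (i k) (p k) (i' k) (p' k) V v w V' v' w' T \<iota> \<pi> \<iota>' \<pi>' \<phi> \<and>
      (k < a - 1 \<or> b < k \<longrightarrow> zero_object C T))" for k s t
  define g where "g k = (W, Zero C W (Z k), Zero C W (Z' k))" for k
  have zs: "\<exists>L l. Ses C L l W (Zero C W X) X" if "zero_object C X" for X
    using ses_zeros[OF W(2) W(2) that] by blast
  have "\<exists>f. \<forall>k. P k (f k) \<and> R k (f k) (f (k - 1))"
  proof (rule int_choice_down[where g = g and b = b])
    fix k assume k: "b \<le> k"
    have "zero_object C (N (k + 1))" using bd k by simp
    then have "zero_object C (Z k)" "zero_object C (Z' k)"
      using kernel_of_zero(2)[OF Z[of "k + 1"]] kernel_of_zero(2)[OF Z'[of "k + 1"]] by simp_all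
    then show "P k (g k)" using W zs diag by (auto simp: P_def g_def)
  next
    fix k assume k: "b < k"
    note z = ses_objs[OF Z[of k]] ses_objs[OF Z'[of k]] ses_arrows[OF Z[of k]] ses_arrows[OF Z'[of k]]
    note ozo = arrow_zero[OF oO oO]
    have "cover_step_data Q diag (N k) (i k) (p k) (i' k) (p' k) W (Zero C W (Z k)) (Zero C W (Z' k))
        W (Zero C W (Z (k - 1))) (Zero C W (Z' (k - 1))) W (Zero C W W) (Zero C W W) (Zero C W W) (Zero C W W) (Zero C W (N k))"
      unfolding cover_step_data_def
      using W ses_zeros[OF W(2) W(2) W(2)] arrow_zero[OF oO z(2)] zero_comp[OF ozo z(1)] zero_comp[OF ozo z(2)]
        zero_comp[OF ozo z(3)] zero_comp[OF ozo z(6)]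
        comp_zero[OF z(7) oO] comp_zero[OF z(8) oO] comp_zero[OF z(10) oO] comp_zero[OF z(11) oO] by simp
    then show "R k (g k) (g (k - 1))" using W(2) unfolding R_def g_def prod.case by blast
  next
    fix k s assume k: "k \<le> b" and s: "P k s"
    obtain V v w where V: "s = (V, v, w)" "V \<in> Q" "\<exists>L l. Ses C L l V v (Z k)" "\<exists>L l. Ses C L l V w (Z' k)"
      "k \<ge> b \<or> k < a - 1 \<longrightarrow> zero_object C V" "diag \<longrightarrow> v = w"
      using s by (cases s) (auto simp: P_def)
    have vw: "arrow C v V (Z k)" "arrow C w V (Z' k)" using V(3,4) ses_arrows(2) by blast+
    show "\<exists>t. P (k - 1) t \<and> R k s t"
    proof (cases "a \<le> k")
      case True
      have "diag \<longrightarrow> Z' k = Z k \<and> i' k = i k \<and> p' k = p k \<and> Z' (k - 1) = Z (k - 1) \<and> v = w"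
        using diag V(6) by simp
      from cover_step_exists[OF Q V(2) cov Z Z' vw this] obtain V' v' w' T \<iota> \<pi> \<iota>' \<pi>' \<phi> where
        "cover_step_data Q diag (N k) (i k) (p k) (i' k) (p' k) V v w V' v' w' T \<iota> \<pi> \<iota>' \<pi>' \<phi>" "V' \<in> Q"
        "\<exists>L l. Ses C L l V' v' (Z (k - 1))" "\<exists>L l. Ses C L l V' w' (Z' (k - 1))" "diag \<longrightarrow> v' = w'" by blast
      note r = this
      have "P (k - 1) (V', v', w')" using r True k unfolding P_def prod.case by auto
      moreover have "\<not> (k < a - 1 \<or> b < k)" using True k by auto
      then have "R k s (V', v', w')" using r(1) unfolding R_def V(1) prod.case by blast
      ultimately show ?thesis by blast
    next
      \<comment> \<open>Here \<open>N k\<close> is zero. Taking \<open>T = V\<close> with the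
        identity as inclusion of cycles, and \<open>W\<close> as the next cycle object, closes off
        the construction; by the invariant this \<open>T\<close> can be nonzero only for
        \<open>k = a - 1\<close>.\<close>
      case False
      have zN: "zero_object C (N k)" using bd False by simp
      then have zz: "zero_object C (Z (k - 1))" "zero_object C (Z' (k - 1))"
        using kernel_of_zero(2)[OF Z[of k]] kernel_of_zero(2)[OF Z'[of k]] by simp_all
      have oV: "V \<in> Obj C" "N k \<in> Obj C" "Z (k - 1) \<in> Obj C" "Z' (k - 1) \<in> Obj C"
        using vw ses_objs[OF Z[of k]] zz zero_object_obj by (auto simp: arrow_def)
      note id = arrow_ident[OF oV(1)] and z = ses_arrows[OF Z[of k]] ses_arrows[OF Z'[of k]]
      note zV = arrow_zero[OF oV(1) oV(2)] and zO = arrow_zero[OF oV(1) oO]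
      have "cover_step_data Q diag (N k) (i k) (p k) (i' k) (p' k) V v w
          W (Zero C W (Z (k - 1))) (Zero C W (Z' (k - 1))) V (Ident C V) (Zero C V W) (Ident C V) (Zero C V W) (Zero C V (N k))"
        unfolding cover_step_data_def
        using V(2) ses_zero_right[OF W(2) oV(1)] zV id_right[OF zV] to_zero[OF zN arrow_comp[OF vw(1) z(1)]]
          to_zero[OF zN arrow_comp[OF vw(2) z(4)]] comp_zero[OF z(2) oV(1)] comp_zero[OF z(5) oV(1)]
          zero_comp[OF zO oV(3)] zero_comp[OF zO oV(4)] by simp
      moreover have "P (k - 1) (W, Zero C W (Z (k - 1)), Zero C W (Z' (k - 1)))"
        using W zs[OF zz(1)] zs[OF zz(2)] diag by (auto simp: P_def)
      moreover have "k < a - 1 \<or> b < k \<longrightarrow> zero_object C V" using V(5) k by auto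
      ultimately show ?thesis unfolding R_def V(1) prod.case
        by (intro exI[of _ "(W, Zero C W (Z (k - 1)), Zero C W (Z' (k - 1)))"]) (unfold prod.case, blast)
    qed
  qed
  then obtain f where f: "\<And>k. P k (f k)" "\<And>k. R k (f k) (f (k - 1))" by blast
  define V v w where "V k = fst (f k)" and "v k = fst (snd (f k))" and "w k = snd (snd (f k))" for k
  have fk: "f k = (V k, v k, w k)" for k by (simp add: V_def v_def w_def)
  have "\<exists>T \<iota> \<pi> \<iota>' \<pi>' \<phi>. cover_step_data Q diag (N k) (i k) (p k) (i' k) (p' k) (V k) (v k) (w k) (V (k - 1)) (v (k - 1)) (w (k - 1))
      T \<iota> \<pi> \<iota>' \<pi>' \<phi> \<and> (k < a - 1 \<or> b < k \<longrightarrow> zero_object C T)" for k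
    using f(2)[of k] unfolding R_def fk by simp
  then obtain T \<iota> \<pi> \<iota>' \<pi>' \<phi> where "\<And>k. cover_step_data Q diag (N k) (i k) (p k) (i' k) (p' k) (V k) (v k) (w k)
      (V (k - 1)) (v (k - 1)) (w (k - 1)) (T k) (\<iota> k) (\<pi> k) (\<iota>' k) (\<pi>' k) (\<phi> k) \<and> (k < a - 1 \<or> b < k \<longrightarrow> zero_object C (T k))"
    by metis
  moreover have "(\<exists>L l. Ses C L l (V k) (v k) (Z k)) \<and> (\<exists>L l. Ses C L l (V k) (w k) (Z' k))" for k
    using f(1)[of k] unfolding P_def fk by simp
  ultimately show ?thesis by blast
qed

text \<open>Surjectivity on cycles does two jobs: by the nine lemma it makes \<open>\<phi>\<close>
  an admissible epimorphism in each degree, and by \<open>acyclic_kernel\<close> it makes the kernel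
  complex acyclic. The last conclusion takes the kernels as given, so that it can be used for both
  differentials with the same kernels.\<close>

lemma cover_complex:
  assumes V: "\<And>k. Ses C (V k) (\<iota> k) (T k) (\<pi> k) (V (k - 1))" and Z: "\<And>k. Ses C (Z k) (i k) (N k) (p k) (Z (k - 1))"
    and d: "\<And>k. d k = i (k - 1) \<cdot> p k" and v: "\<And>k. \<exists>L l. Ses C L l (V k) (v k) (Z k)"
    and \<phi>: "\<And>k. arrow C (\<phi> k) (T k) (N k)" "\<And>k. \<phi> k \<cdot> \<iota> k = i k \<cdot> v k" "\<And>k. p k \<cdot> \<phi> k = v (k - 1) \<cdot> \<pi> k"
    and b: "bounded_graded C T"
  shows "acyclic_complex C T (\<lambda>k. \<iota> (k - 1) \<cdot> \<pi> k)" "chain_map C T (\<lambda>k. \<iota> (k - 1) \<cdot> \<pi> k) \<phi> N d"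
    and "\<exists>K \<kappa>. Ses C K \<kappa> (T k) (\<phi> k) (N k)"
    and "\<lbrakk>\<And>k. Ses C (K k) (\<kappa> k) (T k) (\<phi> k) (N k); chain_complex C N d\<rbrakk>
      \<Longrightarrow> \<exists>\<delta>. acyclic_complex C K \<delta> \<and> chain_map C K \<delta> \<kappa> T (\<lambda>k. \<iota> (k - 1) \<cdot> \<pi> k)"
proof -
  obtain L l where Ll: "\<And>k. Ses C (L k) (l k) (V k) (v k) (Z k)" using v by metis
  show ac: "acyclic_complex C T (\<lambda>k. \<iota> (k - 1) \<cdot> \<pi> k)"
    by (rule acyclicI[where Z = V and i = \<iota> and p = \<pi>]) (use V b in simp_all)
  show m: "chain_map C T (\<lambda>k. \<iota> (k - 1) \<cdot> \<pi> k) \<phi> N d"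
    unfolding chain_map_def
  proof (intro allI conjI \<phi>(1))
    fix k
    note a1 = ses_arrows(2)[OF V[of k]] and a2 = ses_arrows(1)[OF V[of "k - 1"]] and a3 = \<phi>(1)[of "k - 1"]
      and a4 = ses_arrows(2)[OF Ll[of "k - 1"]] and a5 = ses_arrows(1)[OF Z[of "k - 1"]]
    have "\<phi> (k - 1) \<cdot> (\<iota> (k - 1) \<cdot> \<pi> k) = i (k - 1) \<cdot> (v (k - 1) \<cdot> \<pi> k)"
      using assoc[OF a1 a2 a3] \<phi>(2)[of "k - 1"] assoc[OF a1 a4 a5] by simp
    also have "\<dots> = d k \<cdot> \<phi> k"
      using \<phi>(3)[of k] d[of k] assoc[OF \<phi>(1)[of k] ses_arrows(2)[OF Z[of k]] a5] by simp
    finally show "\<phi> (k - 1) \<cdot> (\<iota> (k - 1) \<cdot> \<pi> k) = d k \<cdot> \<phi> k" .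
  qed
  show "\<exists>K \<kappa>. Ses C K \<kappa> (T k) (\<phi> k) (N k)"
    using nine_lemma[OF V[of k] Z[of k] Ll[of k] Ll[of "k - 1"] \<phi>(1)[of k] \<phi>(2)[of k] \<phi>(3)[of k]] by blast
  assume K: "\<And>k. Ses C (K k) (\<kappa> k) (T k) (\<phi> k) (N k)" and N: "chain_complex C N d"
  obtain \<delta> where \<delta>: "chain_complex C K \<delta>" "chain_map C K \<delta> \<kappa> T (\<lambda>k. \<iota> (k - 1) \<cdot> \<pi> k)"
    using kernel_complex[OF ses_kernel[OF K], OF acyclicD(1)[OF ac], OF N, OF m] by blast
  have "acyclic_complex C K \<delta>"
    by (rule acyclic_kernel[OF V _ Z Ll \<phi>(2,3) K \<delta> b]) simp
  then show "\<exists>\<delta>. acyclic_complex C K \<delta> \<and> chain_map C K \<delta> \<kappa> T (\<lambda>k. \<iota> (k - 1) \<cdot> \<pi> k)" using \<delta> by blast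
qed

end

section \<open>Covers of binary complexes by a class closed under sums\<close>

context multi_deflation_exact
begin

theorem binary_cover:
  assumes N: "N \<in> binary_objects C" and Q: "biproduct_class C Q" and cov: "\<And>k. covered_by C Q (obj_at N k)"
  shows "\<exists>T K k t. Ses (Bq C) K k T t N \<and> (\<forall>k. obj_at T k \<in> Q) \<and> (diff N = diff' N \<longrightarrow> diff T = diff' T)"
proof -
  note n = binary_objectsD[OF N]
  let ?d = "diff N = diff' N"
  obtain Z i p where Z: "\<And>k. Ses C (Z k) (i k) (obj_at N k) (p k) (Z (k - 1))" "\<And>k. diff N k = i (k - 1) \<cdot> p k"
    using acyclicE[OF n(2)] by blast
  \<comment> \<open>On a diagonal object the same cycles are used twice, since separate choices
    could yield different factorizations of the two equal differentials.\<close>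
  obtain Z' i' p' where Z': "\<And>k. Ses C (Z' k) (i' k) (obj_at N k) (p' k) (Z' (k - 1))" "\<And>k. diff' N k = i' (k - 1) \<cdot> p' k"
    and diag: "?d \<longrightarrow> Z' = Z \<and> i' = i \<and> p' = p"
  proof (cases ?d)
    case True then show ?thesis using that[of Z i p] Z by simp
  next
    case False then show ?thesis using that acyclicE[OF n(3)] by metis
  qed
  obtain a b where ab: "\<And>k. k < a \<or> b < k \<longrightarrow> zero_object C (obj_at N k)"
    using acyclicD(2)[OF n(2)] unfolding bounded_graded_def by blast
  from cover_sequence[OF Q cov Z(1) Z'(1) ab diag] obtain V v w T \<iota> \<pi> \<iota>' \<pi>' \<phi> where
    *: "\<And>k. (\<exists>L l. Ses C L l (V k) (v k) (Z k)) \<and> (\<exists>L l. Ses C L l (V k) (w k) (Z' k)) \<and>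
      cover_step_data Q ?d (obj_at N k) (i k) (p k) (i' k) (p' k) (V k) (v k) (w k) (V (k - 1)) (v (k - 1)) (w (k - 1))
      (T k) (\<iota> k) (\<pi> k) (\<iota>' k) (\<pi>' k) (\<phi> k) \<and> (k < a - 1 \<or> b < k \<longrightarrow> zero_object C (T k))" by blast
  then have bT: "bounded_graded C T" unfolding bounded_graded_def by blast
  have s: "T k \<in> Q" "Ses C (V k) (\<iota> k) (T k) (\<pi> k) (V (k - 1))" "Ses C (V k) (\<iota>' k) (T k) (\<pi>' k) (V (k - 1))"
    "arrow C (\<phi> k) (T k) (obj_at N k)" "\<phi> k \<cdot> \<iota> k = i k \<cdot> v k" "p k \<cdot> \<phi> k = v (k - 1) \<cdot> \<pi> k"
    "\<phi> k \<cdot> \<iota>' k = i' k \<cdot> w k" "p' k \<cdot> \<phi> k = w (k - 1) \<cdot> \<pi>' k" "?d \<Longrightarrow> \<iota> k = \<iota>' k" "?d \<Longrightarrow> \<pi> k = \<pi>' k"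
    "\<exists>L l. Ses C L l (V k) (v k) (Z k)" "\<exists>L l. Ses C L l (V k) (w k) (Z' k)" for k
    using *[of k] unfolding cover_step_data_def by blast+
  note c = cover_complex[where V = V and \<iota> = \<iota> and T = T and \<pi> = \<pi> and Z = Z and i = i and N = "obj_at N" and p = p
      and d = "diff N" and v = v and \<phi> = \<phi>, OF s(2) Z s(11) s(4-6) bT]
  note c' = cover_complex[where V = V and \<iota> = \<iota>' and T = T and \<pi> = \<pi>' and Z = Z' and i = i' and N = "obj_at N" and p = p'
      and d = "diff' N" and v = w and \<phi> = \<phi>, OF s(3) Z' s(12) s(4,7,8) bT]
  let ?e = "\<lambda>k. \<iota> (k - 1) \<cdot> \<pi> k" and ?e' = "\<lambda>k. \<iota>' (k - 1) \<cdot> \<pi>' k"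
  \<comment> \<open>The kernels depend only on \<open>\<phi>\<close>, which both structures share,
    so a single choice carries both induced differentials.\<close>
  obtain K \<kappa> where K: "\<And>k. Ses C (K k) (\<kappa> k) (T k) (\<phi> k) (obj_at N k)" using c(3) by metis
  obtain \<delta> where \<delta>: "acyclic_complex C K \<delta>" "chain_map C K \<delta> \<kappa> T ?e" using c(4)[OF K n(4)] by blast
  obtain \<delta>' where \<delta>': "acyclic_complex C K \<delta>'" "chain_map C K \<delta>' \<kappa> T ?e'" using c'(4)[OF K n(5)] by blast
  have o: "Binary T ?e ?e' \<in> binary_objects C" "Binary K \<delta> \<delta>' \<in> binary_objects C"
    using c(1) c'(1) \<delta>(1) \<delta>'(1) by (simp_all add: binary_objects_def)
  then have "arrow (Bq C) (Graded_mor \<kappa>) (Binary K \<delta> \<delta>') (Binary T ?e ?e')" "arrow (Bq C) (Graded_mor \<phi>) (Binary T ?e ?e') N"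
    using \<delta> \<delta>' c(2) c'(2) N by (auto intro!: arrow_BqI)
  then have "Ses (Bq C) (Binary K \<delta> \<delta>') (Graded_mor \<kappa>) (Binary T ?e ?e') (Graded_mor \<phi>) N"
    using K by (simp add: Ses_Bq)
  moreover have "?e = ?e'" if ?d using s(9,10)[OF that] by simp
  then have "(\<forall>k. obj_at (Binary T ?e ?e') k \<in> Q) \<and> (?d \<longrightarrow> diff (Binary T ?e ?e') = diff' (Binary T ?e ?e'))"
    using s(1) by simp
  ultimately show ?thesis by blast
qed

lemma biproduct_class_Bq:
  assumes "biproduct_class C Q"
  shows "biproduct_class (Bq C) {X \<in> binary_objects C. \<forall>k. obj_at X k \<in> Q}"
    and "biproduct_class (Bq C) {X \<in> binary_objects C. (\<forall>k. obj_at X k \<in> Q) \<and> diff X = diff' X}"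
proof -
  obtain Z where Z: "Z \<in> Q" "zero_object C Z" using assms unfolding biproduct_class_def by blast
  let ?Z = "Binary (\<lambda>_. Z) (\<lambda>_. Zero C Z Z) (\<lambda>_. Zero C Z Z)"
  have zero: "?Z \<in> binary_objects C" "zero_object (Bq C) ?Z" using zero_binary[OF Z(2)] zero_object_Bq by blast+
  have "\<exists>d d' inX inY prX prY S. biproduct (Bq C) X Y (Binary S d d') inX inY prX prY \<and> (\<forall>k. S k \<in> Q) \<and>
      (diff X = diff' X \<and> diff Y = diff' Y \<longrightarrow> d = d')"
    if X: "X \<in> binary_objects C" "\<forall>k. obj_at X k \<in> Q" and Y: "Y \<in> binary_objects C" "\<forall>k. obj_at Y k \<in> Q" for X Y
  proof -
    have "\<forall>k. \<exists>S inX inY prX prY. S \<in> Q \<and> biproduct C (obj_at X k) (obj_at Y k) S inX inY prX prY"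
      using assms X(2) Y(2) unfolding biproduct_class_def by metis
    then obtain S inX inY prX prY where S: "\<forall>k. S k \<in> Q"
      "\<And>k. biproduct C (obj_at X k) (obj_at Y k) (S k) (inX k) (inY k) (prX k) (prY k)" by metis
    show ?thesis using biproduct_Bq[OF X(1) Y(1) S(2)] S(1) by blast
  qed
  note * = this
  have mem: "S \<in> binary_objects C" if "biproduct (Bq C) X Y S inX inY prX prY" for X Y S inX inY prX prY
    using that by (simp add: biproduct_def)
  show "biproduct_class (Bq C) {X \<in> binary_objects C. \<forall>k. obj_at X k \<in> Q}"
    unfolding biproduct_class_def
  proof (intro conjI ballI)
    show "\<exists>Z\<in>{X \<in> binary_objects C. \<forall>k. obj_at X k \<in> Q}. zero_object (Bq C) Z"
      using zero Z(1) by (intro bexI[of _ ?Z]) auto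
    fix X Y assume XY: "X \<in> {X \<in> binary_objects C. \<forall>k. obj_at X k \<in> Q}" "Y \<in> {X \<in> binary_objects C. \<forall>k. obj_at X k \<in> Q}"
    then obtain d d' inX inY prX prY S where S: "biproduct (Bq C) X Y (Binary S d d') inX inY prX prY" "\<forall>k. S k \<in> Q"
      using *[of X Y] by blast
    show "\<exists>S\<in>{X \<in> binary_objects C. \<forall>k. obj_at X k \<in> Q}. \<exists>inX inY prX prY. biproduct (Bq C) X Y S inX inY prX prY"
      by (rule bexI[of _ "Binary S d d'"]) (use S mem[OF S(1)] in auto)
  qed auto
  show "biproduct_class (Bq C) {X \<in> binary_objects C. (\<forall>k. obj_at X k \<in> Q) \<and> diff X = diff' X}"
    unfolding biproduct_class_def
  proof (intro conjI ballI)
    show "\<exists>Z\<in>{X \<in> binary_objects C. (\<forall>k. obj_at X k \<in> Q) \<and> diff X = diff' X}. zero_object (Bq C) Z"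
      using zero Z(1) by (intro bexI[of _ ?Z]) auto
    fix X Y assume XY: "X \<in> {X \<in> binary_objects C. (\<forall>k. obj_at X k \<in> Q) \<and> diff X = diff' X}"
      "Y \<in> {X \<in> binary_objects C. (\<forall>k. obj_at X k \<in> Q) \<and> diff X = diff' X}"
    then obtain d d' inX inY prX prY S where S: "biproduct (Bq C) X Y (Binary S d d') inX inY prX prY" "\<forall>k. S k \<in> Q" "d = d'"
      using *[of X Y] by blast
    show "\<exists>S\<in>{X \<in> binary_objects C. (\<forall>k. obj_at X k \<in> Q) \<and> diff X = diff' X}. \<exists>inX inY prX prY. biproduct (Bq C) X Y S inX inY prX prY"
      by (rule bexI[of _ "Binary S d d'"]) (use S mem[OF S(1)] in auto)
  qed auto
qed

end

section \<open>Resolving classes and dimension\<close>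

text \<open>For a resolving class these are the objects with a resolution of length at most
  \<open>m\<close>. Allowing \<open>Q\<close> of dimension \<open>m\<close>, instead of demanding
  \<open>Q \<in> A\<close>, makes sequences that arise from kernels usable directly, without first
  rebuilding a resolution.\<close>

primrec dim_class :: "('o, 'm) exact_cat \<Rightarrow> 'o set \<Rightarrow> nat \<Rightarrow> 'o set" where
  "dim_class C A 0 = A"
| "dim_class C A (Suc m) =
     {X. \<exists>K k Q q. Ses C K k Q q X \<and> K \<in> dim_class C A m \<and> Q \<in> dim_class C A m}"

text \<open>The properties of the subcategory that are carried through \<open>Bq\<close>. All zero
  objects have to lie in \<open>A\<close>: outside a finite range the terms and cycles of a complex
  are zero objects over which there is no control.\<close>

locale resolving_class = deflation_exact C for C :: "('o, 'm) exact_cat" (structure) +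
  fixes A :: "'o set"
  assumes subset: "A \<subseteq> Obj C"
    and zeros: "zero_object C Z \<Longrightarrow> Z \<in> A"
    and ext_closed: "\<lbrakk>Ses C X i Y p Z; X \<in> A; Z \<in> A\<rbrakk> \<Longrightarrow> Y \<in> A"
    and kernel_closed: "\<lbrakk>Ses C X i Y p Z; Y \<in> A; Z \<in> A\<rbrakk> \<Longrightarrow> X \<in> A"
    and covered: "X \<in> Obj C \<Longrightarrow> covered_by C A X"
begin

lemma dim_class_Suc: "dim_class C A m \<subseteq> dim_class C A (Suc m)"
proof (induction m)
  case 0
  obtain Z where Z: "zero_object C Z" using zero_object_exists by blast
  show ?case using ses_zero_left[OF Z] zeros[OF Z] subset by (simp, blast)
next
  case (Suc m)
  then show ?case by (simp only: dim_class.simps(2)[of C A "Suc m"]) (auto simp only: dim_class.simps(2)[of C A m], blast)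
qed

lemma dim_class_mono: "m \<le> n \<Longrightarrow> dim_class C A m \<subseteq> dim_class C A n"
  using dim_class_Suc lift_Suc_mono_le[of "dim_class C A"] by blast

text \<open>\<open>Y\<close> is the pullback of the two covers, which is an extension in two ways.
  Comparing these two extensions replaces the lifting of maps between resolutions.\<close>

lemma schanuel:
  assumes "Ses C K k Q q X" "Ses C L l R r X"
  shows "\<exists>Y a b c d. Ses C K a Y b R \<and> Ses C L c Y d Q"
  using ses_pullback[OF assms] by blast

text \<open>
  Closure under extensions and under kernels for dimension \<open>m + 1\<close> follows from the case \<open>m\<close>: any
  admissible epimorphism onto an object of dimension \<open>m + 1\<close> from one of dimension \<open>m\<close> has a kernel
  of dimension \<open>m\<close>, by Schanuel's argument.
\<close>

lemma dim_class_closed: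
  "\<lbrakk>Ses C X i Y p Z; X \<in> dim_class C A m; Z \<in> dim_class C A m\<rbrakk> \<Longrightarrow> Y \<in> dim_class C A m"
  "\<lbrakk>Ses C X i Y p Z; Y \<in> dim_class C A m; Z \<in> dim_class C A m\<rbrakk> \<Longrightarrow> X \<in> dim_class C A m"
  "\<lbrakk>Ses C X i Y p Z; Y \<in> dim_class C A m; Z \<in> dim_class C A (Suc m)\<rbrakk> \<Longrightarrow> X \<in> dim_class C A m"
proof (induction m arbitrary: X i Y p Z)
  case 0
  { case 1 then show ?case using ext_closed by simp
  next
    case 2 then show ?case using kernel_closed by simp
  next
    case 3
    then obtain K k Q q where K: "Ses C K k Q q Z" "K \<in> A" "Q \<in> A" by auto
    obtain W a b c d where W: "Ses C X a W b Q" "Ses C K c W d Y" using schanuel[OF 3(1) K(1)] by blast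
    then show ?case using ext_closed[OF W(2)] kernel_closed[OF W(1)] K 3 by simp
  }
next
  case (Suc m)
  note mono = subsetD[OF dim_class_Suc] and mono0 = subsetD[OF dim_class_mono[of 0]]
  have ext: "Y \<in> dim_class C A (Suc m)"
    if s: "Ses C X i Y p Z" "X \<in> dim_class C A (Suc m)" "Z \<in> dim_class C A (Suc m)" for X i Y p Z
  proof -
    \<comment> \<open>A cover of the middle term yields \<open>R >-> Q ->> Z\<close> and
      \<open>K >-> R ->> X\<close>; the third claim for \<open>m\<close>, applied twice, puts first
      \<open>R\<close> and then \<open>K\<close> in dimension \<open>m\<close>.\<close>
    obtain K k Q q where K: "Ses C K k Q q Y" "Q \<in> A"
      using covered[OF ses_objs(2)[OF s(1)]] by (auto simp: covered_by_def)
    then have Q: "Q \<in> dim_class C A m" using mono0 by simp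
    obtain R j h g where R: "Ses C R j Q (p \<cdot> q) Z" "Ses C K h R g X" using ses_comp[OF K(1) s(1)] by blast
    have "R \<in> dim_class C A m" by (rule Suc(3)[OF R(1) Q s(3)])
    then have "K \<in> dim_class C A m" by (rule Suc(3)[OF R(2) _ s(2)])
    then show ?thesis using K(1) Q by auto
  qed
  have ker: "X \<in> dim_class C A (Suc m)"
    if s: "Ses C X i Y p Z" "Y \<in> dim_class C A (Suc m)" "Z \<in> dim_class C A (Suc m)" for X i Y p Z
  proof -
    obtain K k Q q where K: "Ses C K k Q q Y" "K \<in> dim_class C A m" "Q \<in> dim_class C A m" using s(2) by auto
    obtain R j h g where R: "Ses C R j Q (p \<cdot> q) Z" "Ses C K h R g X" using ses_comp[OF K(1) s(1)] by blast
    have "R \<in> dim_class C A m" by (rule Suc(3)[OF R(1) K(3) s(3)])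
    then show ?thesis using R(2) K(2) by auto
  qed
  { case 1 then show ?case by (rule ext)
  next
    case 2 then show ?case by (rule ker)
  next
    case 3
    then obtain K k Q q where K: "Ses C K k Q q Z" "K \<in> dim_class C A (Suc m)" "Q \<in> dim_class C A (Suc m)"
      by (auto simp only: dim_class.simps(2)[of C A "Suc m"])
    obtain W a b c d where W: "Ses C X a W b Q" "Ses C K c W d Y" using schanuel[OF 3(1) K(1)] by blast
    show ?case by (rule ker[OF W(1) ext[OF W(2) K(2) 3(2)] K(3)])
  }
qed

lemmas dim_class_kernel = dim_class_closed(3)

lemma biproduct_class: "biproduct_class C A"
  unfolding biproduct_class_def
proof (intro conjI ballI subset)
  show "\<exists>Z\<in>A. zero_object C Z" using zero_object_exists zeros by blast
  fix X Y assume "X \<in> A" "Y \<in> A"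
  then obtain S inX inY prX prY where "biproduct C X Y S inX inY prX prY" using biproduct_exists subset by blast
  then show "\<exists>S\<in>A. \<exists>inX inY prX prY. biproduct C X Y S inX inY prX prY"
    using ext_closed[OF ses_split] \<open>X \<in> A\<close> \<open>Y \<in> A\<close> by blast
qed

lemma full_zero_object: "zero_object (full_subcategory C A) Z \<longleftrightarrow> Z \<in> A \<and> zero_object C Z"
proof
  assume Z: "zero_object (full_subcategory C A) Z"
  then have "Z \<in> A" "\<exists>!f. f \<in> Hom C Z Z" by (auto simp: zero_object_def full_subcategory_def)
  moreover from this have "Z \<in> Obj C" using subset by blast
  ultimately show "Z \<in> A \<and> zero_object C Z"
    using zero_objectI arrow_homD[OF arrow_zero] ident_closed by metis
next
  assume "Z \<in> A \<and> zero_object C Z"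
  then show "zero_object (full_subcategory C A) Z"
    unfolding zero_object_def
  proof (intro conjI ballI)
    show "Z \<in> Obj (full_subcategory C A)" using \<open>Z \<in> A \<and> zero_object C Z\<close> by (simp add: full_subcategory_def)
    fix X assume "X \<in> Obj (full_subcategory C A)"
    then have X: "X \<in> Obj C" using subset by (auto simp: full_subcategory_def)
    have "\<forall>X\<in>Obj C. (\<exists>!f. f \<in> Hom C X Z) \<and> (\<exists>!f. f \<in> Hom C Z X)"
      using \<open>Z \<in> A \<and> zero_object C Z\<close> by (simp add: zero_object_def)
    from bspec[OF this X]
    show "\<exists>!f. f \<in> Hom (full_subcategory C A) X Z" "\<exists>!f. f \<in> Hom (full_subcategory C A) Z X"
      by (simp_all add: full_subcategory_def)
  qed
qed

text \<open>Acyclicity in the subcategory asks for the cycles to lie in \<open>A\<close> as well.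
  They vanish in low degrees, and \<open>Z k\<close> is the kernel of
  \<open>N k -> Z (k - 1)\<close>, so closure under kernels propagates membership upwards.\<close>

lemma full_acyclic: "acyclic_complex (full_subcategory C A) N d \<longleftrightarrow> acyclic_complex C N d \<and> (\<forall>k. N k \<in> A)"
proof
  assume a: "acyclic_complex (full_subcategory C A) N d"
  have cc: "chain_complex C N d" "\<forall>k. N k \<in> A"
    using acyclicD(1)[OF a] subset by (auto simp: chain_complex_def full_subcategory_def)
  have "bounded_graded C N" using acyclicD(2)[OF a] unfolding bounded_graded_def full_zero_object by blast
  moreover obtain Z i p where "\<And>k. Ses (full_subcategory C A) (Z k) (i k) (N k) (p k) (Z (k - 1))"
    "\<And>k. d k = i (k - 1) \<cdot>\<^bsub>full_subcategory C A\<^esub> p k" using acyclicE[OF a] by blast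
  then have "\<And>k. Ses C (Z k) (i k) (N k) (p k) (Z (k - 1))" "\<And>k. d k = i (k - 1) \<cdot> p k"
    by (simp_all add: full_subcategory_def)
  ultimately show "acyclic_complex C N d \<and> (\<forall>k. N k \<in> A)" using acyclicI cc(2) by blast
next
  assume a: "acyclic_complex C N d \<and> (\<forall>k. N k \<in> A)"
  then have a: "acyclic_complex C N d" and N: "\<And>k. N k \<in> A" by blast+
  obtain Z i p where Z: "\<And>k. Ses C (Z k) (i k) (N k) (p k) (Z (k - 1))" "\<And>k. d k = i (k - 1) \<cdot> p k"
    using acyclicE[OF a] by blast
  obtain l u where lu: "\<And>k. k < l \<or> u < k \<Longrightarrow> zero_object C (N k)"
    using acyclicD(2)[OF a] unfolding bounded_graded_def by blast
  have low: "Z k \<in> A" if "k < l" for k using zeros[OF kernel_of_zero(1)[OF Z(1) lu]] that by blast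
  have "Z k \<in> A" if "k \<ge> l - 1" for k using that
  proof (induction k rule: int_ge_induct)
    case base then show ?case using low by simp
  next
    case (step k) then show ?case using kernel_closed[OF Z(1)[of "k + 1"] N] by simp
  qed
  then have "Z k \<in> A" for k using low by (cases "k < l") auto
  then have "\<And>k. Ses (full_subcategory C A) (Z k) (i k) (N k) (p k) (Z (k - 1))"
    "\<And>k. d k = i (k - 1) \<cdot>\<^bsub>full_subcategory C A\<^esub> p k"
    using Z N by (simp_all add: full_subcategory_def)
  moreover have "chain_complex (full_subcategory C A) N d"
    using acyclicD(1)[OF a] N by (simp add: chain_complex_def full_subcategory_def)
  moreover have "bounded_graded (full_subcategory C A) N"
    using acyclicD(2)[OF a] N unfolding bounded_graded_def full_zero_object by blast
  ultimately show "acyclic_complex (full_subcategory C A) N d" unfolding acyclic_complex_def by blast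
qed

end

locale finite_resolving_class = resolving_class +
  assumes finite_dim: "X \<in> Obj C \<Longrightarrow> \<exists>m. X \<in> dim_class C A m"

text \<open>For a resolving class \<open>A\<close> these turn out to be the binary complexes of the
  full subcategory on \<open>A\<close>: testing the terms is enough, by
  \<open>full_acyclic\<close>.\<close>

definition graded_class :: "(('o, 'm) multi_obj, 'm multi_mor) exact_cat \<Rightarrow> ('o, 'm) multi_obj set \<Rightarrow> ('o, 'm) multi_obj set" where
  "graded_class C A = {X \<in> binary_objects C. \<forall>k. obj_at X k \<in> A}"

text \<open>Covers come from \<open>binary_cover\<close>. Finite dimension is reduced to the terms:
  the kernel of a cover drops the dimension in every degree at once, and boundedness bounds the
  dimensions of the terms uniformly.\<close>

lemma finite_resolving_class_Bq:
  fixes C :: "(('o, 'm) multi_obj, 'm multi_mor) exact_cat"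
  assumes "finite_resolving_class C A"
  shows "finite_resolving_class (Bq C) (graded_class C A)"
proof -
  interpret finite_resolving_class C A by fact
  interpret multi_deflation_exact C by unfold_locales
  interpret B: deflation_exact "Bq C" by (rule deflation_exact_Bq)
  have cov: "covered_by (Bq C) (graded_class C A) X" if X: "X \<in> Obj (Bq C)" for X
  proof -
    have Xb: "X \<in> binary_objects C" using X by simp
    have "covered_by C A (obj_at X k)" for k using covered binary_objectsD(6)[OF Xb] .
    from binary_cover[OF Xb biproduct_class this] obtain T K k t where T: "Ses (Bq C) K k T t X" "\<forall>k. obj_at T k \<in> A"
      by blast
    then have "T \<in> graded_class C A" using B.ses_objs(2)[OF T(1)] by (simp add: graded_class_def)
    then show ?thesis using T(1) by (auto simp: covered_by_def)
  qed
  have dim: "X \<in> dim_class (Bq C) (graded_class C A) m"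
    if "X \<in> binary_objects C" "\<And>k. obj_at X k \<in> dim_class C A m" for X m
    using that
  proof (induction m arbitrary: X)
    case 0 then show ?case by (simp add: graded_class_def)
  next
    case (Suc m)
    obtain Q K k q where Q: "Q \<in> graded_class C A" "Ses (Bq C) K k Q q X"
      using cov[of X] Suc.prems(1) by (auto simp: covered_by_def)
    have Qm: "obj_at Q n \<in> dim_class C A m" for n
      using Q(1) dim_class_mono[of 0 m] by (auto simp: graded_class_def)
    have "Ses C (obj_at K n) (mor_at k n) (obj_at Q n) (mor_at q n) (obj_at X n)" for n using Q(2) by (simp add: Ses_Bq)
    then have "obj_at K n \<in> dim_class C A m" for n using dim_class_kernel Qm Suc.prems(2) by blast
    then have "K \<in> dim_class (Bq C) (graded_class C A) m" using Suc.IH B.ses_objs(1)[OF Q(2)] by simp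
    moreover have "Q \<in> dim_class (Bq C) (graded_class C A) m" using Suc.IH Qm Q(1) by (simp add: graded_class_def)
    ultimately show ?case using Q(2) by auto
  qed
  show ?thesis
  proof unfold_locales
    show "graded_class C A \<subseteq> Obj (Bq C)" by (auto simp: graded_class_def)
    show "zero_object (Bq C) Z \<Longrightarrow> Z \<in> graded_class C A" for Z
      using zeros by (simp add: zero_object_Bq graded_class_def)
    show "\<lbrakk>Ses (Bq C) X i Y p Z; X \<in> graded_class C A; Z \<in> graded_class C A\<rbrakk> \<Longrightarrow> Y \<in> graded_class C A" for X i Y p Z
      using B.ses_objs(2) ext_closed unfolding graded_class_def Ses_Bq by (simp, blast)
    show "\<lbrakk>Ses (Bq C) X i Y p Z; Y \<in> graded_class C A; Z \<in> graded_class C A\<rbrakk> \<Longrightarrow> X \<in> graded_class C A" for X i Y p Z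
      using B.ses_objs(1) kernel_closed unfolding graded_class_def Ses_Bq by (simp, blast)
    show "X \<in> Obj (Bq C) \<Longrightarrow> covered_by (Bq C) (graded_class C A) X" for X by (rule cov)
    show "\<exists>m. X \<in> dim_class (Bq C) (graded_class C A) m" if X: "X \<in> Obj (Bq C)" for X
    proof -
      have Xb: "X \<in> binary_objects C" using X by simp
      obtain a b where ab: "\<And>k. k < a \<or> b < k \<Longrightarrow> zero_object C (obj_at X k)"
        using acyclicD(2)[OF binary_objectsD(2)[OF Xb]] unfolding bounded_graded_def by blast
      have "\<exists>m. obj_at X k \<in> dim_class C A m" for k using finite_dim binary_objectsD(6)[OF Xb] .
      then obtain m where m: "\<And>k. obj_at X k \<in> dim_class C A (m k)" by metis
      \<comment> \<open>Outside \<open>{a..b}\<close> the terms are zero objects and have dimension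
        \<open>0\<close>; inserting \<open>0\<close> keeps the maximum defined when the interval is
        empty.\<close>
      have "obj_at X k \<in> dim_class C A (Max (insert 0 (m ` {a..b})))" for k
      proof (cases "k < a \<or> b < k")
        case True
        then show ?thesis using zeros[OF ab] dim_class_mono[of 0] by auto
      next
        case False
        then have "m k \<le> Max (insert 0 (m ` {a..b}))" by (intro Max_ge) auto
        then show ?thesis using m dim_class_mono by blast
      qed
      then show ?thesis using dim[OF Xb] by blast
    qed
  qed
qed

text \<open>Obtained as an equality of records, so that it can be iterated by rewriting when
  multicomplexes over the subcategory are compared with multicomplexes in \<open>C\<close>.\<close>

lemma full_subcategory_Bq:
  fixes C :: "(('o, 'm) multi_obj, 'm multi_mor) exact_cat"
  assumes "finite_resolving_class C A"
  shows "Bq (full_subcategory C A) = full_subcategory (Bq C) (graded_class C A)"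
proof -
  interpret finite_resolving_class C A by fact
  have obj: "binary_objects (full_subcategory C A) = graded_class C A"
    by (auto simp: binary_objects_def graded_class_def full_acyclic)
  have hom: "binary_homs (full_subcategory C A) = binary_homs C"
    by (intro ext) (simp add: binary_homs_def full_subcategory_def)
  have sub: "X \<in> graded_class C A \<longleftrightarrow> X \<in> binary_objects C \<and> (\<forall>k. obj_at X k \<in> A)" for X
    by (simp add: graded_class_def)
  show ?thesis
    unfolding Bq_def obj hom by (auto simp: full_subcategory_def fun_eq_iff sub)
qed

lemma finite_resolving_class_base_cat:
  assumes "finite_resolving_class C A"
  shows "finite_resolving_class (base_cat C) (Base_obj ` A)"
proof -
  interpret finite_resolving_class C A by fact
  interpret B: deflation_exact "base_cat C" by (rule deflation_exact_base_cat)
  have dim: "Base_obj X \<in> dim_class (base_cat C) (Base_obj ` A) m" if "X \<in> dim_class C A m" for X m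
    using that
  proof (induction m arbitrary: X)
    case (Suc m)
    then obtain K k Q q where K: "Ses C K k Q q X" "K \<in> dim_class C A m" "Q \<in> dim_class C A m" by auto
    then show ?case using ses_base_catI[OF K(1)] Suc.IH by auto
  qed simp
  show ?thesis
  proof unfold_locales
    show "Base_obj ` A \<subseteq> Obj (base_cat C)" using subset by auto
    show "zero_object (base_cat C) Z \<Longrightarrow> Z \<in> Base_obj ` A" for Z using zeros by (auto simp: zero_object_base_cat)
    show "\<lbrakk>Ses (base_cat C) X i Y p Z; X \<in> Base_obj ` A; Z \<in> Base_obj ` A\<rbrakk> \<Longrightarrow> Y \<in> Base_obj ` A" for X i Y p Z
      using ext_closed by (auto simp: Ses_base_cat)
    show "\<lbrakk>Ses (base_cat C) X i Y p Z; Y \<in> Base_obj ` A; Z \<in> Base_obj ` A\<rbrakk> \<Longrightarrow> X \<in> Base_obj ` A" for X i Y p Z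
      using kernel_closed by (auto simp: Ses_base_cat)
    show "covered_by (base_cat C) (Base_obj ` A) X" if "X \<in> Obj (base_cat C)" for X
    proof -
      obtain X' where X: "X = Base_obj X'" "X' \<in> Obj C" using \<open>X \<in> Obj (base_cat C)\<close> by auto
      obtain R K k r where "R \<in> A" "Ses C K k R r X'" using covered[OF X(2)] by (auto simp: covered_by_def)
      then show ?thesis using ses_base_catI X(1) unfolding covered_by_def by blast
    qed
    show "\<exists>m. X \<in> dim_class (base_cat C) (Base_obj ` A) m" if "X \<in> Obj (base_cat C)" for X
    proof -
      obtain X' where X: "X = Base_obj X'" "X' \<in> Obj C" using \<open>X \<in> Obj (base_cat C)\<close> by auto
      from finite_dim[OF X(2)] obtain m where "X' \<in> dim_class C A m" by blast
      from dim[OF this] show ?thesis unfolding X(1) by blast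
    qed
  qed
qed

lemma full_subcategory_base_cat:
  assumes "A \<subseteq> Obj C"
  shows "base_cat (full_subcategory C A) = full_subcategory (base_cat C) (Base_obj ` A)"
  using assms by (auto simp: base_cat_def full_subcategory_def fun_eq_iff)

primrec multi_class :: "nat \<Rightarrow> ('o, 'm) exact_cat \<Rightarrow> 'o set \<Rightarrow> ('o, 'm) multi_obj set" where
  "multi_class 0 C A = Base_obj ` A"
| "multi_class (Suc n) C A = graded_class (multi_cat n C) (multi_class n C A)"

lemma multi_cat_simps: "multi_cat 0 C = base_cat C" "multi_cat (Suc n) C = Bq (multi_cat n C)"
  by (simp_all add: multi_cat_def)

lemma finite_resolving_class_multi_cat:
  "finite_resolving_class C A \<Longrightarrow> finite_resolving_class (multi_cat n C) (multi_class n C A)"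
  by (induction n) (simp_all add: multi_cat_simps finite_resolving_class_base_cat finite_resolving_class_Bq)

lemma full_subcategory_multi_cat:
  assumes "finite_resolving_class C A"
  shows "multi_cat n (full_subcategory C A) = full_subcategory (multi_cat n C) (multi_class n C A)"
proof (induction n)
  case 0 then show ?case
    using full_subcategory_base_cat resolving_class.subset[OF finite_resolving_class.axioms(1)[OF assms]] by (simp add: multi_cat_simps)
next
  case (Suc n) then show ?case
    using full_subcategory_Bq[OF finite_resolving_class_multi_cat[OF assms]] by (simp add: multi_cat_simps)
qed

text \<open>For the outermost direction the diagonal clause of \<open>binary_cover\<close> applies.
  For an inner one the terms are covered by objects diagonal in that direction, and
  \<open>binary_cover\<close> is applied to the class of these; closure under sums is therefore
  proved along with the existence of covers.\<close>

lemma diagonal_cover: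
  assumes "finite_resolving_class C A" "i < n"
  defines "D \<equiv> {X \<in> multi_class n C A. diagonal_in_direction i X}"
  shows "biproduct_class (multi_cat n C) D"
    and "\<lbrakk>T \<in> Obj (multi_cat n C); diagonal_in_direction i T\<rbrakk> \<Longrightarrow> covered_by (multi_cat n C) D T"
proof -
  have "biproduct_class (multi_cat n C) {X \<in> multi_class n C A. diagonal_in_direction i X} \<and>
    (\<forall>T \<in> Obj (multi_cat n C). diagonal_in_direction i T \<longrightarrow>
      covered_by (multi_cat n C) {X \<in> multi_class n C A. diagonal_in_direction i X} T)"
    using assms(2)
  proof (induction n arbitrary: i)
    case (Suc n)
    interpret finite_resolving_class "multi_cat n C" "multi_class n C A" by (rule finite_resolving_class_multi_cat[OF assms(1)])
    interpret multi_deflation_exact "multi_cat n C" by unfold_locales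
    interpret B: deflation_exact "Bq (multi_cat n C)" by (rule deflation_exact_Bq)
    show ?case
    proof (cases i)
      case 0
      let ?D = "{X \<in> binary_objects (multi_cat n C). (\<forall>k. obj_at X k \<in> multi_class n C A) \<and> diff X = diff' X}"
      have D: "{X \<in> multi_class (Suc n) C A. diagonal_in_direction i X} = ?D"
        using 0 by (auto simp: graded_class_def)
      have "covered_by (Bq (multi_cat n C)) ?D T" if T: "T \<in> binary_objects (multi_cat n C)" "diff T = diff' T" for T
      proof -
        from binary_cover[OF T(1) biproduct_class covered[OF binary_objectsD(6)[OF T(1)]]] T(2)
        obtain R K k r where R: "Ses (Bq (multi_cat n C)) K k R r T" "\<forall>k. obj_at R k \<in> multi_class n C A" "diff R = diff' R"
          by blast
        then have "R \<in> ?D" using B.ses_objs(2)[OF R(1)] by simp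
        then show ?thesis using R(1) unfolding covered_by_def by blast
      qed
      then show ?thesis unfolding D unfolding multi_cat_simps using biproduct_class_Bq(2)[OF biproduct_class] 0 by simp
    next
      case (Suc j)
      then have j: "j < n" using Suc.prems by simp
      let ?E = "{X \<in> multi_class n C A. diagonal_in_direction j X}"
      let ?D = "{X \<in> binary_objects (multi_cat n C). \<forall>k. obj_at X k \<in> ?E}"
      have D: "{X \<in> multi_class (Suc n) C A. diagonal_in_direction i X} = ?D"
        using Suc by (auto simp: graded_class_def)
      note IH = Suc.IH[OF j]
      have "covered_by (Bq (multi_cat n C)) ?D T"
        if T: "T \<in> binary_objects (multi_cat n C)" "\<forall>k. diagonal_in_direction j (obj_at T k)" for T
      proof -
        have "covered_by (multi_cat n C) ?E (obj_at T k)" for k using IH T(2) binary_objectsD(6)[OF T(1)] by blast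
        from binary_cover[OF T(1) conjunct1[OF IH] this]
        obtain R K k r where R: "Ses (Bq (multi_cat n C)) K k R r T" "\<forall>k. obj_at R k \<in> ?E" by blast
        then have "R \<in> ?D" using B.ses_objs(2)[OF R(1)] by simp
        then show ?thesis using R(1) unfolding covered_by_def by blast
      qed
      then show ?thesis unfolding D unfolding multi_cat_simps using biproduct_class_Bq(1)[OF conjunct1[OF IH]] Suc by simp
    qed
  qed simp
  then show "biproduct_class (multi_cat n C) D"
    and "\<lbrakk>T \<in> Obj (multi_cat n C); diagonal_in_direction i T\<rbrakk> \<Longrightarrow> covered_by (multi_cat n C) D T"
    unfolding D_def by blast+
qed

text \<open>The inclusion into \<open>Q\<close> is monic and commutes with all differentials, so
  those of \<open>K\<close> are determined by those of \<open>Q\<close>.\<close>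

lemma diagonal_kernel:
  assumes "deflation_exact C" "i < n" "Ses (multi_cat n C) K k Q q T" "diagonal_in_direction i Q"
  shows "diagonal_in_direction i K"
  using assms(2-4)
proof (induction n arbitrary: i K k Q q T)
  case (Suc n)
  interpret deflation_exact "multi_cat n C" by (rule deflation_exact_multi_cat[OF assms(1)])
  have S: "Ses (multi_cat n C) (obj_at K m) (mor_at k m) (obj_at Q m) (mor_at q m) (obj_at T m)"
    and k: "arrow (Bq (multi_cat n C)) k K Q" for m
    using Suc.prems(2) by (simp_all add: multi_cat_simps Ses_Bq)
  show ?case
  proof (cases i)
    case 0
    have "diff K m = diff' K m" for m
    proof (rule ses_mono[OF S])
      note kd = arrow_BqD[OF k]
      show "arrow (multi_cat n C) (diff K m) (obj_at K m) (obj_at K (m - 1))"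
        "arrow (multi_cat n C) (diff' K m) (obj_at K m) (obj_at K (m - 1))"
        using binary_objectsD(7,8)[OF kd(1)] by blast+
      show "mor_at k (m - 1) \<cdot>\<^bsub>multi_cat n C\<^esub> diff K m = mor_at k (m - 1) \<cdot>\<^bsub>multi_cat n C\<^esub> diff' K m"
        using chain_mapD(2)[OF kd(5), of m] chain_mapD(2)[OF kd(6), of m] Suc.prems(3) 0 by simp
    qed
    then show ?thesis using 0 by (simp add: fun_eq_iff)
  next
    case (Suc j)
    then show ?thesis using Suc.IH[OF _ S, of j] Suc.prems by simp
  qed
qed simp

section \<open>Extending additive invariants\<close>

text \<open>Relative to a set \<open>S\<close>, so that one notion expresses additivity on the
  subcategory, on the objects of bounded dimension, and on the whole category.\<close>

definition additive_on :: "('o, 'm) exact_cat \<Rightarrow> 'o set \<Rightarrow> ('g, 'x) monoid_scheme \<Rightarrow> ('o \<Rightarrow> 'g) \<Rightarrow> bool" where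
  "additive_on C S G f \<longleftrightarrow> (\<forall>X\<in>S. f X \<in> carrier G) \<and>
     (\<forall>X i Y p Z. Ses C X i Y p Z \<and> X \<in> S \<and> Y \<in> S \<and> Z \<in> S \<longrightarrow> f Y = f X \<otimes>\<^bsub>G\<^esub> f Z)"

lemma additive_onD:
  assumes "additive_on C S G f"
  shows "X \<in> S \<Longrightarrow> f X \<in> carrier G"
    and "\<lbrakk>Ses C X i Y p Z; X \<in> S; Y \<in> S; Z \<in> S\<rbrakk> \<Longrightarrow> f Y = f X \<otimes>\<^bsub>G\<^esub> f Z"
  using assms unfolding additive_on_def by blast+

lemma additive_on_subset: "\<lbrakk>additive_on C S G f; T \<subseteq> S\<rbrakk> \<Longrightarrow> additive_on C T G f"
  unfolding additive_on_def by blast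

lemma (in comm_group) quotient_eqI:
  assumes "a \<in> carrier G" "q \<in> carrier G" "l \<in> carrier G" "r \<in> carrier G" "a \<otimes> r = l \<otimes> q"
  shows "inv a \<otimes> q = inv l \<otimes> r"
proof -
  have "a \<otimes> (inv l \<otimes> r) = inv l \<otimes> (l \<otimes> q)" using assms m_lcomm[of a "inv l" r] by simp
  also have "\<dots> = q" using assms(2,3) by (simp add: m_assoc[symmetric])
  finally show ?thesis using assms(1-4) inv_solve_left[of "inv l \<otimes> r" a q] by simp
qed

context finite_resolving_class
begin

text \<open>Written additively, the value \<open>F Q - F K\<close> does not depend on the chosen
  sequence: if \<open>L >-> R ->> X\<close> is another one, the object \<open>Y\<close> of
  \<open>schanuel\<close> gives \<open>F K + F R = F Y = F L + F Q\<close>. Here \<open>Y\<close>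
  has dimension at most \<open>m\<close>, where \<open>F\<close> is already additive.\<close>

lemma additive_extension_step:
  assumes G: "comm_group G" and F: "additive_on C (dim_class C A m) G F"
  shows "\<exists>F'. additive_on C (dim_class C A (Suc m)) G F' \<and> (\<forall>X\<in>dim_class C A m. F' X = F X)"
proof -
  interpret G: comm_group G by fact
  note FD = additive_onD[OF F]
  have "\<forall>X\<in>dim_class C A (Suc m). \<exists>K Q. (\<exists>k q. Ses C K k Q q X) \<and> K \<in> dim_class C A m \<and> Q \<in> dim_class C A m"
    by auto
  then obtain K Q where KQ: "\<And>X. X \<in> dim_class C A (Suc m) \<Longrightarrow>
      (\<exists>k q. Ses C (K X) k (Q X) q X) \<and> K X \<in> dim_class C A m \<and> Q X \<in> dim_class C A m" by metis
  define F' where "F' X = inv\<^bsub>G\<^esub> (F (K X)) \<otimes>\<^bsub>G\<^esub> F (Q X)" for X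
  have F': "F' X = inv\<^bsub>G\<^esub> (F L) \<otimes>\<^bsub>G\<^esub> F R"
    if s: "Ses C L l R r X" "L \<in> dim_class C A m" "R \<in> dim_class C A m" for L l R r X
  proof -
    have "X \<in> dim_class C A (Suc m)" using s by auto
    then obtain k q where k: "Ses C (K X) k (Q X) q X" and kq: "K X \<in> dim_class C A m" "Q X \<in> dim_class C A m"
      using KQ by blast
    obtain Y a b c d where Y: "Ses C (K X) a Y b R" "Ses C L c Y d (Q X)" using schanuel[OF k s(1)] by blast
    have "Y \<in> dim_class C A m" by (rule dim_class_closed(1)[OF Y(1) kq(1) s(3)])
    then have "F (K X) \<otimes>\<^bsub>G\<^esub> F R = F L \<otimes>\<^bsub>G\<^esub> F (Q X)" using FD(2)[OF Y(1)] FD(2)[OF Y(2)] kq s by simp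
    then show ?thesis unfolding F'_def using FD(1) kq s by (intro G.quotient_eqI) simp_all
  qed
  have "F' X = F X" if X: "X \<in> dim_class C A m" for X
  proof -
    obtain k q where k: "Ses C (K X) k (Q X) q X" and kq: "K X \<in> dim_class C A m" "Q X \<in> dim_class C A m"
      using KQ subsetD[OF dim_class_Suc X] by blast
    show ?thesis unfolding F'_def FD(2)[OF k kq X] using FD(1) kq X by (simp add: G.m_assoc[symmetric])
  qed
  moreover have "F' X \<in> carrier G" if "X \<in> dim_class C A (Suc m)" for X
    unfolding F'_def using KQ[OF that] FD(1) by simp
  moreover have "F' Y = F' X \<otimes>\<^bsub>G\<^esub> F' Z"
    if s: "Ses C X i Y p Z" and d: "X \<in> dim_class C A (Suc m)" "Y \<in> dim_class C A (Suc m)" "Z \<in> dim_class C A (Suc m)"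
    for X i Y p Z
  proof -
    obtain k q where k: "Ses C (K Y) k (Q Y) q Y" and kq: "K Y \<in> dim_class C A m" "Q Y \<in> dim_class C A m"
      using KQ d(2) by blast
    obtain R j h g where R: "Ses C R j (Q Y) (p \<cdot> q) Z" "Ses C (K Y) h R g X" using ses_comp[OF k s] by blast
    have Rm: "R \<in> dim_class C A m" by (rule dim_class_kernel[OF R(1) kq(2) d(3)])
    have c: "F (K Y) \<in> carrier G" "F R \<in> carrier G" "F (Q Y) \<in> carrier G" using FD(1) Rm kq by simp_all
    then have "F R \<otimes>\<^bsub>G\<^esub> (inv\<^bsub>G\<^esub> F R \<otimes>\<^bsub>G\<^esub> F (Q Y)) = F (Q Y)" by (simp add: G.m_assoc[symmetric])
    then show ?thesis
      unfolding F'[OF R(1) Rm kq(2)] F'[OF R(2) kq(1) Rm] F'[OF k kq] using c by (simp add: G.m_assoc)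
  qed
  ultimately show ?thesis unfolding additive_on_def by blast
qed

text \<open>Additivity forces \<open>F X = F Q - F K\<close>, so by induction on the dimension the
  values on \<open>A\<close> determine all others. This makes the extensions to different dimensions
  compatible.\<close>

lemma additive_unique:
  assumes G: "comm_group G" and F: "additive_on C (dim_class C A m) G F" "additive_on C (dim_class C A m) G F'"
    and e: "\<And>X. X \<in> A \<Longrightarrow> F X = F' X" and X: "X \<in> dim_class C A m"
  shows "F X = F' X"
proof -
  interpret G: comm_group G by fact
  have "\<forall>X\<in>dim_class C A j. F X = F' X" if "j \<le> m" for j
    using that
  proof (induction j)
    case (Suc j)
    show ?case
    proof
      fix X assume X: "X \<in> dim_class C A (Suc j)"
      then obtain K k Q q where K: "Ses C K k Q q X" "K \<in> dim_class C A j" "Q \<in> dim_class C A j" by auto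
      have m: "K \<in> dim_class C A m" "Q \<in> dim_class C A m" "X \<in> dim_class C A m"
        using K(2,3) X dim_class_mono Suc.prems by (meson Suc_leD subsetD)+
      have "F K \<otimes>\<^bsub>G\<^esub> F X = F K \<otimes>\<^bsub>G\<^esub> F' X"
        using additive_onD(2)[OF F(1) K(1) m] additive_onD(2)[OF F(2) K(1) m] Suc K(2,3) by simp
      then show "F X = F' X"
        using additive_onD(1)[OF F(1)] additive_onD(1)[OF F(2)] m G.Units_eq by simp
    qed
  qed (use e in simp)
  then show ?thesis using X by blast
qed

theorem additive_extension:
  assumes G: "comm_group G" and f: "additive_on C A G f"
  shows "\<exists>F. additive_on C (Obj C) G F \<and> (\<forall>X\<in>A. F X = f X)"
proof -
  have "\<exists>F. additive_on C (dim_class C A m) G F \<and> (\<forall>X\<in>A. F X = f X)" for m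
  proof (induction m)
    case 0 then show ?case using f by auto
  next
    case (Suc m)
    then obtain F where F: "additive_on C (dim_class C A m) G F" "\<forall>X\<in>A. F X = f X" by blast
    from additive_extension_step[OF G F(1)] obtain F' where
      F': "additive_on C (dim_class C A (Suc m)) G F'" "\<forall>X\<in>dim_class C A m. F' X = F X" by blast
    then have "\<forall>X\<in>A. F' X = f X" using F(2) dim_class_mono[of 0 m] by auto
    then show ?case using F'(1) by blast
  qed
  then obtain F where F: "\<And>m. additive_on C (dim_class C A m) G (F m)" "\<And>m X. X \<in> A \<Longrightarrow> F m X = f X" by metis
  have mono: "F j X = F m X" if "X \<in> dim_class C A j" "j \<le> m" for j m X
    by (rule additive_unique[OF G F(1) additive_on_subset[OF F(1) dim_class_mono[OF that(2)]] _ that(1)])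
      (simp add: F(2))
  \<comment> \<open>By \<open>mono\<close> every bound on the dimension of \<open>X\<close> gives
    the same value; the least one is merely a canonical choice.\<close>
  define E where "E X = F (LEAST m. X \<in> dim_class C A m) X" for X
  have E: "E X = F m X" if "X \<in> dim_class C A m" for X m
    unfolding E_def using mono[OF LeastI[of "\<lambda>m. X \<in> dim_class C A m", OF that] Least_le[of "\<lambda>m. X \<in> dim_class C A m", OF that]] .
  have "E X \<in> carrier G" if X: "X \<in> Obj C" for X
  proof -
    obtain m where m: "X \<in> dim_class C A m" using finite_dim[OF X] by blast
    show ?thesis unfolding E[OF m] by (rule additive_onD(1)[OF F(1) m])
  qed
  moreover have "E Y = E X \<otimes>\<^bsub>G\<^esub> E Z" if s: "Ses C X i Y p Z" for X i Y p Z
  proof -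
    obtain a b c where abc: "X \<in> dim_class C A a" "Y \<in> dim_class C A b" "Z \<in> dim_class C A c"
      using finite_dim ses_objs[OF s] by meson
    let ?m = "a + b + c"
    have m: "X \<in> dim_class C A ?m" "Y \<in> dim_class C A ?m" "Z \<in> dim_class C A ?m"
      using abc dim_class_mono[of a ?m] dim_class_mono[of b ?m] dim_class_mono[of c ?m] by auto
    show ?thesis unfolding E[OF m(1)] E[OF m(2)] E[OF m(3)] by (rule additive_onD(2)[OF F(1) s m])
  qed
  moreover have "\<forall>X\<in>A. E X = f X" using E[of _ 0] F(2) by simp
  ultimately show ?thesis unfolding additive_on_def by blast
qed

text \<open>Meant for \<open>D\<close> the objects diagonal in a fixed direction: covers and their
  kernels can be taken inside \<open>D\<close>, and passing to the kernel lowers the dimension by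
  \<open>dim_class_kernel\<close>, so the induction never leaves \<open>D\<close>.\<close>

lemma additive_trivial:
  assumes G: "comm_group G" and F: "additive_on C (Obj C) G F" and D: "D \<subseteq> Obj C"
    and cov: "\<And>T. T \<in> D \<Longrightarrow> \<exists>K k Q q. Ses C K k Q q T \<and> Q \<in> A \<inter> D \<and> K \<in> D"
    and one: "\<And>T. T \<in> A \<inter> D \<Longrightarrow> F T = \<one>\<^bsub>G\<^esub>" and T: "T \<in> D"
  shows "F T = \<one>\<^bsub>G\<^esub>"
proof -
  interpret G: comm_group G by fact
  have "\<forall>T\<in>D. T \<in> dim_class C A m \<longrightarrow> F T = \<one>\<^bsub>G\<^esub>" for m
  proof (induction m)
    case 0 then show ?case using one by simp
  next
    case (Suc m)
    show ?case
    proof (intro ballI impI)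
      fix T assume T: "T \<in> D" "T \<in> dim_class C A (Suc m)"
      then obtain K k Q q where K: "Ses C K k Q q T" "Q \<in> A" "Q \<in> D" "K \<in> D" using cov by blast
      have "K \<in> dim_class C A m"
        by (rule dim_class_kernel[OF K(1) _ T(2)]) (use K(2) dim_class_mono[of 0 m] in auto)
      then have "F K = \<one>\<^bsub>G\<^esub>" "F Q = \<one>\<^bsub>G\<^esub>" using Suc K one by auto
      then show "F T = \<one>\<^bsub>G\<^esub>"
        using additive_onD(2)[OF F K(1)] ses_objs[OF K(1)] additive_onD(1)[OF F] by simp
    qed
  qed
  then show ?thesis using finite_dim T D by blast
qed

end

section \<open>K-groups\<close>

lemma coset_free: "H #>\<^bsub>free_Abelian_group S\<^esub> x = (\<lambda>r. r + x) ` H"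
  by (auto simp: r_coset_def)

text \<open>The property on which the coset computations rest: it places the relators in the free
  abelian group. For multicomplexes over the subcategory it is immediate once they are identified
  with a full subcategory.\<close>

definition ses_typed :: "('o, 'm) exact_cat \<Rightarrow> bool" where
  "ses_typed C \<longleftrightarrow> (\<forall>X i Y p Z. Ses C X i Y p Z \<longrightarrow> X \<in> Obj C \<and> Y \<in> Obj C \<and> Z \<in> Obj C)"

lemma K_relators_subset:
  assumes "ses_typed (multi_cat n C)"
  shows "K_relators n C \<subseteq> carrier (free_Abelian_group (Obj (multi_cat n C)))"
proof
  fix x assume "x \<in> K_relators n C"
  then consider X' i X p X'' where "x = frag_of X' + frag_of X'' - frag_of X" "Ses (multi_cat n C) X' i X p X''"
    | T where "x = frag_of T" "T \<in> Obj (multi_cat n C)"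
    unfolding K_relators_def by blast
  then show "x \<in> carrier (free_Abelian_group (Obj (multi_cat n C)))"
  proof cases
    case 1
    then have "X' \<in> Obj (multi_cat n C)" "X \<in> Obj (multi_cat n C)" "X'' \<in> Obj (multi_cat n C)"
      using assms unfolding ses_typed_def by blast+
    then have "Poly_Mapping.keys (frag_of X' + frag_of X'') \<subseteq> Obj (multi_cat n C)"
      using keys_add[of "frag_of X'" "frag_of X''"] by auto
    then show ?thesis using 1(1) keys_diff[of "frag_of X' + frag_of X''" "frag_of X"] \<open>X \<in> _\<close> by auto
  qed simp
qed

lemma K_relations_props:
  assumes "ses_typed (multi_cat n C)"
  shows "subgroup (K_relations n C) (free_Abelian_group (Obj (multi_cat n C)))"
    and "K_relators n C \<subseteq> K_relations n C" "0 \<in> K_relations n C"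
    and "\<lbrakk>x \<in> K_relations n C; y \<in> K_relations n C\<rbrakk> \<Longrightarrow> x + y \<in> K_relations n C"
    and "\<lbrakk>x \<in> K_relations n C; y \<in> K_relations n C\<rbrakk> \<Longrightarrow> x - y \<in> K_relations n C"
    and "x \<in> K_relations n C \<Longrightarrow> Poly_Mapping.keys x \<subseteq> Obj (multi_cat n C)"
proof -
  let ?F = "free_Abelian_group (Obj (multi_cat n C))"
  show s: "subgroup (K_relations n C) ?F"
    unfolding K_relations_def by (rule group.generate_is_subgroup[OF group_free_Abelian_group K_relators_subset[OF assms]])
  show "K_relators n C \<subseteq> K_relations n C" unfolding K_relations_def by (auto intro: generate.incl)
  show "0 \<in> K_relations n C" using subgroup.one_closed[OF s] by simp
  have k: "Poly_Mapping.keys x \<subseteq> Obj (multi_cat n C)" if "x \<in> K_relations n C" for x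
    using subgroup.mem_carrier[OF s that] by simp
  then show "x \<in> K_relations n C \<Longrightarrow> Poly_Mapping.keys x \<subseteq> Obj (multi_cat n C)" .
  show a: "x + y \<in> K_relations n C" if "x \<in> K_relations n C" "y \<in> K_relations n C" for x y
    using subgroup.m_closed[OF s that] by simp
  show "x - y \<in> K_relations n C" if "x \<in> K_relations n C" "y \<in> K_relations n C" for x y
    using a[OF that(1) subgroup.m_inv_closed[OF s that(2)]] k[OF that(2)] by simp
qed

lemma K_coset_eq_iff:
  assumes "ses_typed (multi_cat n C)"
  shows "(\<lambda>r. r + x) ` K_relations n C = (\<lambda>r. r + y) ` K_relations n C \<longleftrightarrow> x - y \<in> K_relations n C"
proof
  note R = K_relations_props[OF assms]
  assume "(\<lambda>r. r + x) ` K_relations n C = (\<lambda>r. r + y) ` K_relations n C"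
  moreover have "x \<in> (\<lambda>r. r + x) ` K_relations n C" using R(3) by force
  ultimately obtain r where "r \<in> K_relations n C" "x = r + y" by blast
  then show "x - y \<in> K_relations n C" by simp
next
  note R = K_relations_props[OF assms]
  assume xy: "x - y \<in> K_relations n C"
  have "r + x \<in> (\<lambda>r. r + y) ` K_relations n C" if "r \<in> K_relations n C" for r
    using R(4)[OF that xy] by (intro image_eqI[of _ _ "r + (x - y)"]) simp_all
  moreover have "r + y \<in> (\<lambda>r. r + x) ` K_relations n C" if "r \<in> K_relations n C" for r
    using R(5)[OF that xy] by (intro image_eqI[of _ _ "r - (x - y)"]) simp_all
  ultimately show "(\<lambda>r. r + x) ` K_relations n C = (\<lambda>r. r + y) ` K_relations n C" by blast
qed

lemma K_group_props:
  assumes "ses_typed (multi_cat n C)"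
  shows "comm_group (K_group n C)"
    and "carrier (K_group n C) = {(\<lambda>r. r + x) ` K_relations n C | x. Poly_Mapping.keys x \<subseteq> Obj (multi_cat n C)}"
    and "\<lbrakk>Poly_Mapping.keys x \<subseteq> Obj (multi_cat n C); Poly_Mapping.keys y \<subseteq> Obj (multi_cat n C)\<rbrakk> \<Longrightarrow>
      (\<lambda>r. r + x) ` K_relations n C \<otimes>\<^bsub>K_group n C\<^esub> (\<lambda>r. r + y) ` K_relations n C = (\<lambda>r. r + (x + y)) ` K_relations n C"
    and "\<one>\<^bsub>K_group n C\<^esub> = K_relations n C"
proof -
  let ?F = "free_Abelian_group (Obj (multi_cat n C))"
  interpret F: comm_group ?F by (rule abelian_free_Abelian_group)
  note s = K_relations_props(1)[OF assms]
  interpret N: normal "K_relations n C" ?F using s by (rule F.subgroup_imp_normal)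
  show "comm_group (K_group n C)" unfolding K_group_def by (rule F.abelian_FactGroup[OF s])
  show "carrier (K_group n C) = {(\<lambda>r. r + x) ` K_relations n C | x. Poly_Mapping.keys x \<subseteq> Obj (multi_cat n C)}"
  proof -
    have "(\<Union>a\<in>{c. Poly_Mapping.keys c \<subseteq> T}. {f a}) = {f x |x. Poly_Mapping.keys x \<subseteq> T}"
      for T and f :: "_ \<Rightarrow> (('a, 'b) multi_obj \<Rightarrow>\<^sub>0 int) set" by blast
    moreover have "carrier ?F = {c. Poly_Mapping.keys c \<subseteq> Obj (multi_cat n C)}" by auto
    ultimately show ?thesis by (simp only: K_group_def FactGroup_def RCOSETS_def coset_free partial_object.simps)
  qed
  show "\<one>\<^bsub>K_group n C\<^esub> = K_relations n C" by (simp add: K_group_def FactGroup_def)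
  assume "Poly_Mapping.keys x \<subseteq> Obj (multi_cat n C)" "Poly_Mapping.keys y \<subseteq> Obj (multi_cat n C)"
  then show "(\<lambda>r. r + x) ` K_relations n C \<otimes>\<^bsub>K_group n C\<^esub> (\<lambda>r. r + y) ` K_relations n C = (\<lambda>r. r + (x + y)) ` K_relations n C"
    using N.rcos_sum[of x y] by (simp add: K_group_def FactGroup_def coset_free)
qed

lemma ses_typed_multi_cat: "deflation_exact C \<Longrightarrow> ses_typed (multi_cat n C)"
  using deflation_exact_multi_cat[of C n]
  by (auto simp: ses_typed_def dest: ses_category.ses_objs[OF deflation_exact.axioms(1)])

text \<open>After identifying multicomplexes over the subcategory with the full subcategory on
  \<open>B\<close>, the induced map is the identity on representatives. Injectivity comes from the
  homomorphism \<open>h\<close> extending the class map of \<open>B\<close>, surjectivity from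
  induction on the dimension.\<close>

theorem K_map_inclusion_iso:
  assumes res: "finite_resolving_class C A"
  shows "K_map n (full_subcategory C A) C id id \<in> iso (K_group n (full_subcategory C A)) (K_group n C)"
proof -
  let ?P = "full_subcategory C A"
  define E where "E = multi_cat n C"
  define B where "B = multi_class n C A"
  interpret M: finite_resolving_class C A by fact
  interpret R: finite_resolving_class E B unfolding E_def B_def by (rule finite_resolving_class_multi_cat[OF res])
  have EP: "multi_cat n ?P = full_subcategory E B" unfolding E_def B_def by (rule full_subcategory_multi_cat[OF res])
  have objP: "Obj (multi_cat n ?P) = B" and sesP: "Ses (multi_cat n ?P) X i Y p Z \<longleftrightarrow> Ses E X i Y p Z \<and> X \<in> B \<and> Y \<in> B \<and> Z \<in> B"
    for X i Y p Z unfolding EP by (simp_all add: full_subcategory_def)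
  have BE: "B \<subseteq> Obj E" by (rule R.subset)
  have tM: "ses_typed (multi_cat n C)" by (rule ses_typed_multi_cat[OF M.deflation_exact_axioms])
  have tP: "ses_typed (multi_cat n ?P)" unfolding ses_typed_def sesP objP by blast
  note RM = K_relations_props[OF tM, folded E_def] and RP = K_relations_props[OF tP, unfolded objP]
  note GM = K_group_props[OF tM, folded E_def] and GP = K_group_props[OF tP, unfolded objP]
  interpret G: comm_group "K_group n ?P" by (rule GP(1))

  have relM: "frag_of X + frag_of Z - frag_of Y \<in> K_relations n C" if "Ses E X i Y p Z" for X i Y p Z
  proof (rule subsetD[OF RM(2)])
    show "frag_of X + frag_of Z - frag_of Y \<in> K_relators n C"
      using that unfolding K_relators_def E_def by blast
  qed
  have relP: "frag_of X + frag_of Z - frag_of Y \<in> K_relations n ?P" if "Ses E X i Y p Z" "X \<in> B" "Y \<in> B" "Z \<in> B" for X i Y p Z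
  proof (rule subsetD[OF RP(2)])
    have "Ses (multi_cat n ?P) X i Y p Z" using that sesP by simp
    then show "frag_of X + frag_of Z - frag_of Y \<in> K_relators n ?P" unfolding K_relators_def by blast
  qed
  have "K_relators n ?P \<subseteq> K_relations n C"
  proof
    fix x assume "x \<in> K_relators n ?P"
    then consider X i Y p Z where "x = frag_of X + frag_of Z - frag_of Y" "Ses (multi_cat n ?P) X i Y p Z"
      | T where "x = frag_of T" "T \<in> B" "diagonal n T"
      unfolding K_relators_def objP by blast
    then show "x \<in> K_relations n C"
    proof cases
      case 1
      then have "Ses E X i Y p Z" using sesP by simp
      then show ?thesis unfolding 1(1) by (rule relM)
    next
      case 2
      then have "frag_of T \<in> K_relators n C" using BE unfolding K_relators_def E_def by blast
      then show ?thesis unfolding 2(1) by (rule subsetD[OF RM(2)])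
    qed
  qed
  \<comment> \<open>The relations of \<open>C\<close> are intersected with the smaller free abelian
    group because the subgroup of relations of the subcategory is generated there.\<close>
  moreover have "subgroup (K_relations n C \<inter> carrier (free_Abelian_group B)) (free_Abelian_group B)"
  proof (rule group.subgroupI[OF group_free_Abelian_group])
    show "inv\<^bsub>free_Abelian_group B\<^esub> a \<in> K_relations n C \<inter> carrier (free_Abelian_group B)"
      if "a \<in> K_relations n C \<inter> carrier (free_Abelian_group B)" for a
      using that RM(5)[OF RM(3), of a] by simp
  qed (use RM(3,4) in \<open>auto dest!: subsetD[OF keys_add]\<close>)
  ultimately have "generate (free_Abelian_group B) (K_relators n ?P) \<subseteq> K_relations n C \<inter> carrier (free_Abelian_group B)"
    using K_relators_subset[OF tP, unfolded objP]
    by (intro group.generate_subgroup_incl[OF group_free_Abelian_group]) blast+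
  \<comment> \<open>Relations over the subcategory remain relations in \<open>C\<close>; this is
    what makes the induced map well defined on cosets.\<close>
  then have PM: "K_relations n ?P \<subseteq> K_relations n C" unfolding K_relations_def[of n ?P] objP by blast

  define q where "q x = (\<lambda>r. r + x) ` K_relations n ?P" for x
  define qM where "qM x = (\<lambda>r. r + x) ` K_relations n C" for x
  have q_eq: "q x = q y \<longleftrightarrow> x - y \<in> K_relations n ?P" for x y unfolding q_def by (rule K_coset_eq_iff[OF tP])
  have qM_eq: "qM x = qM y \<longleftrightarrow> x - y \<in> K_relations n C" for x y unfolding qM_def by (rule K_coset_eq_iff[OF tM])
  have q_mult: "q x \<otimes>\<^bsub>K_group n ?P\<^esub> q y = q (x + y)" if "Poly_Mapping.keys x \<subseteq> B" "Poly_Mapping.keys y \<subseteq> B" for x y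
    unfolding q_def by (rule GP(3)[OF that])
  have q_car: "q x \<in> carrier (K_group n ?P)" if "Poly_Mapping.keys x \<subseteq> B" for x using that unfolding GP(2) q_def by blast
  have q_one: "\<one>\<^bsub>K_group n ?P\<^esub> = q 0" unfolding GP(4) q_def by simp

  \<comment> \<open>\<open>the_elem\<close> is meaningful because, by \<open>PM\<close>, a coset of
    the smaller relations lies in a single coset of the larger ones; applying identities termwise
    leaves representatives unchanged.\<close>
  have map: "K_map n ?P C id id (q x) = qM x" for x
  proof -
    have "qM y = qM x" if "y \<in> q x" for y using that PM unfolding q_def qM_eq by auto
    moreover have "x \<in> q x" unfolding q_def using RP(3) by (intro image_eqI[of _ _ 0]) simp_all
    ultimately have "qM ` q x = {qM x}" by blast
    moreover have "(\<lambda>y. K_relations n C #>\<^bsub>free_Abelian_group (Obj (multi_cat n C))\<^esub>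
        frag_extend (\<lambda>X. frag_of (map_multi_obj id id X)) y) ` q x = qM ` q x"
      by (simp add: coset_free qM_def multi_obj.map_id frag_expansion[symmetric])
    ultimately show ?thesis by (simp add: K_map_def)
  qed

  have "additive_on E B (K_group n ?P) (\<lambda>X. q (frag_of X))"
    unfolding additive_on_def
  proof (intro conjI ballI allI impI)
    show "q (frag_of X) \<in> carrier (K_group n ?P)" if "X \<in> B" for X using that by (simp add: q_car)
    fix X i Y p Z assume s: "Ses E X i Y p Z \<and> X \<in> B \<and> Y \<in> B \<and> Z \<in> B"
    then have "frag_of X + frag_of Z - frag_of Y \<in> K_relations n ?P" using relP by blast
    then have "q (frag_of X + frag_of Z) = q (frag_of Y)" unfolding q_eq .
    then show "q (frag_of Y) = q (frag_of X) \<otimes>\<^bsub>K_group n ?P\<^esub> q (frag_of Z)" using q_mult s by simp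
  qed
  \<comment> \<open>The tautological class map on \<open>B\<close> is an additive invariant with
    values in the K-group of the subcategory; its extension \<open>F\<close> to all objects is the
    candidate for the inverse.\<close>
  from R.additive_extension[OF GP(1) this] obtain F where
    F: "additive_on E (Obj E) (K_group n ?P) F" "\<And>X. X \<in> B \<Longrightarrow> F X = q (frag_of X)" by blast
  have F_diag: "F T = \<one>\<^bsub>K_group n ?P\<^esub>" if T: "T \<in> Obj E" "diagonal n T" for T
  proof -
    obtain i where i: "i < n" "diagonal_in_direction i T" using T(2) by (auto simp: diagonal_def)
    let ?D = "{T \<in> Obj E. diagonal_in_direction i T}"
    show ?thesis
    proof (rule R.additive_trivial[OF GP(1) F(1), of ?D])
      show "T \<in> ?D" using T i by simp
      fix T assume T: "T \<in> ?D"
      then have "covered_by E {X \<in> B. diagonal_in_direction i X} T"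
        using diagonal_cover(2)[OF res i(1)] unfolding E_def B_def by blast
      then obtain K k Q q where K: "Ses E K k Q q T" "Q \<in> B" "diagonal_in_direction i Q" by (auto simp: covered_by_def)
      have "diagonal_in_direction i K"
        by (rule diagonal_kernel[OF M.deflation_exact_axioms i(1) K(1)[unfolded E_def] K(3)])
      then show "\<exists>K k Q q. Ses E K k Q q T \<and> Q \<in> B \<inter> ?D \<and> K \<in> ?D" using K R.ses_objs[OF K(1)] by blast
    next
      fix T assume T: "T \<in> B \<inter> ?D"
      then have "diagonal n T" using i(1) by (auto simp: diagonal_def)
      then have "frag_of T \<in> K_relators n ?P" using T unfolding K_relators_def objP by blast
      then have "frag_of T \<in> K_relations n ?P" by (rule subsetD[OF RP(2)])
      then have "q (frag_of T) = q 0" unfolding q_eq by simp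
      then show "F T = \<one>\<^bsub>K_group n ?P\<^esub>" using F(2) T q_one by simp
    qed auto
  qed
  obtain h where h: "h \<in> hom (free_Abelian_group (Obj E)) (K_group n ?P)" "\<And>X. X \<in> Obj E \<Longrightarrow> h (frag_of X) = F X"
    using G.free_Abelian_group_universal[of F "Obj E"] additive_onD(1)[OF F(1)] by blast
  interpret h: group_hom "free_Abelian_group (Obj E)" "K_group n ?P" h
    by (intro group_hom.intro group_hom_axioms.intro group_free_Abelian_group G.is_group h(1))
  have h_add: "h (x + y) = h x \<otimes>\<^bsub>K_group n ?P\<^esub> h y" if "Poly_Mapping.keys x \<subseteq> Obj E" "Poly_Mapping.keys y \<subseteq> Obj E" for x y
    using h.hom_mult[of x y] that by simp
  have h_diff: "h (x - y) = h x \<otimes>\<^bsub>K_group n ?P\<^esub> inv\<^bsub>K_group n ?P\<^esub> h y"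
    if "Poly_Mapping.keys x \<subseteq> Obj E" "Poly_Mapping.keys y \<subseteq> Obj E" for x y
    using h_add[of x "- y"] h.hom_inv[of y] that by simp
  have "h x = \<one>\<^bsub>K_group n ?P\<^esub>" if rel: "x \<in> K_relators n C" for x
  proof -
    consider X i Y p Z where "x = frag_of X + frag_of Z - frag_of Y" "Ses E X i Y p Z"
      | T where "x = frag_of T" "T \<in> Obj E" "diagonal n T"
      using rel unfolding K_relators_def E_def by blast
    then show ?thesis
    proof cases
      case 1
      note o = R.ses_objs[OF 1(2)]
      have k: "Poly_Mapping.keys (frag_of X + frag_of Z) \<subseteq> Obj E" using keys_add[of "frag_of X" "frag_of Z"] o by auto
      have "h x = (F X \<otimes>\<^bsub>K_group n ?P\<^esub> F Z) \<otimes>\<^bsub>K_group n ?P\<^esub> inv\<^bsub>K_group n ?P\<^esub> F Y"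
        unfolding 1(1) using h_diff[OF k, of "frag_of Y"] h_add[of "frag_of X" "frag_of Z"] h(2) o by simp
      then show ?thesis using additive_onD(2)[OF F(1) 1(2)] additive_onD(1)[OF F(1)] o by simp
    next
      case 2 then show ?thesis using F_diag h(2) by simp
    qed
  qed
  then have "K_relators n C \<subseteq> kernel (free_Abelian_group (Obj E)) (K_group n ?P) h"
    using K_relators_subset[OF tM] unfolding kernel_def E_def by blast
  then have "K_relations n C \<subseteq> kernel (free_Abelian_group (Obj E)) (K_group n ?P) h"
    unfolding K_relations_def E_def[symmetric]
    by (rule group.generate_subgroup_incl[OF group_free_Abelian_group _ h.subgroup_kernel])
  then have h_rel: "h x = \<one>\<^bsub>K_group n ?P\<^esub>" if "x \<in> K_relations n C" for x using that by (auto simp: kernel_def)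
  \<comment> \<open>On elements supported on \<open>B\<close>, \<open>h\<close> returns the class
    that the subcategory assigns to them; hence the homomorphism it induces is a left inverse of the
    induced map.\<close>
  have h_q: "h x = q x" if "Poly_Mapping.keys x \<subseteq> B" for x
    using that
  proof (induction x rule: free_Abelian_group_induct[consumes 1])
    case 1 then show ?case using h.hom_one q_one by simp
  next
    case (2 x y)
    have k: "Poly_Mapping.keys (x - y) \<subseteq> B" using 2 keys_diff[of x y] by blast
    have "q (x - y) \<otimes>\<^bsub>K_group n ?P\<^esub> q y = q x" using q_mult[OF k 2(2)] by simp
    then have "q (x - y) = q x \<otimes>\<^bsub>K_group n ?P\<^esub> inv\<^bsub>K_group n ?P\<^esub> q y"
      using q_car 2(1,2) k G.inv_solve_right by metis
    then show ?case using h_diff 2 BE by (simp add: subset_trans)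
  next
    case (3 X) then show ?case using h(2) F(2) BE by auto
  qed

  have surj: "\<exists>a. Poly_Mapping.keys a \<subseteq> B \<and> x - a \<in> K_relations n C" if "Poly_Mapping.keys x \<subseteq> Obj E" for x
    using that
  proof (induction x rule: free_Abelian_group_induct[consumes 1])
    case 1 then show ?case using RM(3) by (intro exI[of _ 0]) simp
  next
    case (2 x y)
    then obtain a b where ab: "Poly_Mapping.keys a \<subseteq> B" "x - a \<in> K_relations n C" "Poly_Mapping.keys b \<subseteq> B" "y - b \<in> K_relations n C"
      by blast
    have e: "(x - y) - (a - b) = (x - a) - (y - b)" by simp
    have "(x - y) - (a - b) \<in> K_relations n C" unfolding e by (rule RM(5)[OF ab(2,4)])
    moreover have "Poly_Mapping.keys (a - b) \<subseteq> B" using ab keys_diff[of a b] by blast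
    ultimately show ?case by blast
  next
    case (3 X)
    \<comment> \<open>For a single object, the relation \<open>[X] = [Q] - [K]\<close> lowers the
      dimension until only objects of \<open>B\<close> remain.\<close>
    have "\<forall>X\<in>dim_class E B m. \<exists>a. Poly_Mapping.keys a \<subseteq> B \<and> frag_of X - a \<in> K_relations n C" for m
    proof (induction m)
      case 0
      show ?case
      proof
        fix X assume "X \<in> dim_class E B 0"
        then show "\<exists>a. Poly_Mapping.keys a \<subseteq> B \<and> frag_of X - a \<in> K_relations n C"
          using RM(3) by (intro exI[of _ "frag_of X"]) simp
      qed
    next
      case (Suc m)
      show ?case
      proof
        fix X assume "X \<in> dim_class E B (Suc m)"
        then obtain K k Q q where K: "Ses E K k Q q X" "K \<in> dim_class E B m" "Q \<in> dim_class E B m" by auto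
        obtain a where a: "Poly_Mapping.keys a \<subseteq> B" "frag_of K - a \<in> K_relations n C"
          using bspec[OF Suc K(2)] by blast
        obtain b where b: "Poly_Mapping.keys b \<subseteq> B" "frag_of Q - b \<in> K_relations n C"
          using bspec[OF Suc K(3)] by blast
        have e: "frag_of X - (b - a) = (frag_of K + frag_of X - frag_of Q) + ((frag_of Q - b) - (frag_of K - a))" by simp
        have "frag_of X - (b - a) \<in> K_relations n C" unfolding e by (rule RM(4)[OF relM[OF K(1)] RM(5)[OF b(2) a(2)]])
        moreover have "Poly_Mapping.keys (b - a) \<subseteq> B" using a(1) b(1) keys_diff[of b a] by blast
        ultimately show "\<exists>a. Poly_Mapping.keys a \<subseteq> B \<and> frag_of X - a \<in> K_relations n C" by blast
      qed
    qed
    then show ?case using R.finite_dim[OF 3] by blast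
  qed

  have carP: "carrier (K_group n ?P) = q ` {x. Poly_Mapping.keys x \<subseteq> B}" unfolding GP(2) q_def by blast
  have carM: "carrier (K_group n C) = qM ` {x. Poly_Mapping.keys x \<subseteq> Obj E}" unfolding GM(2) qM_def by blast
  show ?thesis
  proof (rule isoI)
    show "K_map n ?P C id id \<in> hom (K_group n ?P) (K_group n C)"
    proof (rule homI)
      show "K_map n ?P C id id c \<in> carrier (K_group n C)" if "c \<in> carrier (K_group n ?P)" for c
        using that BE map unfolding carP carM by auto
      fix c d assume "c \<in> carrier (K_group n ?P)" "d \<in> carrier (K_group n ?P)"
      then obtain x y where xy: "c = q x" "d = q y" "Poly_Mapping.keys x \<subseteq> B" "Poly_Mapping.keys y \<subseteq> B" unfolding carP by blast
      have "qM x \<otimes>\<^bsub>K_group n C\<^esub> qM y = qM (x + y)" unfolding qM_def by (rule GM(3)) (use xy BE in auto)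
      then show "K_map n ?P C id id (c \<otimes>\<^bsub>K_group n ?P\<^esub> d) =
          K_map n ?P C id id c \<otimes>\<^bsub>K_group n C\<^esub> K_map n ?P C id id d"
        using q_mult xy map by simp
    qed
    show "bij_betw (K_map n ?P C id id) (carrier (K_group n ?P)) (carrier (K_group n C))"
      unfolding bij_betw_def
    proof
      show "inj_on (K_map n ?P C id id) (carrier (K_group n ?P))"
      proof (rule inj_onI)
        fix c d assume "c \<in> carrier (K_group n ?P)" "d \<in> carrier (K_group n ?P)"
          and e: "K_map n ?P C id id c = K_map n ?P C id id d"
        then obtain x y where xy: "c = q x" "d = q y" "Poly_Mapping.keys x \<subseteq> B" "Poly_Mapping.keys y \<subseteq> B" unfolding carP by blast
        have "x - y \<in> K_relations n C" using e unfolding xy(1,2) map qM_eq .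
        moreover have "Poly_Mapping.keys (x - y) \<subseteq> B" using keys_diff[of x y] xy(3,4) by blast
        ultimately have "q (x - y) = q 0" using h_rel h_q q_one by metis
        then show "c = d" unfolding xy(1,2) q_eq by simp
      qed
      show "K_map n ?P C id id ` carrier (K_group n ?P) = carrier (K_group n C)"
      proof
        show "K_map n ?P C id id ` carrier (K_group n ?P) \<subseteq> carrier (K_group n C)"
          using BE map unfolding carP carM by auto
        show "carrier (K_group n C) \<subseteq> K_map n ?P C id id ` carrier (K_group n ?P)"
        proof
          fix c assume "c \<in> carrier (K_group n C)"
          then obtain x where x: "c = qM x" "Poly_Mapping.keys x \<subseteq> Obj E" unfolding carM by blast
          obtain a where a: "Poly_Mapping.keys a \<subseteq> B" "x - a \<in> K_relations n C" using surj[OF x(2)] by blast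
          have "c = K_map n ?P C id id (q a)" unfolding x(1) map qM_eq by (rule a(2))
          then show "c \<in> K_map n ?P C id id ` carrier (K_group n ?P)" using q_car[OF a(1)] by blast
        qed
      qed
    qed
  qed
qed

section \<open>The resolution theorem\<close>

lemma (in deflation_exact) ses_zero_iso:
  assumes S: "Ses C A i B p D" and D: "zero_object C D"
  shows "iso_mor C A i B"
proof -
  note s = ses_arrows[OF S]
  have o: "A \<in> Obj C" "B \<in> Obj C" using s by (auto simp: arrow_def)
  note idA = arrow_ident[OF o(1)] and idB = arrow_ident[OF o(2)]
  have "p \<cdot> Ident C B = Zero C B D" using to_zero[OF D s(2)] id_right[OF s(2)] by simp
  then obtain u where u: "arrow C u B A" "i \<cdot> u = Ident C B" using ses_lift[OF S idB] by blast
  have "i \<cdot> (u \<cdot> i) = i \<cdot> Ident C A" using assoc[OF s(1) u(1) s(1)] u(2) id_left[OF s(1)] id_right[OF s(1)] by simp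
  then have "u \<cdot> i = Ident C A" by (rule ses_mono[OF S arrow_comp[OF s(1) u(1)] idA])
  then show ?thesis using iso_morI[OF s(1) u(1)] u(2) by blast
qed

text \<open>The resolution is cut at its cycles into sequences
  \<open>Z k >-> N k ->> Z (k - 1)\<close>. Going down from the top, where the cycles vanish, each
  of them raises the dimension by at most one; the one for \<open>N 0\<close> is also the cover of
  \<open>X\<close>.\<close>

lemma (in deflation_exact) finite_resolution_dim:
  assumes res: "has_finite_resolution C P X" and zeros: "\<And>Z. zero_object C Z \<Longrightarrow> Z \<in> P"
    and mono: "\<And>j. P \<subseteq> dim_class C P j"
  shows "covered_by C P X" "\<exists>m. X \<in> dim_class C P m"
proof -
  obtain N d m where N: "acyclic_complex C N d" "N (-1) = X" "\<And>k. 0 \<le> k \<and> k \<le> int m \<Longrightarrow> N k \<in> P"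
    "\<And>k. k < -1 \<or> int m < k \<Longrightarrow> zero_object C (N k)"
    using res unfolding has_finite_resolution_def by blast
  obtain Z i p where Z: "\<And>k. Ses C (Z k) (i k) (N k) (p k) (Z (k - 1))" and "\<And>k. d k = i (k - 1) \<cdot> p k"
    using acyclicE[OF N(1)] by blast
  \<comment> \<open>\<open>Z m\<close> is zero as a quotient of \<open>N (m + 1)\<close>, so the
    induction starts in degree \<open>m\<close> and counts downwards.\<close>
  have "Z (int m - int j) \<in> dim_class C P j" if "j \<le> m" for j
    using that
  proof (induction j)
    case 0
    then show ?case using zeros[OF kernel_of_zero(2)[OF Z[of "int m + 1"] N(4)]] by simp
  next
    case (Suc j)
    then have "N (int m - int j) \<in> dim_class C P j" using mono N(3)[of "int m - int j"] by auto
    moreover have "Z (int m - int j) \<in> dim_class C P j" using Suc by simp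
    moreover have e: "int m - int (Suc j) = int m - int j - 1" by simp
    ultimately show ?case unfolding e using Z[of "int m - int j"] by auto
  qed
  from this[of m] have Z0: "Z 0 \<in> dim_class C P m" by simp
  \<comment> \<open>\<open>X\<close> sits in degree \<open>-1\<close>, where the complex ends. The
    cycles in degree \<open>-2\<close> vanish, so \<open>Z (-1)\<close> is isomorphic to
    \<open>X\<close>, and the sequence for \<open>N 0\<close> can be rewritten with quotient
    \<open>X\<close>.\<close>
  have "zero_object C (Z (-2))" using kernel_of_zero(1)[OF Z[of "-2"]] N(4)[of "-2"] by simp
  then have "iso_mor C (Z (-1)) (i (-1)) X" using ses_zero_iso[OF Z[of "-1"]] N(2) by simp
  moreover note s = ses_arrows[OF Z[of 0]] ses_objs[OF Z[of 0]] ses_arrows[OF Z[of "-1"]] ses_objs[OF Z[of "-1"]]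
  have a: "arrow C (i (-1)) (Z (-1)) X" "arrow C (p 0) (N 0) (Z (-1))" using s N(2) by simp_all
  have "Ses C (Z 0) (i 0) (N 0) (i (-1) \<cdot> p 0) X"
    by (rule ses_iso[OF Z[of 0], of _ _ _ _ _ "Ident C (Z 0)" "Ident C (N 0)" "i (-1)"])
      (use s N(2) iso_ident arrow_comp[OF a(2,1)] id_left[OF s(1)] id_right[OF s(1)] id_right[OF arrow_comp[OF a(2,1)]]
        calculation in \<open>auto simp: arrow_def\<close>)
  moreover have "N 0 \<in> P" using N(3)[of 0] by simp
  ultimately show "covered_by C P X" "\<exists>m. X \<in> dim_class C P m"
    using Z0 mono[of m] unfolding covered_by_def
    by (blast, intro exI[of _ "Suc m"], auto)
qed

theorem mainTheorem2:
  fixes M :: "('o, 'm) exact_cat" and P :: "'o set"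
  assumes "exact_category M"
    and "P \<subseteq> Obj M"
    and "additive_category (full_subcategory M P)"
    and "closed_under_extensions M P"
    and "\<And>A i B p D. \<lbrakk>Ses M A i B p D; B \<in> P; D \<in> P\<rbrakk> \<Longrightarrow> A \<in> P"
    and "\<And>N j Q. \<lbrakk>admissible_epi M N j Q; Q \<in> P\<rbrakk>
           \<Longrightarrow> \<exists>Q' j' f. Q' \<in> P \<and> admissible_epi M Q' j' Q \<and> f \<in> Hom M Q' N \<and> j \<cdot>\<^bsub>M\<^esub> f = j'"
    and "\<And>N. N \<in> Obj M \<Longrightarrow> has_finite_resolution M P N"
  shows "\<forall>n. K_map n (full_subcategory M P) M id id
              \<in> iso (K_group n (full_subcategory M P)) (K_group n M)"
proof -
  interpret D: deflation_exact M by (rule exact_category.deflation_exact[OF assms(1)])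
  have ext: "Y \<in> P" if "Ses M X i Y p Z" "X \<in> P" "Z \<in> P" for X i Y p Z
    using assms(4) that unfolding closed_under_extensions_def by blast
  \<comment> \<open>A zero object of the subcategory is only tested against objects of
    \<open>P\<close>. Uniqueness of its endomorphism already forces the identity to be zero, which
    makes it a zero object of \<open>M\<close>.\<close>
  obtain Z0 where "zero_object (full_subcategory M P) Z0"
    using additive_category.zero_object_exists[OF assms(3)] by blast
  then have Z0: "Z0 \<in> P" "\<exists>!f. f \<in> Hom M Z0 Z0" by (auto simp: zero_object_def full_subcategory_def)
  then have "Z0 \<in> Obj M" using assms(2) by blast
  then have Z0z: "zero_object M Z0"
    using Z0(2) D.zero_objectI arrow_homD[OF D.arrow_zero] D.ident_closed by metis
  \<comment> \<open>Any zero object of \<open>M\<close> is an extension of \<open>Z0\<close> by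
    \<open>Z0\<close>, so closure under extensions puts it in \<open>P\<close> once a single zero
    object is known to lie there.\<close>
  have zeros: "Z \<in> P" if "zero_object M Z" for Z
    using ext[OF D.ses_zeros[OF Z0z that Z0z] Z0(1) Z0(1)] .
  have mono: "P \<subseteq> dim_class M P j" for j
  proof (induction j)
    case (Suc j)
    show ?case
    proof
      fix X assume X: "X \<in> P"
      then have "Ses M Z0 (Zero M Z0 X) X (Ident M X) X" using D.ses_zero_left[OF Z0z] assms(2) by blast
      then show "X \<in> dim_class M P (Suc j)" using Suc X Z0(1) by auto
    qed
  qed simp
  have "finite_resolving_class M P"
    by unfold_locales
      (use assms(2,5) ext zeros D.finite_resolution_dim[OF assms(7) zeros mono] in blast)+
  then show ?thesis using K_map_inclusion_iso by blast
qed

end
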